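(* Let $\lambda,\mu,\alpha>0$ and suppose $\rho:=\frac{\lambda(\lambda+2\alpha)}{2\alpha\mu}<1$. Let $q_{m,n}(k)$ be the equilibrium distribution of the process $X(t)$ and let $\mathbf{p}=\{p(n,k):(n,k)\in S_*\}$ be the positive vector, both as described in the context. Then there is a constant $W>0$ such that for every fixed $(n,k)\in S_*$, $$\lim_{m\to\infty}\rho^{-2m}q_{m,n}(k)=W\,p(n,k).$$
   Context: Model: a single-server retrial system with two infinite-capacity orbit queues. Jobs arrive by a Poisson process of rate $\lambda$; an arrival finding the server idle starts service (exponential, rate $\mu$); an arrival finding the server busy joins the shorter orbit queue (each with probability $1/2$ in case of a tie). When the server is idle, each nonempty orbit sends a job to the server at rate $\alpha$. $Q_l(t)$ is the number of jobs in orbit $l$ and $C(t)\in\{0,1\}$ the server state (1 = busy). Set $X(t)=(X_1(t),X_2(t),C(t))$ with $X_1=\min\{Q_1,Q_2\}$, $X_2=|Q_2-Q_1|$, a continuous-time Markov chain on $\{(m,n,k):m,n\in\{0,1,2,\ldots\},k\in\{0,1\}\}$ with transition rates: - $(m,n,0)\to(m,n,1)$ at rate $\lambda$; $(m,n,1)\to(m,n,0)$ at rate $\mu$; - $(m,n,1)\to(m+1,n-1,1)$ at rate $\lambda$ if $n\ge1$; $(m,0,1)\to(m,1,1)$ at rate $\lambda$; - $(m,n,0)\to(m,n-1,1)$ at rate $\alpha$ if $n\ge1$; $(m,n,0)\to(m-1,n+1,1)$ at rate $\alpha$ if $m,n\ge1$; $(m,0,0)\to(m-1,1,1)$ at rate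 $2\alpha$ if $m\ge1$. $q_{m,n}(k)=\lim_{t\to\infty}\mathbb{P}(X(t)=(m,n,k))$. Let $S_*=\{0,1,2,\ldots\}\times\{0,1\}$. Let $K$ be the $S_*\times S_*$ matrix, written in $2\times2$ blocks indexed by $n\ge0$, that is block tridiagonal with diagonal blocks all equal to $K_0$, superdiagonal blocks $\bar K_1$ in block row $0$ and $K_1$ in block rows $n\ge1$, and subdiagonal blocks all equal to $K_{-1}$, where $$K_0=\begin{pmatrix}-(\lambda+2\alpha)&\lambda\\\mu&-(\lambda+\mu)\end{pmatrix},\quad \bar K_1=\begin{pmatrix}0&2\rho^2\alpha\\0&\lambda\end{pmatrix},\quad K_1=\begin{pmatrix}0&\rho^2\alpha\\0&0\end{pmatrix},\quad K_{-1}=\begin{pmatrix}0&\alpha\\0&\rho^{-2}\lambda\end{pmatrix}.$$ Let $\mathbf{v}=\big(1,\frac{\mu(\lambda+2\alpha)}{\lambda(\lambda+\mu+2\alpha)}\big)^{T}$, let $\Delta_v$ be the $2\times2$ diagonal matrix whose diagonal is $\mathbf{v}$, let $D=\mathrm{diag}(\Delta_v,\rho^{-1}\Delta_v,\rho^{-2}\Delta_v,\ldots)$ and $K_D=D^{-1}KD$. $K_D$ is an ergodic transition rate matrix; let $\bar\xi=\{\bar\xi_n,n\ge0\}$ (each $\bar\xi_n$ a $1\times 2$ row vector) be its stationary distribution, $\bar\xi K_D=\mathbf{0}$. Then $\mathbf{p}:=\bar\xi D^{-1}=\{\rho^n\bar\xi_n\Delta_v^{-1},n\ge0\}$, and $p(n,k)$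 denotes its $(n,k)$ entry. *)

theory Defs
  imports "HOL-Probability.Probability"
begin

definition generator :: "('s \<Rightarrow> 's \<Rightarrow> real) \<Rightarrow> 's \<Rightarrow> 's \<Rightarrow> real" where
  "generator r x y = (if x = y then - (\<Sum>\<^sub>\<infinity>z\<in>- {x}. r x z) else r x y)"

definition transition_function ::
  "('s \<Rightarrow> 's \<Rightarrow> real) \<Rightarrow> (real \<Rightarrow> 's \<Rightarrow> 's \<Rightarrow> real) \<Rightarrow> bool" where
  "transition_function Q P \<longleftrightarrow>
     (\<forall>t\<ge>0. \<forall>x y. 0 \<le> P t x y) \<and>
     (\<forall>t\<ge>0. \<forall>x. (P t x has_sum 1) UNIV) \<and>
     (\<forall>x y. P 0 x y = (if x = y then 1 else 0)) \<and>
     (\<forall>s\<ge>0. \<forall>t\<ge>0. \<forall>x y. ((\<lambda>z. P s x z * P t z y) has_sum P (s + t) x y) UNIV) \<and>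
     (\<forall>x y. ((\<lambda>t. P t x y) has_real_derivative Q x y) (at_right 0))"

(* The initial distribution is arbitrary. The Markov property is expressed through the
   finite-dimensional distributions; no regularity of the paths is required. *)
definition markov_chain ::
  "'w measure \<Rightarrow> ('s \<Rightarrow> 's \<Rightarrow> real) \<Rightarrow> (real \<Rightarrow> 'w \<Rightarrow> 's) \<Rightarrow> bool" where
  "markov_chain M Q X \<longleftrightarrow>
     prob_space M \<and>
     (\<forall>t\<ge>0. X t \<in> measurable M (count_space UNIV)) \<and>
     (\<exists>P. transition_function Q P \<and>
       (\<forall>(N::nat) (t::nat \<Rightarrow> real) (x::nat \<Rightarrow> 's).
          0 \<le> t 0 \<and> (\<forall>i<N. t i \<le> t (Suc i)) \<longrightarrow>
          measure M {\<omega> \<in> space M. \<forall>i\<le>N. X (t i) \<omega> = x i} =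
          measure M {\<omega> \<in> space M. X (t 0) \<omega> = x 0} *
          (\<Prod>i<N. P (t (Suc i) - t i) (x i) (x (Suc i)))))"

definition stationary_distribution :: "('s \<Rightarrow> 's \<Rightarrow> real) \<Rightarrow> ('s \<Rightarrow> real) \<Rightarrow> bool" where
  "stationary_distribution Q \<xi> \<longleftrightarrow>
     (\<forall>x. 0 \<le> \<xi> x) \<and> (\<xi> has_sum 1) UNIV \<and>
     (\<forall>y. ((\<lambda>x. \<xi> x * Q x y) has_sum 0) UNIV)"

(* Server state: False encodes 0 (idle), True encodes 1 (busy). In a state (m, n, k), m is the
   length of the shorter orbit and n the difference of the two orbit lengths. *)
definition retrial_rate ::
  "real \<Rightarrow> real \<Rightarrow> real \<Rightarrow> nat \<times> nat \<times> bool \<Rightarrow> nat \<times> nat \<times> bool \<Rightarrow> real" where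
  "retrial_rate lam \<mu> \<alpha> = (\<lambda>(m, n, k) y.
     if k then
       (if y = (m, n, False) then \<mu>
        else if n \<ge> 1 \<and> y = (m + 1, n - 1, True) then lam
        else if n = 0 \<and> y = (m, 1, True) then lam
        else 0)
     else
       (if y = (m, n, True) then lam
        else if n \<ge> 1 \<and> y = (m, n - 1, True) then \<alpha>
        else if m \<ge> 1 \<and> n \<ge> 1 \<and> y = (m - 1, n + 1, True) then \<alpha>
        else if m \<ge> 1 \<and> n = 0 \<and> y = (m - 1, 1, True) then 2 * \<alpha>
        else 0))"

definition rho :: "real \<Rightarrow> real \<Rightarrow> real \<Rightarrow> real" where
  "rho lam \<mu> \<alpha> = lam * (lam + 2 * \<alpha>) / (2 * \<alpha> * \<mu>)"

(* The 2 x 2 matrix with rows (a, b) and (c, d), indexed by the server state. *)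
definition mat2 :: "real \<Rightarrow> real \<Rightarrow> real \<Rightarrow> real \<Rightarrow> bool \<Rightarrow> bool \<Rightarrow> real" where
  "mat2 a b c d i j = (if i then (if j then d else c) else (if j then b else a))"

definition K0 :: "real \<Rightarrow> real \<Rightarrow> real \<Rightarrow> bool \<Rightarrow> bool \<Rightarrow> real" where
  "K0 lam \<mu> \<alpha> = mat2 (- (lam + 2 * \<alpha>)) lam
                       \<mu> (- (lam + \<mu>))"

definition K1bar :: "real \<Rightarrow> real \<Rightarrow> real \<Rightarrow> bool \<Rightarrow> bool \<Rightarrow> real" where
  "K1bar lam \<mu> \<alpha> = mat2 0 (2 * (rho lam \<mu> \<alpha>)\<^sup>2 * \<alpha>)
                          0 lam"

definition K1 :: "real \<Rightarrow> real \<Rightarrow> real \<Rightarrow> bool \<Rightarrow> bool \<Rightarrow> real" where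
  "K1 lam \<mu> \<alpha> = mat2 0 ((rho lam \<mu> \<alpha>)\<^sup>2 * \<alpha>)
                       0 0"

definition Km1 :: "real \<Rightarrow> real \<Rightarrow> real \<Rightarrow> bool \<Rightarrow> bool \<Rightarrow> real" where
  "Km1 lam \<mu> \<alpha> = mat2 0 \<alpha>
                        0 (rho lam \<mu> \<alpha> powi (-2) * lam)"

definition K :: "real \<Rightarrow> real \<Rightarrow> real \<Rightarrow> nat \<times> bool \<Rightarrow> nat \<times> bool \<Rightarrow> real" where
  "K lam \<mu> \<alpha> = (\<lambda>(n, i) (n', j).
     if n' = n then K0 lam \<mu> \<alpha> i j
     else if n' = n + 1 then (if n = 0 then K1bar lam \<mu> \<alpha> i j else K1 lam \<mu> \<alpha> i j)
     else if n = n' + 1 then Km1 lam \<mu> \<alpha> i j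
     else 0)"

definition v :: "real \<Rightarrow> real \<Rightarrow> real \<Rightarrow> bool \<Rightarrow> real" where
  "v lam \<mu> \<alpha> k = (if k then \<mu> * (lam + 2 * \<alpha>) / (lam * (lam + \<mu> + 2 * \<alpha>)) else 1)"

(* The diagonal of the diagonal matrix D. *)
definition D :: "real \<Rightarrow> real \<Rightarrow> real \<Rightarrow> nat \<times> bool \<Rightarrow> real" where
  "D lam \<mu> \<alpha> = (\<lambda>(n, k). rho lam \<mu> \<alpha> powi (- int n) * v lam \<mu> \<alpha> k)"

(* The matrix product D^{-1} K D, with D diagonal. *)
definition KD :: "real \<Rightarrow> real \<Rightarrow> real \<Rightarrow> nat \<times> bool \<Rightarrow> nat \<times> bool \<Rightarrow> real" where
  "KD lam \<mu> \<alpha> x y = inverse (D lam \<mu> \<alpha> x) * K lam \<mu> \<alpha> x y * D lam \<mu> \<alpha> y"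

definition p_vec :: "real \<Rightarrow> real \<Rightarrow> real \<Rightarrow> (nat \<times> bool \<Rightarrow> real) \<Rightarrow> nat \<times> bool \<Rightarrow> real" where
  "p_vec lam \<mu> \<alpha> \<xi> x = \<xi> x * inverse (D lam \<mu> \<alpha> x)"

end

theory Submission
  imports Defs "HOL-Complex_Analysis.Complex_Analysis"
begin

text \<open>
Let \<open>R = 1 / \<rho>\<^sup>2\<close>. The proof finds the dominant singularity of the generating function
\<open>A(x) = \<Sum>\<^sub>m\<^sub>\<ge>\<^sub>1 q\<^sub>m\<^sub>,\<^sub>0(0) x\<^sup>m\<close>: a simple pole at \<open>R\<close>. It combines the kernel method for random walks in the quarter
plane with Lyapunov functions.

The limits \<open>q\<close> inherit \<open>q P\<^sub>s \<le> q\<close> from the Markov property, hence \<open>q Q \<le> 0\<close>. The rates are bounded, so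
by Fubini the entries of \<open>q Q\<close> add up to \<open>0\<close>, and the balance equations \<open>q Q = 0\<close> hold (\<open>retrial_stationary\<close>).

Pair these equations with a weight \<open>x\<^sup>m y\<^sup>n u\<^sup>k\<close>. If \<open>y\<close> and \<open>u\<close> are chosen so that the drift of the weight
vanishes in the interior, only boundary terms survive, and \<open>A(x)\<close> is expressed by the series
\<open>B(y) = \<Sum>\<^sub>n\<^sub>\<ge>\<^sub>1 q\<^sub>0\<^sub>,\<^sub>n(0) y\<^sup>n\<^sup>-\<^sup>1\<close> (\<open>boundary_identity\<close>). With \<open>r = \<surd>(1 + \<rho>\<^sup>2 - 1 / x)\<close> the relevant branch is
\<open>y = x (1 + \<rho> - r)\<close>, and the coefficient of \<open>A(x)\<close> factors as a multiple of
\<open>x (r - 1) (r - \<rho>) (r + 1 + \<rho>)\<close> (\<open>kernel_branch_real\<close>). Near the circle of radius \<open>R\<close> its only zero is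
\<open>r = 1\<close>, that is \<open>x = R\<close>, \<open>y = 1 / \<rho>\<close>. Provided that \<open>B\<close> converges beyond \<open>1 / \<rho>\<close>, the product
\<open>(1 - x / R) A(x)\<close> continues analytically past \<open>R\<close>, and so \<open>R\<^sup>m q\<^sub>m\<^sub>,\<^sub>0(0)\<close> converges to its value at \<open>R\<close>
(\<open>coefficient_limit_at_simple_pole\<close>, \<open>boundary_phase_limit\<close>). This value is a combination with positive
coefficients of the boundary probabilities \<open>q\<^sub>0\<^sub>,\<^sub>n(0)\<close>.

Two inputs are quantitative: the convergence of these series (\<open>retrial_moments\<close>), and the fact that the
boundary probabilities do not all vanish (\<open>retrial_recurrence\<close>), which makes the limit positive. Both
come from one Lyapunov function, a sum of two geometric weights, applied through finitely supported
truncations and hence before any moment of \<open>q\<close> is known to be finite.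

The phases \<open>n \<ge> 1\<close> follow by induction. By the balance equations \<open>c\<^sub>m = R\<^sup>m q\<^sub>m\<^sub>,\<^sub>n\<^sub>+\<^sub>1(0)\<close> satisfies
that \<open>c\<^sub>m\<^sub>+\<^sub>1 + (2 / \<rho>) c\<^sub>m\<close> converges if the limits for the phases up to \<open>n\<close> exist; since \<open>c\<close> is nonnegative
and \<open>2 / \<rho> > 1\<close>, this forces convergence (\<open>phase_limits\<close>). The limits obey the same second-order
recursion as \<open>\<^bold>p\<close>, whose solutions are determined by their first entry (\<open>phase_recursion_unique\<close>). So they are
a multiple of \<open>\<^bold>p\<close>.
\<close>

section \<open>Foster--Lyapunov bounds for finite truncations\<close>

lemma markov_chain_event:
  assumes "markov_chain M Q X" "0 \<le> t"
  shows "{\<omega> \<in> space M. X t \<omega> = x} \<in> sets M"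
proof -
  have "X t \<in> measurable M (count_space UNIV)" using assms by (simp add: markov_chain_def)
  then have "X t -` {x} \<inter> space M \<in> sets M" by (rule measurable_sets) auto
  moreover have "X t -` {x} \<inter> space M = {\<omega> \<in> space M. X t \<omega> = x}" by auto
  ultimately show ?thesis by simp
qed

text \<open>Finitely many intermediate states at time \<open>t\<close> already give a lower bound for the law at
time \<open>t + s\<close>. Such finite partial sums survive a pointwise limit \<open>t \<rightarrow> \<infinity>\<close>, whereas an infinite sum
could lose mass.\<close>

lemma markov_chain_marginal_step:
  assumes M: "markov_chain M Q X"
  obtains P where "transition_function Q P"
    and "\<And>s t F y. 0 \<le> s \<Longrightarrow> 0 \<le> t \<Longrightarrow> finite F \<Longrightarrow>
      (\<Sum>z\<in>F. measure M {\<omega> \<in> space M. X t \<omega> = z} * P s z y) \<le> measure M {\<omega> \<in> space M. X (t + s) \<omega> = y}"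
proof -
  from M obtain P where P: "transition_function Q P" and
    fd: "\<And>(N::nat) (t::nat \<Rightarrow> real) x. 0 \<le> t 0 \<and> (\<forall>i<N. t i \<le> t (Suc i)) \<Longrightarrow>
          measure M {\<omega> \<in> space M. \<forall>i\<le>N. X (t i) \<omega> = x i} =
          measure M {\<omega> \<in> space M. X (t 0) \<omega> = x 0} *
          (\<Prod>i<N. P (t (Suc i) - t i) (x i) (x (Suc i)))"
    and pm: "prob_space M"
    unfolding markov_chain_def by auto
  interpret prob_space M by (rule pm)
  note ev = markov_chain_event[OF M]
  have "(\<Sum>z\<in>F. measure M {\<omega> \<in> space M. X t \<omega> = z} * P s z y) \<le> measure M {\<omega> \<in> space M. X (t + s) \<omega> = y}"
    if "0 \<le> s" "0 \<le> t" "finite F" for s t F y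
  proof -
    let ?E = "\<lambda>z. {\<omega> \<in> space M. X t \<omega> = z} \<inter> {\<omega> \<in> space M. X (t + s) \<omega> = y}"
    have joint: "measure M {\<omega> \<in> space M. X t \<omega> = z} * P s z y = measure M (?E z)" for z
    proof -
      have "{\<omega> \<in> space M. \<forall>i\<le>Suc 0. X ((\<lambda>i. if i = 0 then t else t + s) i) \<omega> = (\<lambda>i. if i = 0 then z else y) i} = ?E z"
        by (auto simp: le_Suc_eq)
      then show ?thesis
        using fd[of "\<lambda>i. if i = 0 then t else t + s" "Suc 0" "\<lambda>i. if i = 0 then z else y"] that by simp
    qed
    have "(\<Sum>z\<in>F. measure M (?E z)) = measure M (\<Union>z\<in>F. ?E z)"
      by (rule finite_measure_finite_Union[symmetric]) (use that ev in \<open>auto simp: disjoint_family_on_def\<close>)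
    also have "\<dots> \<le> measure M {\<omega> \<in> space M. X (t + s) \<omega> = y}"
      by (rule finite_measure_mono) (use that ev in auto)
    finally show ?thesis by (simp add: joint)
  qed
  with P that show thesis by blast
qed

lemma transition_function_difference_quotient:
  assumes "transition_function Q P"
  shows "((\<lambda>s. (P s z y - (if z = y then 1 else 0)) / s) \<longlongrightarrow> Q z y) (at_right 0)"
proof -
  have "P 0 z y = (if z = y then 1 else 0)" "((\<lambda>t. P t z y) has_real_derivative Q z y) (at_right 0)"
    using assms unfolding transition_function_def by blast+
  then show ?thesis unfolding has_field_derivative_iff by (simp only: diff_zero)
qed

text \<open>Differentiating \<open>q P\<^sub>s \<le> q\<close> at \<open>s = 0\<close>. The sum is restricted to a finite set that contains \<open>y\<close>,
so that limit and sum commute; the discarded terms are off-diagonal and hence nonnegative.\<close>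

lemma substationary_generator:
  assumes P: "transition_function Q P"
    and sub: "\<And>s. 0 \<le> s \<Longrightarrow> (\<Sum>z\<in>F. q z * P s z y) \<le> q y"
    and F: "finite F" "y \<in> F"
  shows "(\<Sum>z\<in>F. q z * Q z y) \<le> (0::real)"
proof -
  note lim = transition_function_difference_quotient[OF P]
  have "((\<lambda>s. \<Sum>z\<in>F. q z * ((P s z y - (if z = y then 1 else 0)) / s)) \<longlongrightarrow> (\<Sum>z\<in>F. q z * Q z y)) (at_right 0)"
    by (intro tendsto_intros lim)
  moreover have "\<forall>\<^sub>F s in at_right 0. (\<Sum>z\<in>F. q z * ((P s z y - (if z = y then 1 else 0)) / s)) \<le> 0"
  proof (rule eventually_mono[OF eventually_at_right_less[of "0::real"]])
    fix s :: real assume s: "0 < s"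
    have "(\<Sum>z\<in>F. q z * ((P s z y - (if z = y then 1 else 0)) / s))
        = ((\<Sum>z\<in>F. q z * P s z y) - (\<Sum>z\<in>F. q z * (if z = y then 1 else 0))) / s"
      by (simp add: sum_divide_distrib right_diff_distrib sum_subtractf diff_divide_distrib)
    also have "(\<Sum>z\<in>F. q z * (if z = y then 1 else 0)) = q y"
      using F by (simp add: if_distrib cong: if_cong)
    finally show "(\<Sum>z\<in>F. q z * ((P s z y - (if z = y then 1 else 0)) / s)) \<le> 0"
      using sub[of s] s by (simp add: divide_le_0_iff)
  qed
  ultimately show ?thesis by (rule tendsto_upperbound) simp
qed

text \<open>A Lyapunov function \<open>f\<close> is unbounded, so \<open>Q f\<close> cannot be integrated against a measure whose moments
are not yet known. The truncation \<open>(R - f)\<^sup>+\<close> has finite support if the sublevel sets of \<open>f\<close> are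
finite. It dominates \<open>R - f\<close> everywhere, with equality at the points \<open>z\<close> of its support; so its drift
at \<open>z\<close> is at least \<open>- Q f\<close>.\<close>

lemma truncated_Lyapunov:
  fixes f :: "'s \<Rightarrow> real"
  assumes offdiag: "\<And>y. y \<noteq> z \<Longrightarrow> 0 \<le> Q z y"
    and row: "(Q z has_sum 0) UNIV"
    and drift: "((\<lambda>y. Q z y * f y) has_sum d) UNIV"
    and fin: "finite {x. f x < R}"
    and z: "f z < R"
  shows "- d \<le> (\<Sum>y | f y < R. Q z y * (R - f y))"
proof -
  have "((\<lambda>y. R * Q z y + - (Q z y * f y)) has_sum (R * 0 + - d)) UNIV"
    by (intro has_sum_add has_sum_uminusI has_sum_cmult_right row drift)
  then have "((\<lambda>y. R * Q z y - Q z y * f y) has_sum - d) UNIV" by simp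
  moreover have "((\<lambda>y. Q z y * max 0 (R - f y)) has_sum (\<Sum>y | f y < R. Q z y * (R - f y))) UNIV"
    by (rule has_sum_finite_neutralI[OF fin]) (auto intro!: sum.cong)
  moreover have "R * Q z y - Q z y * f y \<le> Q z y * max 0 (R - f y)" for y
  proof (cases "y = z")
    case True
    then show ?thesis using z by (simp add: algebra_simps max_def)
  next
    case False
    have "Q z y * (R - f y) \<le> Q z y * max 0 (R - f y)"
      by (rule mult_left_mono) (use offdiag[OF False] in auto)
    then show ?thesis by (simp add: algebra_simps)
  qed
  ultimately show ?thesis by (rule has_sum_mono)
qed

text \<open>Pairing \<open>q Q \<le> 0\<close> with the truncation \<open>(R - f)\<^sup>+\<close> is a finite computation and bounds the partial
sum of \<open>q g\<close> over the set where \<open>f < R\<close> by \<open>b\<close>, uniformly in \<open>R\<close>.\<close>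

lemma substationary_moment_bound:
  fixes q f g d :: "'s \<Rightarrow> real"
  assumes q0: "\<And>x. 0 \<le> q x" and q1: "\<And>F. finite F \<Longrightarrow> sum q F \<le> 1"
    and sub: "\<And>F y. finite F \<Longrightarrow> y \<in> F \<Longrightarrow> (\<Sum>z\<in>F. q z * Q z y) \<le> 0"
    and offdiag: "\<And>x y. x \<noteq> y \<Longrightarrow> 0 \<le> Q x y"
    and row: "\<And>x. (Q x has_sum 0) UNIV"
    and drift: "\<And>x. ((\<lambda>y. Q x y * f y) has_sum d x) UNIV"
    and fin: "\<And>R. finite {x. f x < R}"
    and Lyap: "\<And>x. d x \<le> b - g x"
    and g0: "\<And>x. 0 \<le> g x" and b0: "0 \<le> b"
  shows "(\<lambda>x. q x * g x) summable_on UNIV"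
proof -
  have bound: "(\<Sum>x\<in>F. q x * g x) \<le> b" if F: "finite F" for F
  proof -
    define R where "R = Max (insert 0 (f ` F)) + 1"
    define S where "S = {x. f x < R}"
    have S: "finite S" unfolding S_def by (rule fin)
    have "F \<subseteq> S"
    proof
      fix x assume "x \<in> F"
      then have "f x \<le> Max (insert 0 (f ` F))" using F by (intro Max_ge) auto
      then show "x \<in> S" by (simp add: S_def R_def)
    qed
    have "(\<Sum>x\<in>S. q x * (g x - b)) \<le> (\<Sum>x\<in>S. q x * (\<Sum>y\<in>S. Q x y * (R - f y)))"
    proof (intro sum_mono mult_left_mono q0)
      fix x assume "x \<in> S"
      then have "- d x \<le> (\<Sum>y\<in>S. Q x y * (R - f y))"
        unfolding S_def by (intro truncated_Lyapunov offdiag row drift fin) auto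
      then show "g x - b \<le> (\<Sum>y\<in>S. Q x y * (R - f y))" using Lyap[of x] by simp
    qed
    also have "\<dots> = (\<Sum>y\<in>S. \<Sum>x\<in>S. q x * (Q x y * (R - f y)))"
      by (subst sum.swap) (simp add: sum_distrib_left)
    also have "\<dots> = (\<Sum>y\<in>S. (R - f y) * (\<Sum>x\<in>S. q x * Q x y))"
      by (simp add: sum_distrib_left mult_ac)
    also have "\<dots> \<le> 0"
      by (intro sum_nonpos mult_nonneg_nonpos sub S) (auto simp: S_def)
    finally have "(\<Sum>x\<in>S. q x * g x) \<le> b * sum q S"
      by (simp add: right_diff_distrib sum_subtractf sum_distrib_left mult.commute)
    also have "\<dots> \<le> b * 1" by (intro mult_left_mono q1 S b0)
    finally have "(\<Sum>x\<in>S. q x * g x) \<le> b" by simp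
    moreover have "(\<Sum>x\<in>F. q x * g x) \<le> (\<Sum>x\<in>S. q x * g x)"
      by (rule sum_mono2) (use \<open>F \<subseteq> S\<close> S q0 g0 in auto)
    ultimately show ?thesis by linarith
  qed
  show ?thesis
    by (rule nonneg_bounded_partial_sums_imp_summable_on[where C = b])
       (use q0 g0 bound in \<open>auto intro: eventually_finite_subsets_at_top_weakI\<close>)
qed

text \<open>The drift condition prevents the mass started at \<open>x\<^sub>0\<close> from leaving the finite set \<open>C\<close> for good:
once the probability of \<open>C\<close> is small, the mean of \<open>min f R\<close> decreases at a fixed rate for as
long as it stays below \<open>R / 2\<close>, and would become negative. The argument runs on a time grid of step
\<open>h\<close>, chosen so small that the finitely many difference quotients of \<open>P\<close> at \<open>0\<close> that matter are close
to \<open>Q\<close>. In the proof \<open>G j\<close> is the mean of \<open>(R - f)\<^sup>+\<close>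
at time \<open>j h\<close>, that is, \<open>R\<close> minus the mean of \<open>min f R\<close>.\<close>

lemma Lyapunov_recurrence:
  fixes f d :: "'s \<Rightarrow> real"
  assumes P: "transition_function Q P"
    and offdiag: "\<And>x y. x \<noteq> y \<Longrightarrow> 0 \<le> Q x y"
    and row: "\<And>x. (Q x has_sum 0) UNIV"
    and drift: "\<And>x. ((\<lambda>y. Q x y * f y) has_sum d x) UNIV"
    and fin: "\<And>R. finite {x. f x < R}"
    and f0: "\<And>x. 0 \<le> f x"
    and e: "0 < e" and b: "0 \<le> b" and C: "finite C"
    and Lyap: "\<And>x. d x \<le> (if x \<in> C then b else 0) - e"
  shows "\<not> (\<forall>y\<in>C. ((\<lambda>t. P t x0 y) \<longlongrightarrow> 0) at_top)"
proof
  assume lim: "\<forall>y\<in>C. ((\<lambda>t. P t x0 y) \<longlongrightarrow> 0) at_top"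
  have P0: "0 \<le> P t x y" if "0 \<le> t" for t x y
    using P that unfolding transition_function_def by blast
  have Psum: "(P t x has_sum 1) UNIV" if "0 \<le> t" for t x
    using P that unfolding transition_function_def by blast
  have Pfin: "sum (P t x) F \<le> 1" if "0 \<le> t" "finite F" for t x F
    using has_sum_mono_neutral[OF has_sum_finite[OF that(2)] Psum[OF that(1), of x]] P0[OF that(1)] by auto
  have PI: "P 0 x y = (if x = y then 1 else 0)" for x y
    using P unfolding transition_function_def by blast
  have CK: "((\<lambda>z. P s x z * P t z y) has_sum P (s + t) x y) UNIV" if "0 \<le> s" "0 \<le> t" for s t x y
    using P that unfolding transition_function_def by blast
  have CKfin: "(\<Sum>z\<in>F. P s x z * P t z y) \<le> P (s + t) x y" if "0 \<le> s" "0 \<le> t" "finite F" for s t x y F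
    using has_sum_mono_neutral[OF has_sum_finite[OF that(3)] CK[OF that(1,2), of x y]] P0 that by auto
  note der = transition_function_difference_quotient[OF P]
  have "((\<lambda>t. \<Sum>y\<in>C. P t x0 y) \<longlongrightarrow> (\<Sum>y\<in>C. 0)) at_top"
    by (intro tendsto_sum) (use lim in auto)
  then have "\<forall>\<^sub>F t in at_top. (\<Sum>y\<in>C. P t x0 y) < e / (4 * (b + 1))"
    by (rule order_tendstoD(2)) (use e b in auto)
  then obtain T0 where T0: "\<And>t. t \<ge> T0 \<Longrightarrow> (\<Sum>y\<in>C. P t x0 y) < e / (4 * (b + 1))"
    unfolding eventually_at_top_linorder by blast
  \<comment> \<open>Before time T the mean of min f R grows by at most (b + 1) per unit of time, so it stays below M.\<close>
  define T where "T = max T0 0"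
  define M where "M = f x0 + (b + 1) * (T + 1)"
  have bT: "0 < (b + 1) * (T + 1)" unfolding T_def using b by (intro mult_pos_pos) auto
  have M: "0 < M" "f x0 < M" unfolding M_def using f0[of x0] bT by auto
  define R where "R = 2 * M"
  define S where "S = {x. f x < R}"
  have S: "finite S" unfolding S_def by (rule fin)
  define ph where "ph y = R - f y" for y
  have x0: "x0 \<in> S" unfolding S_def R_def using M by simp
  have ph0: "0 \<le> ph y" "ph y \<le> R" if "y \<in> S" for y
    using that f0[of y] by (auto simp: S_def ph_def)
  \<comment> \<open>Admissible error of the difference quotients on the finite set S.\<close>
  define dl where "dl = min 1 (e / 8)"
  have dl: "0 < dl" "dl \<le> 1" "dl \<le> e / 8" using e by (auto simp: dl_def)
  define L where "L z = (\<Sum>y\<in>S. Q z y * ph y)" for z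
  have Lge: "e - (if z \<in> C then b else 0) \<le> L z" if "z \<in> S" for z
  proof -
    have "- d z \<le> L z" unfolding L_def ph_def S_def
      by (rule truncated_Lyapunov) (use offdiag row drift fin that in \<open>auto simp: S_def\<close>)
    then show ?thesis using Lyap[of z] by linarith
  qed
  have "\<forall>\<^sub>F h in at_right 0. \<forall>z\<in>S. (\<Sum>y\<in>S. (P h z y - (if z = y then 1 else 0)) / h * ph y) > L z - dl"
  proof (intro eventually_ball_finite[OF S] ballI)
    fix z assume "z \<in> S"
    have "((\<lambda>h. \<Sum>y\<in>S. (P h z y - (if z = y then 1 else 0)) / h * ph y) \<longlongrightarrow> L z) (at_right 0)"
      unfolding L_def by (intro tendsto_intros der)
    then show "\<forall>\<^sub>F h in at_right 0. (\<Sum>y\<in>S. (P h z y - (if z = y then 1 else 0)) / h * ph y) > L z - dl"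
      by (rule order_tendstoD(1)) (use dl in auto)
  qed
  moreover have "\<forall>\<^sub>F h in at_right 0. h < (1::real)"
    by (rule eventually_at_rightI[of 0 1]) auto
  ultimately have "\<forall>\<^sub>F h in at_right 0. h > 0 \<and> h < 1 \<and>
      (\<forall>z\<in>S. (\<Sum>y\<in>S. (P h z y - (if z = y then 1 else 0)) / h * ph y) > L z - dl)"
    using eventually_at_right_less[of "0::real"] by eventually_elim auto
  then obtain h where h: "0 < h" "h < 1" and
    hS: "\<And>z. z \<in> S \<Longrightarrow> (\<Sum>y\<in>S. (P h z y - (if z = y then 1 else 0)) / h * ph y) > L z - dl"
    using eventually_happens'[OF trivial_limit_at_right_real] by blast
  have one: "ph z + h * (L z - dl) \<le> (\<Sum>y\<in>S. P h z y * ph y)" if "z \<in> S" for z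
  proof -
    have "(\<Sum>y\<in>S. (P h z y - (if z = y then 1 else 0)) / h * ph y)
       = ((\<Sum>y\<in>S. P h z y * ph y) - (\<Sum>y\<in>S. (if z = y then 1 else 0) * ph y)) / h"
      by (simp add: sum_divide_distrib left_diff_distrib sum_subtractf diff_divide_distrib)
    also have "(\<Sum>y\<in>S. (if z = y then 1 else 0) * ph y) = ph z"
      using S that by (simp add: if_distrib[where f="\<lambda>x. x * _"] cong: if_cong)
    finally have "L z - dl < ((\<Sum>y\<in>S. P h z y * ph y) - ph z) / h" using hS[OF that] by simp
    then show ?thesis using h by (simp add: pos_less_divide_eq mult.commute)
  qed
  define G where "G j = (\<Sum>y\<in>S. ph y * P (real j * h) x0 y)" for j :: nat
  define PC where "PC j = (\<Sum>y\<in>C. P (real j * h) x0 y)" for j :: nat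
  have jh: "0 \<le> real j * h" for j using h by simp
  have step: "G (Suc j) \<ge> G j + h * (e * (G j / R) - b * PC j - dl)" for j
  proof -
    let ?p = "P (real j * h) x0"
    have "(\<Sum>z\<in>S. ?p z * (ph z + h * (L z - dl))) \<le> (\<Sum>z\<in>S. ?p z * (\<Sum>y\<in>S. P h z y * ph y))"
      by (intro sum_mono mult_left_mono one P0 jh)
    also have "\<dots> = (\<Sum>y\<in>S. \<Sum>z\<in>S. ?p z * (P h z y * ph y))"
      by (subst sum.swap) (simp add: sum_distrib_left)
    also have "\<dots> = (\<Sum>y\<in>S. ph y * (\<Sum>z\<in>S. ?p z * P h z y))"
      by (simp add: sum_distrib_left mult_ac)
    also have "\<dots> \<le> G (Suc j)" unfolding G_def
    proof (intro sum_mono mult_left_mono ph0)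
      fix y show "(\<Sum>z\<in>S. ?p z * P h z y) \<le> P (real (Suc j) * h) x0 y"
        using CKfin[OF jh[of j] _ S, of h x0 y] h by (simp add: algebra_simps)
    qed
    finally have 1: "G j + h * (\<Sum>z\<in>S. ?p z * (L z - dl)) \<le> G (Suc j)"
      by (simp add: G_def distrib_left sum.distrib sum_distrib_left mult_ac)
    have "(\<Sum>z\<in>S. ?p z * (L z - dl)) \<ge> (\<Sum>z\<in>S. ?p z * (e - (if z \<in> C then b else 0) - dl))"
      by (intro sum_mono mult_left_mono diff_right_mono Lge P0 jh)
    also have "(\<Sum>z\<in>S. ?p z * (e - (if z \<in> C then b else 0) - dl))
       = e * sum ?p S - (\<Sum>z\<in>S. if z \<in> C then b * ?p z else 0) - dl * sum ?p S"
    proof -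
      have "?p z * (e - (if z \<in> C then b else 0) - dl) = e * ?p z - (if z \<in> C then b * ?p z else 0) - dl * ?p z" for z
        by (simp add: algebra_simps)
      then show ?thesis by (simp only: sum_subtractf sum_distrib_left)
    qed
    also have "(\<Sum>z\<in>S. if z \<in> C then b * ?p z else 0) = (\<Sum>z\<in>S \<inter> C. b * ?p z)"
      by (simp add: sum.inter_restrict S)
    finally have 2: "(\<Sum>z\<in>S. ?p z * (L z - dl)) \<ge> e * sum ?p S - (\<Sum>z\<in>S \<inter> C. b * ?p z) - dl * sum ?p S" by simp
    have "(\<Sum>z\<in>S \<inter> C. b * ?p z) \<le> (\<Sum>z\<in>C. b * ?p z)"
      by (rule sum_mono2) (use C b P0[OF jh] in auto)
    then have 3: "(\<Sum>z\<in>S \<inter> C. b * ?p z) \<le> b * PC j" by (simp add: PC_def sum_distrib_left)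
    have 4: "dl * sum ?p S \<le> dl * 1" by (intro mult_left_mono Pfin jh S) (use dl in auto)
    have "G j \<le> (\<Sum>y\<in>S. R * ?p y)" unfolding G_def by (intro sum_mono mult_right_mono ph0 P0 jh)
    then have "G j / R \<le> sum ?p S" using M by (simp add: R_def field_simps sum_distrib_left)
    then have 5: "e * (G j / R) \<le> e * sum ?p S" using e by (intro mult_left_mono) auto
    have "e * (G j / R) - b * PC j - dl \<le> (\<Sum>z\<in>S. ?p z * (L z - dl))"
      using 2 3 4 5 by linarith
    then have "h * (e * (G j / R) - b * PC j - dl) \<le> h * (\<Sum>z\<in>S. ?p z * (L z - dl))"
      using h by (intro mult_left_mono) auto
    with 1 show ?thesis by linarith
  qed
  have Gle: "G j \<le> R" for j
  proof -
    have "G j \<le> (\<Sum>y\<in>S. R * P (real j * h) x0 y)" unfolding G_def by (intro sum_mono mult_right_mono ph0 P0 jh)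
    also have "\<dots> = R * sum (P (real j * h) x0) S" by (simp add: sum_distrib_left)
    also have "\<dots> \<le> R * 1" by (intro mult_left_mono Pfin jh S) (use M in \<open>auto simp: R_def\<close>)
    finally show ?thesis by simp
  qed
  have G0: "0 \<le> G j" for j unfolding G_def by (intro sum_nonneg mult_nonneg_nonneg ph0 P0 jh)
  have PC1: "PC j \<le> 1" for j unfolding PC_def by (intro Pfin jh C)
  have Ginit: "G 0 = R - f x0"
    unfolding G_def using x0 S by (simp add: PI ph_def if_distrib cong: if_cong)
  \<comment> \<open>Crude bound for the initial phase, valid for all j.\<close>
  have early: "G j \<ge> R - f x0 - real j * h * (b + 1)" for j
  proof (induction j)
    case 0 then show ?case using Ginit by simp
  next
    case (Suc j)
    have "e * (G j / R) - b * PC j - dl \<ge> - (b + 1)"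
    proof -
      have "0 \<le> e * (G j / R)" using G0[of j] e M by (intro mult_nonneg_nonneg divide_nonneg_nonneg) (auto simp: R_def)
      then show ?thesis using mult_left_mono[OF PC1[of j] b] dl by simp
    qed
    then have "h * (e * (G j / R) - b * PC j - dl) \<ge> h * (- (b + 1))" using h by (intro mult_left_mono) auto
    then show ?case using Suc step[of j] by (simp add: algebra_simps)
  qed
  define N where "N = nat \<lceil>T / h\<rceil>"
  have N: "T \<le> real N * h" "real N * h \<le> T + 1"
  proof -
    have "T / h \<le> real N" unfolding N_def using h by (simp add: T_def)
    then show "T \<le> real N * h" using h by (simp add: field_simps)
    have "real N \<le> T / h + 1" unfolding N_def using h of_int_ceiling_le_add_one[of "T / h"]
      by (simp add: T_def)
    then have "real N * h \<le> (T / h + 1) * h" using h by (intro mult_right_mono) auto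
    also have "\<dots> = T + h" using h by (simp add: distrib_right)
    finally show "real N * h \<le> T + 1" using h by simp
  qed
  \<comment> \<open>After time T the set C has probability below e / (4 (b + 1)), and G \<ge> M = R / 2 makes the mass of S at least 1/2.\<close>
  have late: "G (N + j) \<ge> M + real j * (h * (e / 8))" for j
  proof (induction j)
    case 0
    have "real N * h * (b + 1) \<le> (T + 1) * (b + 1)" using N b by (intro mult_right_mono) auto
    then show ?case using early[of N] by (simp add: R_def M_def algebra_simps)
  next
    case (Suc j)
    have "0 \<le> real j * (h * (e / 8))" using h e by (intro mult_nonneg_nonneg) auto
    then have "M \<le> G (N + j)" using Suc by linarith
    then have "1 / 2 \<le> G (N + j) / R" using M by (simp add: R_def field_simps)
    then have "e * (1/2) \<le> e * (G (N + j) / R)" using e by (intro mult_left_mono) auto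
    moreover have "b * PC (N + j) \<le> e / 4"
    proof -
      have "T0 \<le> real (N + j) * h"
        using N(1) jh[of j] by (simp add: T_def distrib_right)
      then have "PC (N + j) < e / (4 * (b + 1))" unfolding PC_def by (rule T0)
      then have "b * PC (N + j) \<le> b * (e / (4 * (b + 1)))" using b by (intro mult_left_mono) auto
      also have "\<dots> \<le> e / 4" using b e by (simp add: field_simps)
      finally show ?thesis .
    qed
    ultimately have "e * (G (N + j) / R) - b * PC (N + j) - dl \<ge> e / 8" using dl by linarith
    then have "h * (e * (G (N + j) / R) - b * PC (N + j) - dl) \<ge> h * (e / 8)" using h by (intro mult_left_mono) auto
    moreover have "real (Suc j) * (h * (e / 8)) = real j * (h * (e / 8)) + h * (e / 8)"
      by (simp add: distrib_right)
    ultimately show ?case using Suc step[of "N + j"] unfolding add_Suc_right by linarith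
  qed
  obtain j :: nat where "real j > M / (h * (e / 8))" using reals_Archimedean2 by blast
  then have "M < real j * (h * (e / 8))" using h e by (simp add: field_simps)
  with late[of j] Gle[of "N + j"] show False by (simp add: R_def)
qed

section \<open>The generator of the retrial system and its balance equations\<close>

definition successors :: "nat \<times> nat \<times> bool \<Rightarrow> (nat \<times> nat \<times> bool) set" where
  "successors = (\<lambda>(m, n, k).
     if k then {(m, n, False), if n = 0 then (m, 1, True) else (m + 1, n - 1, True)}
     else {(m, n, True)} \<union> (if n = 0 then {} else {(m, n - 1, True)})
        \<union> (if m = 0 then {} else {(m - 1, n + 1, True)}))"

definition retrial_drift ::
  "real \<Rightarrow> real \<Rightarrow> real \<Rightarrow> (nat \<times> nat \<times> bool \<Rightarrow> real) \<Rightarrow> nat \<times> nat \<times> bool \<Rightarrow> real" where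
  "retrial_drift lam \<mu> \<alpha> F = (\<lambda>(m, n, k).
     if k then
       \<mu> * (F (m, n, False) - F (m, n, True))
       + lam * (F (if n = 0 then (m, 1, True) else (m + 1, n - 1, True)) - F (m, n, True))
     else
       lam * (F (m, n, True) - F (m, n, False))
       + (if n = 0 then 0 else \<alpha> * (F (m, n - 1, True) - F (m, n, False)))
       + (if m = 0 then 0
          else (if n = 0 then 2 * \<alpha> else \<alpha>) * (F (m - 1, n + 1, True) - F (m, n, False))))"

lemma finite_successors: "finite (successors x)"
  by (auto simp: successors_def split: prod.split)

lemma not_successor_of_itself: "x \<notin> successors x"
  by (cases x) (simp add: successors_def)

lemma retrial_rate_eq_0:
  assumes "y \<notin> successors x"
  shows "retrial_rate lam \<mu> \<alpha> x y = 0"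
proof -
  obtain m n k where x: "x = (m, n, k)" by (cases x)
  show ?thesis using assms unfolding x
    by (cases k; cases n; cases m) (simp_all add: successors_def retrial_rate_def)
qed

lemma sum_retrial_rate:
  "(\<Sum>y\<in>successors x. retrial_rate lam \<mu> \<alpha> x y * (F y - F x)) = retrial_drift lam \<mu> \<alpha> F x"
proof -
  obtain m n k where x: "x = (m, n, k)" by (cases x)
  show ?thesis unfolding x
    by (cases k; cases n; cases m) (simp_all add: successors_def retrial_rate_def retrial_drift_def)
qed

lemma retrial_rate_nonneg:
  assumes "0 < lam" "0 < \<mu>" "0 < \<alpha>"
  shows "0 \<le> retrial_rate lam \<mu> \<alpha> x y"
  using assms by (cases x) (auto simp: retrial_rate_def)

lemma retrial_generator_diag:
  "generator (retrial_rate lam \<mu> \<alpha>) x x = - (\<Sum>y\<in>successors x. retrial_rate lam \<mu> \<alpha> x y)"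
proof -
  have "(retrial_rate lam \<mu> \<alpha> x has_sum (\<Sum>y\<in>successors x. retrial_rate lam \<mu> \<alpha> x y)) (- {x})"
    by (rule has_sum_finite_neutralI[OF finite_successors])
       (auto simp: retrial_rate_eq_0 not_successor_of_itself)
  then show ?thesis unfolding generator_def using infsumI by fastforce
qed

lemma retrial_generator_off_diag:
  "x \<noteq> y \<Longrightarrow> generator (retrial_rate lam \<mu> \<alpha>) x y = retrial_rate lam \<mu> \<alpha> x y"
  by (simp add: generator_def)

lemma has_sum_retrial_generator:
  "((\<lambda>y. generator (retrial_rate lam \<mu> \<alpha>) x y * F y) has_sum retrial_drift lam \<mu> \<alpha> F x) UNIV"
proof (rule has_sum_finite_neutralI)
  let ?Q = "generator (retrial_rate lam \<mu> \<alpha>)"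
  show "finite (insert x (successors x))" by (simp add: finite_successors)
  show "?Q x y * F y = 0" if "y \<in> UNIV - insert x (successors x)" for y
  proof -
    have "x \<noteq> y" "y \<notin> successors x" using that by auto
    then show ?thesis by (simp add: retrial_generator_off_diag retrial_rate_eq_0)
  qed
  have "(\<Sum>y\<in>insert x (successors x). ?Q x y * F y)
      = ?Q x x * F x + (\<Sum>y\<in>successors x. retrial_rate lam \<mu> \<alpha> x y * F y)"
  proof -
    have "?Q x y = retrial_rate lam \<mu> \<alpha> x y" if "y \<in> successors x" for y
      using that not_successor_of_itself by (metis retrial_generator_off_diag)
    then show ?thesis by (simp add: finite_successors not_successor_of_itself)
  qed
  also have "\<dots> = (\<Sum>y\<in>successors x. retrial_rate lam \<mu> \<alpha> x y * (F y - F x))"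
    by (simp add: retrial_generator_diag right_diff_distrib sum_subtractf sum_distrib_right)
  finally show "retrial_drift lam \<mu> \<alpha> F x = (\<Sum>y\<in>insert x (successors x). ?Q x y * F y)"
    by (simp add: sum_retrial_rate)
qed auto

text \<open>The absolute bound behind every interchange of sums: the exit rates are bounded, and a jump only
reaches successors.\<close>

lemma has_sum_abs_retrial_generator:
  assumes "0 < lam" "0 < \<mu>" "0 < \<alpha>" and B: "\<And>y. y \<in> insert x (successors x) \<Longrightarrow> \<bar>F y\<bar> \<le> B"
  shows "\<exists>c. ((\<lambda>y. \<bar>generator (retrial_rate lam \<mu> \<alpha>) x y * F y\<bar>) has_sum c) UNIV \<and>
             c \<le> 2 * (lam + \<mu> + 3 * \<alpha>) * B"
proof (intro exI conjI)
  let ?Q = "generator (retrial_rate lam \<mu> \<alpha>)"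
  let ?c = "\<Sum>y\<in>insert x (successors x). \<bar>?Q x y * F y\<bar>"
  show "((\<lambda>y. \<bar>?Q x y * F y\<bar>) has_sum ?c) UNIV"
    by (rule has_sum_finite_neutralI[of "insert x (successors x)"])
       (auto simp: finite_successors retrial_generator_off_diag retrial_rate_eq_0)
  define T where "T = (\<Sum>y\<in>successors x. retrial_rate lam \<mu> \<alpha> x y)"
  have T0: "0 \<le> T" unfolding T_def by (intro sum_nonneg retrial_rate_nonneg assms)
  obtain m n k where x: "x = (m, n, k)" by (cases x)
  have T: "T \<le> lam + \<mu> + 3 * \<alpha>" unfolding T_def x using assms(1-3)
    by (cases k; cases n; cases m) (simp_all add: successors_def retrial_rate_def)
  have B0: "0 \<le> B" using B[of x] by (smt (verit) insertI1)
  have "?c \<le> (\<Sum>y\<in>insert x (successors x). \<bar>?Q x y\<bar> * B)"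
    unfolding abs_mult by (intro sum_mono mult_left_mono B) auto
  also have "\<dots> = (\<Sum>y\<in>insert x (successors x). \<bar>?Q x y\<bar>) * B" by (simp add: sum_distrib_right)
  also have "(\<Sum>y\<in>insert x (successors x). \<bar>?Q x y\<bar>) = \<bar>?Q x x\<bar> + (\<Sum>y\<in>successors x. \<bar>?Q x y\<bar>)"
    by (simp add: finite_successors not_successor_of_itself)
  also have "(\<Sum>y\<in>successors x. \<bar>?Q x y\<bar>) = T" unfolding T_def
  proof (rule sum.cong)
    fix y assume "y \<in> successors x"
    then have "x \<noteq> y" using not_successor_of_itself by metis
    then show "\<bar>?Q x y\<bar> = retrial_rate lam \<mu> \<alpha> x y"
      using retrial_rate_nonneg[OF assms(1-3), of x y] by (simp add: retrial_generator_off_diag)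
  qed simp
  also have "?Q x x = - T" by (simp add: retrial_generator_diag T_def)
  also have "\<bar>- T\<bar> + T = 2 * T" using T0 by simp
  also have "2 * T * B \<le> 2 * (lam + \<mu> + 3 * \<alpha>) * B" using T B0 by (intro mult_right_mono) auto
  finally show "?c \<le> 2 * (lam + \<mu> + 3 * \<alpha>) * B" .
qed

lemma retrial_drift_linear:
  "retrial_drift lam \<mu> \<alpha> (\<lambda>x. c * F x + G x) x = c * retrial_drift lam \<mu> \<alpha> F x + retrial_drift lam \<mu> \<alpha> G x"
  by (cases x) (simp add: retrial_drift_def algebra_simps)

lemma retrial_drift_const: "retrial_drift lam \<mu> \<alpha> (\<lambda>_. c) x = 0"
  by (cases x) (auto simp: retrial_drift_def)

text \<open>Fubini for the double sum of \<open>q x * Q x y * F y\<close>.\<close>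

lemma generator_duality:
  fixes q F :: "'s \<Rightarrow> real"
  assumes q0: "\<And>x. 0 \<le> q x"
    and abs: "\<And>x. ((\<lambda>y. \<bar>Q x y * F y\<bar>) has_sum c x) UNIV" and c: "(\<lambda>x. q x * c x) summable_on UNIV"
    and row: "\<And>x. ((\<lambda>y. Q x y * F y) has_sum d x) UNIV"
    and col: "\<And>y. ((\<lambda>x. q x * Q x y) has_sum b y) UNIV"
  shows "\<exists>S. ((\<lambda>x. q x * d x) has_sum S) UNIV \<and> ((\<lambda>y. F y * b y) has_sum S) UNIV"
proof -
  define g where "g = (\<lambda>(x, y). q x * (Q x y * F y))"
  have "(\<lambda>p. \<bar>g p\<bar>) summable_on UNIV \<times> UNIV"
  proof (rule summable_on_SigmaI[OF _ c])
    show "((\<lambda>y. \<bar>g (x, y)\<bar>) has_sum q x * c x) UNIV" for x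
      using has_sum_cmult_right[OF abs[of x], of "q x"] q0[of x]
      by (simp add: g_def abs_mult)
  qed auto
  then have "g summable_on UNIV \<times> UNIV"
    using abs_summable_summable[of g] by simp
  then obtain S where S: "(g has_sum S) (UNIV \<times> UNIV)" using has_sum_infsum by blast
  have 1: "((\<lambda>x. q x * d x) has_sum S) UNIV"
    by (rule has_sum_SigmaD[OF S]) (use has_sum_cmult_right[OF row] in \<open>simp add: g_def\<close>)
  have "((\<lambda>(y, x). g (x, y)) has_sum S) (UNIV \<times> UNIV)" using S by (subst (asm) has_sum_swap) simp
  then have "((\<lambda>y. F y * b y) has_sum S) UNIV"
  proof (rule has_sum_SigmaD)
    show "((\<lambda>x. case (y, x) of (y, x) \<Rightarrow> g (x, y)) has_sum F y * b y) UNIV" for y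
      using has_sum_cmult_right[OF col[of y], of "F y"] by (simp add: g_def mult_ac)
  qed
  with 1 show ?thesis by blast
qed

lemma nonpos_has_sum_0:
  fixes f :: "'s \<Rightarrow> real"
  assumes "(f has_sum 0) UNIV" "\<And>x. f x \<le> 0"
  shows "f x = 0"
proof -
  have neg: "((\<lambda>x. - f x) has_sum 0) UNIV" using has_sum_uminusI[OF assms(1)] by simp
  have "(\<Sum>x\<in>{x}. - f x) \<le> 0"
    by (rule has_sum_mono_neutral[OF has_sum_finite[of "{x}"] neg]) (use assms(2) in auto)
  then show ?thesis using assms(2)[of x] by simp
qed

text \<open>The column sums of \<open>q Q\<close> are nonpositive, and duality with the constant \<open>1\<close> shows that they add up to
\<open>0\<close>; so each of them vanishes.\<close>

lemma retrial_stationary: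
  fixes q :: "nat \<times> nat \<times> bool \<Rightarrow> real"
  assumes pos: "0 < lam" "0 < \<mu>" "0 < \<alpha>"
    and q0: "\<And>x. 0 \<le> q x" and q: "q summable_on UNIV"
    and sub: "\<And>F y. finite F \<Longrightarrow> y \<in> F \<Longrightarrow> (\<Sum>z\<in>F. q z * generator (retrial_rate lam \<mu> \<alpha>) z y) \<le> 0"
  shows "((\<lambda>x. q x * generator (retrial_rate lam \<mu> \<alpha>) x y) has_sum 0) UNIV"
proof -
  let ?Q = "generator (retrial_rate lam \<mu> \<alpha>)"
  let ?B = "2 * (lam + \<mu> + 3 * \<alpha>)"
  have "\<exists>c. ((\<lambda>y. \<bar>?Q x y * 1\<bar>) has_sum c) UNIV \<and> c \<le> ?B * 1" for x
    by (rule has_sum_abs_retrial_generator[OF pos]) simp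
  then obtain c where c: "\<And>x. ((\<lambda>y. \<bar>?Q x y * 1\<bar>) has_sum c x) UNIV" "\<And>x. c x \<le> ?B * 1"
    by metis
  have Q: "\<bar>?Q x y\<bar> \<le> ?B" for x y
  proof -
    have "(\<Sum>z\<in>{y}. \<bar>?Q x z * 1\<bar>) \<le> c x"
      by (rule has_sum_mono_neutral[OF has_sum_finite[of "{y}"] c(1)[of x]]) auto
    then show ?thesis using c(2)[of x] by simp
  qed
  have col: "(\<lambda>x. q x * ?Q x y) summable_on UNIV" for y
  proof (rule abs_summable_summable)
    show "(\<lambda>x. norm (q x * ?Q x y)) summable_on UNIV"
    proof (rule Infinite_Sum.abs_summable_on_comparison_test'[OF summable_on_cmult_left[OF q, of ?B]])
      show "norm (q x * ?Q x y) \<le> q x * ?B" for x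
        using mult_left_mono[OF Q[of x y] q0[of x]] q0[of x] by (simp add: abs_mult)
    qed
  qed
  define b where "b y = infsum (\<lambda>x. q x * ?Q x y) UNIV" for y
  have b: "((\<lambda>x. q x * ?Q x y) has_sum b y) UNIV" for y
    using col unfolding b_def by (rule has_sum_infsum)
  have b_nonpos: "b y \<le> 0" for y
  proof -
    have "((\<lambda>x. q x * ?Q x y) has_sum (b y - q y * ?Q y y)) (UNIV - {y})"
      using has_sum_Diff[OF b[of y] has_sum_finite[of "{y}" "\<lambda>x. q x * ?Q x y"]] by simp
    then have "b y - q y * ?Q y y \<le> - (q y * ?Q y y)"
    proof (rule has_sum_le_finite_sums)
      fix F assume F: "finite F" "F \<subseteq> UNIV - {y}"
      then have "y \<notin> F" by auto
      then show "(\<Sum>x\<in>F. q x * ?Q x y) \<le> - (q y * ?Q y y)"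
        using sub[of "insert y F" y] F by simp
    qed
    then show ?thesis by simp
  qed
  have "(\<lambda>x. q x * c x) summable_on UNIV"
  proof (rule abs_summable_summable)
    show "(\<lambda>x. norm (q x * c x)) summable_on UNIV"
    proof (rule Infinite_Sum.abs_summable_on_comparison_test'[OF summable_on_cmult_left[OF q, of ?B]])
      fix x
      have "0 \<le> c x" using has_sum_nonneg[OF c(1)[of x]] by simp
      then show "norm (q x * c x) \<le> q x * ?B"
        using mult_left_mono[OF c(2)[of x] q0[of x]] q0[of x] by (simp add: abs_mult)
    qed
  qed
  then obtain S where S: "((\<lambda>x. q x * 0) has_sum S) UNIV" "((\<lambda>y. 1 * b y) has_sum S) UNIV"
    using generator_duality[where d = "\<lambda>_. 0", OF q0 c(1) _ _ b]
      has_sum_retrial_generator[of lam \<mu> \<alpha> _ "\<lambda>_. 1"]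
    by (auto simp: retrial_drift_const)
  have "S = 0" by (rule has_sum_unique[OF S(1)], rule has_sum_0) simp
  then have "(b has_sum 0) UNIV" using S(2) by simp
  then have "b y = 0" using b_nonpos by (rule nonpos_has_sum_0)
  then show ?thesis using b[of y] by simp
qed

lemma busy_successor_iff:
  "(m, n, True) \<in> successors (a, b, c) \<longleftrightarrow>
     (if c then (b = 0 \<and> m = a \<and> n = 1) \<or> (m = Suc a \<and> b = Suc n)
      else m = a \<and> n = b \<or> m = a \<and> b = Suc n \<or> a = Suc m \<and> n = Suc b)"
  by (cases c; cases a; cases b) (auto simp: successors_def)

context
  fixes lam \<mu> \<alpha> :: real and q :: "nat \<times> nat \<times> bool \<Rightarrow> real"
  assumes stat: "\<And>y. ((\<lambda>x. q x * generator (retrial_rate lam \<mu> \<alpha>) x y) has_sum 0) UNIV"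
begin

lemma balance:
  assumes A: "finite A" "y \<notin> A" and pred: "\<And>x. y \<in> successors x \<Longrightarrow> x \<in> A"
  shows "q y * (\<Sum>z\<in>successors y. retrial_rate lam \<mu> \<alpha> y z) = (\<Sum>x\<in>A. q x * retrial_rate lam \<mu> \<alpha> x y)"
proof -
  let ?Q = "generator (retrial_rate lam \<mu> \<alpha>)"
  have "((\<lambda>x. q x * ?Q x y) has_sum (\<Sum>x\<in>insert y A. q x * ?Q x y)) UNIV"
  proof (rule has_sum_finite_neutralI)
    fix x assume "x \<in> UNIV - insert y A"
    then have "x \<noteq> y" "y \<notin> successors x" using pred[of x] by blast+
    then show "q x * ?Q x y = 0" by (simp add: retrial_generator_off_diag retrial_rate_eq_0)
  qed (use A in auto)
  then have "(\<Sum>x\<in>insert y A. q x * ?Q x y) = 0" using stat has_sum_unique by blast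
  moreover have "(\<Sum>x\<in>A. q x * ?Q x y) = (\<Sum>x\<in>A. q x * retrial_rate lam \<mu> \<alpha> x y)"
    by (rule sum.cong) (use A in \<open>auto simp: generator_def\<close>)
  ultimately show ?thesis using A by (simp add: retrial_generator_diag)
qed

text \<open>For \<open>m \<ge> 1\<close> the total retrial rate is \<open>2 \<alpha>\<close> whatever \<open>n\<close> is, so there the busy probabilities
are a constant multiple of the idle ones. The boundary \<open>m = 0\<close> has a smaller factor.\<close>

lemma idle_balance:
  "\<mu> * q (m, n, True) =
     (lam + (if n = 0 then 0 else \<alpha>) + (if m = 0 then 0 else if n = 0 then 2 * \<alpha> else \<alpha>)) * q (m, n, False)"
proof -
  have "q (m, n, False) * (\<Sum>z\<in>successors (m, n, False). retrial_rate lam \<mu> \<alpha> (m, n, False) z)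
     = (\<Sum>x\<in>{(m, n, True)}. q x * retrial_rate lam \<mu> \<alpha> x (m, n, False))"
    by (rule balance) (simp_all add: successors_def split: prod.splits if_splits)
  moreover have "(\<Sum>z\<in>successors (m, n, False). retrial_rate lam \<mu> \<alpha> (m, n, False) z)
     = lam + (if n = 0 then 0 else \<alpha>) + (if m = 0 then 0 else if n = 0 then 2 * \<alpha> else \<alpha>)"
    by (cases n; cases m) (simp_all add: successors_def retrial_rate_def)
  ultimately show ?thesis by (simp add: retrial_rate_def mult.commute)
qed

lemma busy_exit_rate: "(\<Sum>z\<in>successors (m, n, True). retrial_rate lam \<mu> \<alpha> (m, n, True) z) = lam + \<mu>"
  by (cases n) (simp_all add: successors_def retrial_rate_def)

lemma busy_balance_0:
  "(lam + \<mu>) * q (Suc m, 0, True) =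
    lam * q (Suc m, 0, False) + \<alpha> * q (Suc m, 1, False) + lam * q (m, 1, True)"
proof -
  have "q (Suc m, 0, True) * (lam + \<mu>)
     = (\<Sum>x\<in>{(Suc m, 0, False), (Suc m, 1, False), (m, 1, True)}. q x * retrial_rate lam \<mu> \<alpha> x (Suc m, 0, True))"
    by (subst busy_exit_rate[of "Suc m" 0, symmetric], rule balance) (auto simp: busy_successor_iff split: if_splits)
  then show ?thesis
    by (simp add: retrial_rate_def mult.commute)
qed

lemma busy_balance_1:
  "(lam + \<mu>) * q (Suc m, 1, True) =
    lam * q (Suc m, 1, False) + \<alpha> * q (Suc m, 2, False) + lam * q (m, 2, True)
    + 2 * \<alpha> * q (Suc (Suc m), 0, False) + lam * q (Suc m, 0, True)"
proof -
  have "q (Suc m, 1, True) * (lam + \<mu>)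
     = (\<Sum>x\<in>{(Suc m, 1, False), (Suc m, 2, False), (m, 2, True), (Suc (Suc m), 0, False), (Suc m, 0, True)}.
         q x * retrial_rate lam \<mu> \<alpha> x (Suc m, 1, True))"
    by (subst busy_exit_rate[of "Suc m" 1, symmetric], rule balance) (auto simp: busy_successor_iff split: if_splits)
  then show ?thesis
    by (simp add: retrial_rate_def mult.commute)
qed

lemma busy_balance_ge_2:
  "(lam + \<mu>) * q (Suc m, Suc (Suc n), True) =
    lam * q (Suc m, Suc (Suc n), False) + \<alpha> * q (Suc m, Suc (Suc (Suc n)), False)
    + lam * q (m, Suc (Suc (Suc n)), True) + \<alpha> * q (Suc (Suc m), Suc n, False)"
proof -
  have "q (Suc m, Suc (Suc n), True) * (lam + \<mu>)
     = (\<Sum>x\<in>{(Suc m, Suc (Suc n), False), (Suc m, Suc (Suc (Suc n)), False),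
          (m, Suc (Suc (Suc n)), True), (Suc (Suc m), Suc n, False)}.
         q x * retrial_rate lam \<mu> \<alpha> x (Suc m, Suc (Suc n), True))"
    by (subst busy_exit_rate[of "Suc m" "Suc (Suc n)", symmetric], rule balance) (auto simp: busy_successor_iff split: if_splits)
  then show ?thesis
    by (simp add: retrial_rate_def mult.commute)
qed

end

section \<open>Geometric Lyapunov functions\<close>

text \<open>Test functions on which the drift acts by multiplication, with a factor that only depends on
whether \<open>m = 0\<close>, whether \<open>n = 0\<close>, and on the server state.\<close>

definition geometric_weight :: "real \<Rightarrow> real \<Rightarrow> real \<Rightarrow> nat \<times> nat \<times> bool \<Rightarrow> real" where
  "geometric_weight x y u = (\<lambda>(m, n, k). x ^ m * y ^ n * (if k then u else 1))"

lemma geometric_drift: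
  assumes "x \<noteq> 0" "y \<noteq> 0"
  shows "retrial_drift lam \<mu> \<alpha> (geometric_weight x y u) (m, n, k) = x ^ m * y ^ n *
    (if k then \<mu> * (1 - u) + lam * u * ((if n = 0 then y else x / y) - 1)
     else lam * (u - 1) + (if n = 0 then 0 else \<alpha> * (u / y - 1))
       + (if m = 0 then 0 else (if n = 0 then 2 * \<alpha> else \<alpha>) * (u * y / x - 1)))"
  using assms
  by (cases k; cases n; cases m) (simp_all add: retrial_drift_def geometric_weight_def field_simps)

text \<open>The weight \<open>s\<^sup>2\<^sup>m\<^sup>+\<^sup>n\<close>, exponential in the number of waiting jobs, decreases in the mean except on
the idle states with \<open>m = 0\<close>, where at most one orbit retries. There the weight \<open>z\<^sup>m y\<^sup>n\<close> with
\<open>y > s\<close> takes over: it decreases in the mean wherever \<open>n \<ge> 1\<close> and outgrows the first weight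
along \<open>m = 0\<close>. It fails for \<open>n = 0\<close>, where a multiple of the first one dominates it because
\<open>z \<le> s\<^sup>2\<close>. The premises \<open>e1\<close> and \<open>e2\<close> are the drift conditions of the first weight,
\<open>e3\<close> to \<open>e5\<close> those of the second.\<close>

lemma geometric_Lyapunov:
  fixes lam \<mu> \<alpha> :: real
  assumes pos: "0 < lam" "0 < \<mu>" "0 < \<alpha>"
    and s: "1 < s" "s < y" and z: "1 \<le> z" "z \<le> s\<^sup>2" and u: "1 < u1" "1 < u2"
    and e1: "\<mu> * (1 - u1) + lam * u1 * (s - 1) < 0"
    and e2: "lam * (u1 - 1) + 2 * \<alpha> * (u1 / s - 1) < 0"
    and e3: "\<mu> * (1 - u2) + lam * u2 * (z / y - 1) < 0"
    and e4: "lam * (u2 - 1) + \<alpha> * (u2 / y - 1) + \<alpha> * (u2 * y / z - 1) < 0"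
    and e5: "lam * (u2 - 1) + \<alpha> * (u2 / y - 1) < 0"
  shows "\<exists>f e b n0. 0 < e \<and> 0 \<le> b \<and> (\<forall>x. 0 \<le> f x) \<and> (\<forall>R. finite {x. f x < R}) \<and>
    (\<forall>m n k. retrial_drift lam \<mu> \<alpha> f (m, n, k)
       \<le> (if m = 0 \<and> n \<le> n0 then b else 0) - e * (s ^ (2 * m + n) + z ^ m * y ^ n))"
proof -
  define e where "e = Min {- (\<mu> * (1 - u1) + lam * u1 * (s - 1)),
    - (lam * (u1 - 1) + 2 * \<alpha> * (u1 / s - 1)), - (\<mu> * (1 - u2) + lam * u2 * (z / y - 1)),
    - (lam * (u2 - 1) + \<alpha> * (u2 / y - 1) + \<alpha> * (u2 * y / z - 1)), - (lam * (u2 - 1) + \<alpha> * (u2 / y - 1))}"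
  have e: "0 < e" "\<mu> * (1 - u1) + lam * u1 * (s - 1) \<le> - e"
    "lam * (u1 - 1) + 2 * \<alpha> * (u1 / s - 1) \<le> - e"
    "\<mu> * (1 - u2) + lam * u2 * (z / y - 1) \<le> - e"
    "lam * (u2 - 1) + \<alpha> * (u2 / y - 1) + \<alpha> * (u2 * y / z - 1) \<le> - e"
    "lam * (u2 - 1) + \<alpha> * (u2 / y - 1) \<le> - e"
    using e1 e2 e3 e4 e5 by (auto simp: e_def min_def)
  define B1 where "B1 = lam * (u1 - 1) + \<alpha> * \<bar>u1 / s - 1\<bar>"
  define B2 where "B2 = \<bar>\<mu> * (1 - u2) + lam * u2 * (y - 1)\<bar>
    + \<bar>lam * (u2 - 1) + 2 * \<alpha> * (u2 * y / z - 1)\<bar> + \<bar>lam * (u2 - 1)\<bar>"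
  have B: "0 \<le> B1" "0 \<le> B2" using pos u by (auto simp: B1_def B2_def)
  \<comment> \<open>C e exceeds the worst positive drift B2 of the second weight by 2 e.\<close>
  define C where "C = (B2 + 2 * e) / e"
  have C: "1 \<le> C" "C * e = B2 + 2 * e" using e B by (auto simp: C_def field_simps)
  have "\<forall>\<^sub>F n in sequentially. (s / y) ^ n < (e / 2) / (C * B1 + e)"
  proof (rule order_tendstoD(2)[OF LIMSEQ_realpow_zero])
    show "0 < e / 2 / (C * B1 + e)" using e B C by (intro divide_pos_pos add_nonneg_pos mult_nonneg_nonneg) auto
  qed (use s in auto)
  \<comment> \<open>From n0 on, the second weight absorbs the positive drift of the first one along m = 0.\<close>
  then obtain n0 where n0': "\<And>n. n0 \<le> n \<Longrightarrow> (s / y) ^ n < (e / 2) / (C * B1 + e)"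
    unfolding eventually_sequentially by blast
  have n0: "(C * B1 + e) * s ^ n \<le> e / 2 * y ^ n" if "n0 \<le> n" for n
  proof -
    have "0 < C * B1 + e" using e B C by (intro add_nonneg_pos mult_nonneg_nonneg) auto
    moreover have "0 < y ^ n" using s by simp
    ultimately show ?thesis using n0'[OF that] by (simp add: power_divide field_simps)
  qed
  define F1 where "F1 = geometric_weight (s\<^sup>2) s u1"
  define F2 where "F2 = geometric_weight z y u2"
  define f where "f x = C * F1 x + F2 x" for x
  define b where "b = (C * B1 + B2 + 2 * e) * y ^ n0"
  have sq: "s\<^sup>2 / s = s" "u1 * s / s\<^sup>2 = u1 / s" using s by (auto simp: power2_eq_square)
  have drift: "retrial_drift lam \<mu> \<alpha> f (m, n, k)
       \<le> (if m = 0 \<and> n \<le> n0 then b else 0) - e / 2 * (s ^ (2 * m + n) + z ^ m * y ^ n)" for m n k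
  proof -
    define S where "S = (s\<^sup>2) ^ m * s ^ n"
    define Z where "Z = z ^ m * y ^ n"
    have S': "s ^ (2 * m + n) = S" by (simp add: S_def power_add power_mult)
    have S: "1 \<le> S" "1 \<le> Z" using s z
      by (auto simp: S_def Z_def intro!: mult_ge1_I one_le_power)
    define D1 where "D1 = (if k then \<mu> * (1 - u1) + lam * u1 * (s - 1)
             else lam * (u1 - 1) + (if n = 0 then 0 else \<alpha> * (u1 / s - 1))
               + (if m = 0 then 0 else (if n = 0 then 2 * \<alpha> else \<alpha>) * (u1 / s - 1)))"
    define D2 where "D2 = (if k then \<mu> * (1 - u2) + lam * u2 * ((if n = 0 then y else z / y) - 1)
             else lam * (u2 - 1) + (if n = 0 then 0 else \<alpha> * (u2 / y - 1))
               + (if m = 0 then 0 else (if n = 0 then 2 * \<alpha> else \<alpha>) * (u2 * y / z - 1)))"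
    have "retrial_drift lam \<mu> \<alpha> F1 (m, n, k) = S * D1"
      unfolding F1_def D1_def S_def using s by (subst geometric_drift) (simp_all add: sq)
    moreover have "retrial_drift lam \<mu> \<alpha> F2 (m, n, k) = Z * D2"
      unfolding F2_def D2_def Z_def using s z by (subst geometric_drift) simp_all
    ultimately have f: "retrial_drift lam \<mu> \<alpha> f (m, n, k) = C * (S * D1) + Z * D2"
      unfolding f_def retrial_drift_linear by simp
    have half: "e / 2 * (S + Z) = e * S / 2 + e * Z / 2" by (simp add: distrib_left)
    have Ze: "Z * - e = - (e * Z)" by simp
    have ZB: "Z * B2 = B2 * Z" by simp
    show ?thesis
    proof (cases "k \<or> m \<noteq> 0")
      case True
      have "D1 \<le> - e" using True e by (auto simp: D1_def algebra_simps)
      then have "C * (S * D1) \<le> C * (S * - e)" using S C by (intro mult_left_mono) auto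
      also have "\<dots> = - ((B2 + 2 * e) * S)" by (simp add: C(2)[symmetric])
      finally have CD: "C * (S * D1) \<le> - (B2 * S + 2 * (e * S))" by (simp add: algebra_simps)
      have eS: "0 \<le> e * S" "0 \<le> e * Z" "0 \<le> B2 * S" using e S B by auto
      have "C * (S * D1) + Z * D2 \<le> - (e / 2 * (S + Z))"
      proof (cases "n = 0")
        case False
        then have "D2 \<le> - e" using True e by (auto simp: D2_def)
        then have "Z * D2 \<le> Z * - e" using S by (intro mult_left_mono) auto
        then show ?thesis using CD eS unfolding half Ze by linarith
      next
        case n: True
        have "D2 \<le> B2" using n True unfolding B2_def D2_def by auto
        then have "Z * D2 \<le> Z * B2" using S by (intro mult_left_mono) auto
        moreover have "Z \<le> S" unfolding Z_def S_def using n z by (simp add: power_mono)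
        then have "B2 * Z \<le> B2 * S" "e * Z \<le> e * S" using B e by (auto intro!: mult_left_mono)
        ultimately show ?thesis using CD eS unfolding half ZB by linarith
      qed
      moreover have "0 \<le> (if m = 0 \<and> n \<le> n0 then b else 0)"
        using e B C s by (auto simp: b_def)
      ultimately show ?thesis unfolding f S' Z_def[symmetric] by linarith
    next
      case False
      have SZ: "S = s ^ n" "Z = y ^ n" using False by (auto simp: S_def Z_def)
      have "\<alpha> * (u1 / s - 1) \<le> \<alpha> * \<bar>u1 / s - 1\<bar>" using pos by (intro mult_left_mono) auto
      then have "D1 \<le> B1" using False pos unfolding B1_def D1_def by auto
      then have "C * (S * D1) \<le> C * (S * B1)" using S C by (intro mult_left_mono) auto
      then have CD: "C * (S * D1) \<le> C * B1 * S" by (simp add: mult_ac)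
      have "S \<le> Z" unfolding SZ using s by (intro power_mono) auto
      show ?thesis
      proof (cases "n \<le> n0")
        case True
        have "Z \<le> y ^ n0" unfolding SZ using s True by (intro power_increasing) auto
        have "D2 \<le> B2" using False e B unfolding B2_def D2_def by auto
        then have "Z * D2 \<le> Z * B2" using S by (intro mult_left_mono) auto
        moreover have "C * B1 * S \<le> C * B1 * Z" "e * S \<le> e * Z"
          using \<open>S \<le> Z\<close> B C e by (auto intro!: mult_left_mono)
        moreover have "C * B1 * Z + B2 * Z + 2 * (e * Z) \<le> b"
        proof -
          have "(C * B1 + B2 + 2 * e) * Z \<le> b" unfolding b_def
            using \<open>Z \<le> y ^ n0\<close> B C e by (intro mult_left_mono) auto
          then show ?thesis by (simp add: distrib_right)
        qed
        moreover have "0 \<le> e * Z" using e S by auto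
        ultimately have "C * (S * D1) + Z * D2 \<le> b - e / 2 * (S + Z)"
          using CD unfolding half ZB by linarith
        then show ?thesis unfolding f S' Z_def[symmetric] using True False by simp
      next
        case n: False
        then have "D2 \<le> - e" using False e by (auto simp: D2_def)
        then have "Z * D2 \<le> Z * - e" using S by (intro mult_left_mono) auto
        moreover have "C * B1 * S + e * S \<le> e * Z / 2" using n0[of n] n by (simp add: SZ distrib_right)
        moreover have "0 \<le> e * S" using e S by auto
        ultimately have "C * (S * D1) + Z * D2 \<le> - (e / 2 * (S + Z))"
          using CD unfolding half Ze by linarith
        then show ?thesis unfolding f S' Z_def[symmetric] using n by simp
      qed
    qed
  qed
  have pos_weight: "0 \<le> F1 x" "0 \<le> F2 x" for x
    using s z u by (auto simp: F1_def F2_def geometric_weight_def split: prod.split)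
  have fin: "finite {x. f x < R}" for R
  proof -
    obtain N where N: "R < s ^ N" using real_arch_pow[of s R] s by blast
    have "{x. f x < R} \<subseteq> {..N} \<times> {..N} \<times> UNIV"
    proof
      fix x assume "x \<in> {x. f x < R}"
      then have fR: "f x < R" by simp
      obtain m n k where x: "x = (m, n, k)" by (cases x)
      have "s ^ (2 * m + n) * 1 \<le> s ^ (2 * m + n) * (if k then u1 else 1)"
        using s u by (intro mult_left_mono) auto
      then have "s ^ (2 * m + n) \<le> F1 x"
        by (simp add: F1_def geometric_weight_def x power_add power_mult)
      also have "\<dots> \<le> C * F1 x" using mult_right_mono[OF C(1) pos_weight(1)[of x]] by simp
      finally have "s ^ (2 * m + n) < s ^ N" using fR N pos_weight(2)[of x] by (simp add: f_def)
      then have "2 * m + n < N" using s by (simp add: power_strict_increasing_iff)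
      then show "x \<in> {..N} \<times> {..N} \<times> UNIV" by (simp add: x)
    qed
    then show ?thesis by (rule finite_subset) auto
  qed
  have f0: "0 \<le> f x" for x unfolding f_def using pos_weight C by (intro add_nonneg_nonneg mult_nonneg_nonneg) auto
  have b0: "0 \<le> b" using e B C s by (auto simp: b_def)
  show ?thesis using e(1) b0 f0 fin drift by (intro exI[of _ f] exI[of _ "e / 2"] exI[of _ b] exI[of _ n0]) auto
qed

text \<open>Stability enters here. The first weight works for every \<open>s < 1 / \<rho>\<close>: the conditions on \<open>u1\<close> leave
an open interval exactly when \<open>\<rho> s < 1\<close>. For the second weight \<open>y\<close> may be any number between
\<open>1 / \<rho>\<close> and \<open>1 / \<rho>\<^sup>2\<close>, if \<open>u2 = 1 + d\<close> and \<open>z = y * (1 + et * d)\<close> with \<open>1 < et < \<mu> / lam\<close> and small \<open>d\<close>. That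
\<open>y\<close> can exceed \<open>1 / \<rho>\<close> is what later allows an analytic continuation past the dominant
singularity.\<close>

lemma retrial_Lyapunov_exists:
  fixes lam \<mu> \<alpha> :: real
  assumes pos: "0 < lam" "0 < \<mu>" "0 < \<alpha>" and stable: "rho lam \<mu> \<alpha> < 1"
  shows "\<exists>y z. 1 / rho lam \<mu> \<alpha> < y \<and> 1 \<le> z \<and> z < (1 / rho lam \<mu> \<alpha>)\<^sup>2 \<and>
    (\<forall>s. 1 < s \<and> z \<le> s\<^sup>2 \<and> s < 1 / rho lam \<mu> \<alpha> \<longrightarrow>
      (\<exists>f e b n0. 0 < e \<and> 0 \<le> b \<and> (\<forall>x. 0 \<le> f x) \<and> (\<forall>R. finite {x. f x < R}) \<and>
        (\<forall>m n k. retrial_drift lam \<mu> \<alpha> f (m, n, k)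
           \<le> (if m = 0 \<and> n \<le> n0 then b else 0) - e * (s ^ (2 * m + n) + z ^ m * y ^ n))))"
proof -
  let ?\<rho> = "rho lam \<mu> \<alpha>"
  have rho: "0 < ?\<rho>" "lam * (lam + 2 * \<alpha>) = 2 * \<alpha> * \<mu> * ?\<rho>" using pos by (auto simp: rho_def)
  have "2 * \<alpha> * \<mu> * ?\<rho> < 2 * \<alpha> * \<mu> * 1" using pos stable by (intro mult_strict_left_mono) auto
  then have "lam * (2 * \<alpha>) < \<mu> * (2 * \<alpha>)" using rho(2) pos
    by (smt (verit) distrib_left mult.commute mult.right_neutral mult_pos_pos mult.left_commute)
  then have lam_mu: "lam < \<mu>" using pos by simp
  define y where "y = (1 / ?\<rho> + (1 / ?\<rho>)\<^sup>2) / 2"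
  have r1: "1 < 1 / ?\<rho>" using rho stable by simp
  have "1 / ?\<rho> * 1 < 1 / ?\<rho> * (1 / ?\<rho>)" using rho stable by (intro mult_strict_left_mono) auto
  then have ii: "1 / ?\<rho> < (1 / ?\<rho>)\<^sup>2" by (simp only: power2_eq_square mult_1_right)
  have "i < (i + j) / 2" "(i + j) / 2 < j" if "i < j" for i j :: real using that by auto
  from this[OF ii] have y: "1 / ?\<rho> < y" "y < (1 / ?\<rho>)\<^sup>2" unfolding y_def by auto
  have "1 < y" using y r1 by linarith
  then have y1: "1 < y" "0 < y" by auto
  note y = y y1
  \<comment> \<open>Stability implies lam < \<mu>, which makes room for et; to first order in d condition e3 reads lam * et < \<mu>.\<close>
  define et where "et = (1 + \<mu> / lam) / 2"
  have et: "1 < et" "lam * et < \<mu>" using lam_mu pos by (auto simp: et_def field_simps)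
  define M where "M = Min {(\<alpha> - \<alpha> / y) / (lam + \<alpha> / y), (\<mu> - lam * et) / (lam * et), ((1 / ?\<rho>)\<^sup>2 / y - 1) / et}"
  have "0 < (\<alpha> - \<alpha> / y) / (lam + \<alpha> / y)"
  proof (rule divide_pos_pos)
    have "\<alpha> * 1 < \<alpha> * y" using pos y by (intro mult_strict_left_mono) auto
    then show "0 < \<alpha> - \<alpha> / y" using y by (simp add: field_simps)
    show "0 < lam + \<alpha> / y" using pos y by (intro add_pos_pos divide_pos_pos) auto
  qed
  moreover have "0 < (\<mu> - lam * et) / (lam * et)" using et pos by simp
  moreover have "0 < ((1 / ?\<rho>)\<^sup>2 / y - 1) / et" using y et by (simp add: less_divide_eq)
  ultimately have M: "0 < M" unfolding M_def by simp
  define d where "d = M / 2"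
  have "d < M" using M by (simp add: d_def)
  then have d: "0 < d" "d < (\<alpha> - \<alpha> / y) / (lam + \<alpha> / y)" "d < (\<mu> - lam * et) / (lam * et)"
    "d < ((1 / ?\<rho>)\<^sup>2 / y - 1) / et"
    using M by (auto simp: M_def d_def)
  define u2 where "u2 = 1 + d"
  define z where "z = y * (1 + et * d)"
  have etd: "d < et * d" using et d by simp
  have z: "1 \<le> z" "z < (1 / ?\<rho>)\<^sup>2"
  proof -
    have "1 * 1 \<le> y * (1 + et * d)" using y et d by (intro mult_mono) auto
    then show "1 \<le> z" by (simp add: z_def)
    have "1 + et * d < (1 / ?\<rho>)\<^sup>2 / y" using d(4) et by (simp add: field_simps)
    then have "(1 + et * d) * y < (1 / ?\<rho>)\<^sup>2" using y by (simp only: pos_less_divide_eq)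
    then show "z < (1 / ?\<rho>)\<^sup>2" by (simp only: z_def mult.commute)
  qed
  have zy: "z / y = 1 + et * d" using y by (simp add: z_def)
  have e3: "\<mu> * (1 - u2) + lam * u2 * (z / y - 1) < 0"
  proof -
    have "d * (lam * et) < \<mu> - lam * et" using d(3) et pos by (simp add: less_divide_eq)
    then have "d * (lam * et * (1 + d)) < d * \<mu>" using d(1) by (intro mult_strict_left_mono) (auto simp: algebra_simps)
    then show ?thesis by (simp add: u2_def zy algebra_simps)
  qed
  have e5: "lam * (u2 - 1) + \<alpha> * (u2 / y - 1) < 0"
  proof -
    have "0 < lam + \<alpha> / y" using pos y by (intro add_pos_pos divide_pos_pos) auto
    then have "d * (lam + \<alpha> / y) < \<alpha> - \<alpha> / y" using d(2) by (simp add: less_divide_eq)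
    then show ?thesis by (simp add: u2_def algebra_simps add_divide_distrib)
  qed
  have e4: "lam * (u2 - 1) + \<alpha> * (u2 / y - 1) + \<alpha> * (u2 * y / z - 1) < 0"
  proof -
    have "0 < 1 + et * d" using et d by (intro add_pos_pos) auto
    then have "u2 / (1 + et * d) < 1" using etd by (simp add: u2_def)
    moreover have "u2 * y / z = u2 / (1 + et * d)" using y by (simp add: z_def)
    ultimately have "\<alpha> * (u2 * y / z - 1) < 0" using pos by (simp add: mult_less_0_iff)
    then show ?thesis using e5 by linarith
  qed
  have "\<exists>f e b n0. 0 < e \<and> 0 \<le> b \<and> (\<forall>x. 0 \<le> f x) \<and> (\<forall>R. finite {x. f x < R}) \<and>
        (\<forall>m n k. retrial_drift lam \<mu> \<alpha> f (m, n, k)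
           \<le> (if m = 0 \<and> n \<le> n0 then b else 0) - e * (s ^ (2 * m + n) + z ^ m * y ^ n))"
    if s: "1 < s" "z \<le> s\<^sup>2" "s < 1 / ?\<rho>" for s
  proof -
    have "2 * \<alpha> * \<mu> * (?\<rho> * s) < 2 * \<alpha> * \<mu> * 1"
      using pos s rho by (intro mult_strict_left_mono) (auto simp: field_simps)
    then have ls: "lam * (lam + 2 * \<alpha>) * s < 2 * \<alpha> * \<mu>" using rho(2) by (simp add: mult.assoc)
    moreover have "0 < lam * lam * s" using pos s by auto
    ultimately have "(2 * \<alpha>) * (lam * s) < (2 * \<alpha>) * \<mu>" by (simp add: algebra_simps)
    then have "lam * s < \<mu>" using pos by simp
    then have den: "0 < \<mu> - lam * (s - 1)" using pos by (simp add: algebra_simps)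
    have den2: "0 < lam + 2 * \<alpha> / s" using pos s by (intro add_pos_pos divide_pos_pos) auto
    have "\<mu> / (\<mu> - lam * (s - 1)) < (lam + 2 * \<alpha>) / (lam + 2 * \<alpha> / s)"
    proof -
      have "0 < (s - 1) * (2 * \<alpha> * \<mu> - lam * (lam + 2 * \<alpha>) * s)" using s ls by simp
      then have "\<mu> * (lam * s + 2 * \<alpha>) < (lam + 2 * \<alpha>) * s * (\<mu> - lam * (s - 1))"
        by (simp add: algebra_simps)
      then have "\<mu> * (lam + 2 * \<alpha> / s) * s < (lam + 2 * \<alpha>) * (\<mu> - lam * (s - 1)) * s"
        using s by (simp add: distrib_left distrib_right mult_ac)
      then have "\<mu> * (lam + 2 * \<alpha> / s) < (lam + 2 * \<alpha>) * (\<mu> - lam * (s - 1))" using s by simp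
      then show ?thesis using den den2 by (simp add: divide_less_eq less_divide_eq mult_ac)
    qed
    then obtain u1 where u1: "\<mu> / (\<mu> - lam * (s - 1)) < u1" "u1 < (lam + 2 * \<alpha>) / (lam + 2 * \<alpha> / s)"
      using dense by blast
    have "1 < \<mu> / (\<mu> - lam * (s - 1))" using den pos s by (simp add: less_divide_eq)
    then have u11: "1 < u1" using u1 by linarith
    have e1: "\<mu> * (1 - u1) + lam * u1 * (s - 1) < 0"
      using u1(1) den by (simp add: divide_less_eq algebra_simps)
    have e2: "lam * (u1 - 1) + 2 * \<alpha> * (u1 / s - 1) < 0"
      using u1(2) den2 by (simp add: less_divide_eq algebra_simps)
    show ?thesis
      by (rule geometric_Lyapunov[OF pos s(1) _ z(1) s(2) u11 _ e1 e2 e3 e4 e5])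
         (use s y d in \<open>auto simp: u2_def\<close>)
  qed
  then show ?thesis using y z by blast
qed

text \<open>Recurrence of the level \<open>m = 0\<close>. Without it all mass could escape to infinity, and the limit law
would be zero.\<close>

lemma retrial_recurrence:
  fixes lam \<mu> \<alpha> :: real
  assumes pos: "0 < lam" "0 < \<mu>" "0 < \<alpha>" and stable: "rho lam \<mu> \<alpha> < 1"
    and P: "transition_function (generator (retrial_rate lam \<mu> \<alpha>)) P"
  shows "\<exists>n k. \<not> ((\<lambda>t. P t x0 (0, n, k)) \<longlongrightarrow> 0) at_top"
proof -
  let ?\<rho> = "rho lam \<mu> \<alpha>"
  have rho: "0 < ?\<rho>" using pos by (auto simp: rho_def)
  obtain y z where y: "1 / ?\<rho> < y" and z: "1 \<le> z" "z < (1 / ?\<rho>)\<^sup>2" and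
    Ly: "\<And>s. 1 < s \<and> z \<le> s\<^sup>2 \<and> s < 1 / rho lam \<mu> \<alpha> \<Longrightarrow>
      (\<exists>f e b n0. 0 < e \<and> 0 \<le> b \<and> (\<forall>x. 0 \<le> f x) \<and> (\<forall>R. finite {x. f x < R}) \<and>
        (\<forall>m n k. retrial_drift lam \<mu> \<alpha> f (m, n, k)
           \<le> (if m = 0 \<and> n \<le> n0 then b else 0) - e * (s ^ (2 * m + n) + z ^ m * y ^ n)))"
    using retrial_Lyapunov_exists[OF pos stable] by blast
  have "sqrt z < 1 / ?\<rho>" using z rho by (intro real_less_lsqrt) auto
  then obtain s where s: "sqrt z < s" "s < 1 / ?\<rho>" using dense by blast
  have "1 \<le> sqrt z" using z by simp
  then have s1: "1 < s" using s by linarith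
  have "(sqrt z)\<^sup>2 \<le> s\<^sup>2" using s z by (intro power_mono) auto
  then have zs: "z \<le> s\<^sup>2" using z by simp
  obtain f e b n0 where f: "0 < e" "0 \<le> b" "\<And>x. 0 \<le> f x" "\<And>R. finite {x. f x < R}"
    and drift: "\<And>m n k. retrial_drift lam \<mu> \<alpha> f (m, n, k)
           \<le> (if m = 0 \<and> n \<le> n0 then b else 0) - e * (s ^ (2 * m + n) + z ^ m * y ^ n)"
    using Ly[of s] s1 zs s by blast
  let ?C = "{0} \<times> {..n0} \<times> (UNIV :: bool set)"
  have "\<not> (\<forall>y\<in>?C. ((\<lambda>t. P t x0 y) \<longlongrightarrow> 0) at_top)"
  proof (rule Lyapunov_recurrence[OF P, where f = f and d = "retrial_drift lam \<mu> \<alpha> f" and e = e and b = b])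
    show "0 \<le> generator (retrial_rate lam \<mu> \<alpha>) x y" if "x \<noteq> y" for x y
      using that retrial_rate_nonneg[OF pos] by (simp add: retrial_generator_off_diag)
    show "(generator (retrial_rate lam \<mu> \<alpha>) x has_sum 0) UNIV" for x
      using has_sum_retrial_generator[of lam \<mu> \<alpha> x "\<lambda>_. 1"] by (simp add: retrial_drift_const)
    show "retrial_drift lam \<mu> \<alpha> f x \<le> (if x \<in> ?C then b else 0) - e" for x
    proof (cases x)
      case (fields m n k)
      have "1 \<le> s ^ (2 * m + n)" using s1 by (intro one_le_power) auto
      moreover have "0 \<le> z ^ m * y ^ n" using z y rho
        by (intro mult_nonneg_nonneg zero_le_power) (auto intro: order_trans[OF _ less_imp_le[OF y]])
      ultimately have "e * 1 \<le> e * (s ^ (2 * m + n) + z ^ m * y ^ n)" using f by (intro mult_left_mono) auto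
      then show ?thesis using drift[of m n k] fields by (auto split: if_splits)
    qed
  qed (use f has_sum_retrial_generator in auto)
  then show ?thesis by auto
qed

text \<open>The first moment bound says that the generating function of \<open>q\<close> converges up to, but not including,
the point \<open>x = 1 / \<rho>\<^sup>2\<close>, \<open>y = 1 / \<rho>\<close>; the second that the boundary series in \<open>y\<close> alone converges
strictly beyond \<open>1 / \<rho>\<close>.\<close>

lemma retrial_moments:
  fixes lam \<mu> \<alpha> :: real
  assumes pos: "0 < lam" "0 < \<mu>" "0 < \<alpha>" and stable: "rho lam \<mu> \<alpha> < 1"
    and q0: "\<And>x. 0 \<le> q x" and q1: "\<And>F. finite F \<Longrightarrow> sum q F \<le> 1"
    and sub: "\<And>F y. finite F \<Longrightarrow> y \<in> F \<Longrightarrow> (\<Sum>z\<in>F. q z * generator (retrial_rate lam \<mu> \<alpha>) z y) \<le> 0"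
  shows "\<And>s. 1 < s \<Longrightarrow> s < 1 / rho lam \<mu> \<alpha> \<Longrightarrow> (\<lambda>(m, n, k). q (m, n, k) * s ^ (2 * m + n)) summable_on UNIV"
    and "\<exists>y > 1 / rho lam \<mu> \<alpha>. summable (\<lambda>n. q (0, n, False) * y ^ n)"
proof -
  let ?\<rho> = "rho lam \<mu> \<alpha>"
  have rho: "0 < ?\<rho>" using pos by (auto simp: rho_def)
  obtain y z where y: "1 / ?\<rho> < y" and z: "1 \<le> z" "z < (1 / ?\<rho>)\<^sup>2" and
    Ly: "\<And>s. 1 < s \<and> z \<le> s\<^sup>2 \<and> s < 1 / rho lam \<mu> \<alpha> \<Longrightarrow>
      (\<exists>f e b n0. 0 < e \<and> 0 \<le> b \<and> (\<forall>x. 0 \<le> f x) \<and> (\<forall>R. finite {x. f x < R}) \<and>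
        (\<forall>m n k. retrial_drift lam \<mu> \<alpha> f (m, n, k)
           \<le> (if m = 0 \<and> n \<le> n0 then b else 0) - e * (s ^ (2 * m + n) + z ^ m * y ^ n)))"
    using retrial_Lyapunov_exists[OF pos stable] by blast
  have y0: "0 < y" using y rho by (auto intro: less_trans[OF _ y])
  have szlt: "sqrt z < 1 / ?\<rho>" using z rho by (intro real_less_lsqrt) auto
  have both: "(\<lambda>(m, n, k). q (m, n, k) * (s ^ (2 * m + n) + z ^ m * y ^ n)) summable_on UNIV"
    if s: "1 < s" "sqrt z \<le> s" "s < 1 / ?\<rho>" for s
  proof -
    have "(sqrt z)\<^sup>2 \<le> s\<^sup>2" using s z by (intro power_mono) auto
    then have zs: "z \<le> s\<^sup>2" using z by simp
    obtain f e b n0 where f: "0 < e" "0 \<le> b" "\<And>x. 0 \<le> f x" "\<And>R. finite {x. f x < R}"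
      and drift: "\<And>m n k. retrial_drift lam \<mu> \<alpha> f (m, n, k)
             \<le> (if m = 0 \<and> n \<le> n0 then b else 0) - e * (s ^ (2 * m + n) + z ^ m * y ^ n)"
      using Ly[of s] zs s by blast
    define g where "g = (\<lambda>(m, n, k :: bool). e * (s ^ (2 * m + n) + z ^ m * y ^ n))"
    have "(\<lambda>x. q x * g x) summable_on UNIV"
    proof (rule substationary_moment_bound[OF q0 q1 sub, where f = f and d = "retrial_drift lam \<mu> \<alpha> f" and b = b])
      show "0 \<le> generator (retrial_rate lam \<mu> \<alpha>) x y" if "x \<noteq> y" for x y
        using that retrial_rate_nonneg[OF pos] by (simp add: retrial_generator_off_diag)
      show "(generator (retrial_rate lam \<mu> \<alpha>) x has_sum 0) UNIV" for x
        using has_sum_retrial_generator[of lam \<mu> \<alpha> x "\<lambda>_. 1"] by (simp add: retrial_drift_const)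
      show "retrial_drift lam \<mu> \<alpha> f x \<le> b - g x" for x
      proof (cases x)
        case (fields m n k)
        then show ?thesis using drift[of m n k] f by (auto simp: g_def split: if_splits)
      qed
      show "0 \<le> g x" for x using f s z y0 by (auto simp: g_def split: prod.split)
    qed (use f has_sum_retrial_generator in auto)
    then have "(\<lambda>x. 1 / e * (q x * g x)) summable_on UNIV" by (rule summable_on_cmult_right)
    moreover have "(\<lambda>x. 1 / e * (q x * g x)) = (\<lambda>(m, n, k). q (m, n, k) * (s ^ (2 * m + n) + z ^ m * y ^ n))"
      using f by (auto simp: g_def)
    ultimately show ?thesis by simp
  qed
  show "(\<lambda>(m, n, k). q (m, n, k) * s ^ (2 * m + n)) summable_on UNIV" if s: "1 < s" "s < 1 / ?\<rho>" for s
  proof -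
    let ?s = "max s (sqrt z)"
    have "(\<lambda>x. norm (case x of (m, n, k) \<Rightarrow> q (m, n, k) * s ^ (2 * m + n))) summable_on UNIV"
    proof (rule Infinite_Sum.abs_summable_on_comparison_test'[OF both[of ?s]])
      fix x :: "nat \<times> nat \<times> bool"
      obtain m n k where x: "x = (m, n, k)" by (cases x)
      have "s ^ (2 * m + n) \<le> ?s ^ (2 * m + n)" using s by (intro power_mono) auto
      moreover have "0 \<le> z ^ m * y ^ n" using z y0 by auto
      ultimately have "q x * s ^ (2 * m + n) \<le> q x * (?s ^ (2 * m + n) + z ^ m * y ^ n)"
        using q0 by (intro mult_left_mono) auto
      then show "norm (case x of (m, n, k) \<Rightarrow> q (m, n, k) * s ^ (2 * m + n))
        \<le> (case x of (m, n, k) \<Rightarrow> q (m, n, k) * (?s ^ (2 * m + n) + z ^ m * y ^ n))"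
        using s q0[of x] by (simp add: x abs_mult)
    qed (use s szlt in auto)
    then show ?thesis by (rule abs_summable_summable)
  qed
  show "\<exists>y > 1 / ?\<rho>. summable (\<lambda>n. q (0, n, False) * y ^ n)"
  proof (intro exI[of _ y] conjI y)
    have "max 1 (sqrt z) < 1 / ?\<rho>" using szlt rho stable by auto
    then obtain s where s: "max 1 (sqrt z) < s" "s < 1 / ?\<rho>" using dense by blast
    let ?g = "\<lambda>(m, n, k). q (m, n, k) * (s ^ (2 * m + n) + z ^ m * y ^ n)"
    have "?g summable_on range (\<lambda>n. (0, n, False))"
      by (rule summable_on_subset[OF both[of s]]) (use s in auto)
    then have "(?g \<circ> (\<lambda>n. (0, n, False))) summable_on UNIV"
      by (subst (asm) summable_on_reindex) (auto simp: inj_on_def)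
    then have "summable (?g \<circ> (\<lambda>n. (0, n, False)))" by (rule summable_on_imp_summable)
    then show "summable (\<lambda>n. q (0, n, False) * y ^ n)"
    proof (rule summable_comparison_test_ev[rotated], intro always_eventually allI)
      fix n
      have "0 \<le> s ^ n" using s by auto
      then have "q (0, n, False) * y ^ n \<le> q (0, n, False) * (s ^ n + y ^ n)"
        using q0 by (intro mult_left_mono) auto
      then show "norm (q (0, n, False) * y ^ n) \<le> (?g \<circ> (\<lambda>n. (0, n, False))) n"
        using q0 y0 by (simp add: abs_mult)
    qed
  qed
qed

section \<open>The kernel method\<close>

text \<open>The balance equations, tested against a geometric weight. The moment bound dominates the weight and
its values at the successors.\<close>

lemma retrial_geometric_pairing:
  fixes q :: "nat \<times> nat \<times> bool \<Rightarrow> real"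
  assumes pos: "0 < lam" "0 < \<mu>" "0 < \<alpha>"
    and q0: "\<And>x. 0 \<le> q x"
    and stat: "\<And>y. ((\<lambda>x. q x * generator (retrial_rate lam \<mu> \<alpha>) x y) has_sum 0) UNIV"
    and s: "1 < s" and mom: "(\<lambda>(m, n, k). q (m, n, k) * s ^ (2 * m + n)) summable_on UNIV"
    and xy: "0 < x" "x \<le> s\<^sup>2" "0 < y" "y \<le> s" and u: "0 < u"
  shows "((\<lambda>p. q p * retrial_drift lam \<mu> \<alpha> (geometric_weight x y u) p) has_sum 0) UNIV"
proof -
  let ?Q = "generator (retrial_rate lam \<mu> \<alpha>)"
  let ?F = "geometric_weight x y u"
  define U where "U = max 1 u"
  define W where "W = (\<lambda>(m, n, k :: bool). s ^ (2 * m + n) :: real)"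
  have W: "\<bar>?F p\<bar> \<le> U * W p" for p
  proof (cases p)
    case (fields m n k)
    have "x ^ m * y ^ n \<le> (s\<^sup>2) ^ m * s ^ n" using xy s by (intro mult_mono power_mono) auto
    also have "\<dots> = W p" by (simp add: W_def fields power_add power_mult)
    finally have "x ^ m * y ^ n * (if k then u else 1) \<le> W p * U"
      using xy s u by (intro mult_mono) (auto simp: U_def W_def fields)
    moreover have "0 \<le> x ^ m * y ^ n * (if k then u else 1)" using xy u by simp
    ultimately show ?thesis by (simp add: geometric_weight_def fields mult.commute abs_mult)
  qed
  have "\<bar>?F p'\<bar> \<le> s * U * W p" if "p' \<in> insert p (successors p)" for p p'
  proof -
    obtain m n k where p: "p = (m, n, k)" by (cases p)
    obtain m' n' k' where p': "p' = (m', n', k')" by (cases p')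
    have "2 * m' + n' \<le> Suc (2 * m + n)" using that
      by (auto simp: p p' successors_def split: if_splits)
    then have "s ^ (2 * m' + n') \<le> s ^ Suc (2 * m + n)" using s by (intro power_increasing) auto
    then have "W p' \<le> s * W p" by (simp add: W_def p p')
    then have "U * W p' \<le> U * (s * W p)" by (intro mult_left_mono) (auto simp: U_def)
    then show ?thesis using W[of p'] by (simp add: mult_ac)
  qed
  then have "\<exists>c. ((\<lambda>p'. \<bar>?Q p p' * ?F p'\<bar>) has_sum c) UNIV \<and> c \<le> 2 * (lam + \<mu> + 3 * \<alpha>) * (s * U * W p)" for p
    by (rule has_sum_abs_retrial_generator[OF pos])
  then obtain c where c: "\<And>p. ((\<lambda>p'. \<bar>?Q p p' * ?F p'\<bar>) has_sum c p) UNIV"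
    "\<And>p. c p \<le> 2 * (lam + \<mu> + 3 * \<alpha>) * (s * U * W p)" by metis
  have qW: "(\<lambda>p. q p * W p) summable_on UNIV" using mom by (simp add: W_def case_prod_unfold)
  have "(\<lambda>p. q p * c p) summable_on UNIV"
  proof (rule abs_summable_summable)
    show "(\<lambda>p. norm (q p * c p)) summable_on UNIV"
    proof (rule Infinite_Sum.abs_summable_on_comparison_test'[OF summable_on_cmult_right[OF qW, of "2 * (lam + \<mu> + 3 * \<alpha>) * (s * U)"]])
      fix p
      have "0 \<le> c p" using has_sum_nonneg[OF c(1)[of p]] by simp
      then show "norm (q p * c p) \<le> 2 * (lam + \<mu> + 3 * \<alpha>) * (s * U) * (q p * W p)"
        using mult_left_mono[OF c(2)[of p] q0[of p]] q0[of p] by (simp add: abs_mult mult_ac)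
    qed
  qed
  from generator_duality[OF q0 c(1) this has_sum_retrial_generator stat]
  obtain S where S: "((\<lambda>p. q p * retrial_drift lam \<mu> \<alpha> ?F p) has_sum S) UNIV" "((\<lambda>p. ?F p * 0) has_sum S) UNIV"
    by blast
  have "S = 0" by (rule has_sum_unique[OF S(2)], rule has_sum_0) simp
  with S show ?thesis by simp
qed

lemma sums_nonneg_imp_has_sum:
  fixes f :: "nat \<Rightarrow> real"
  assumes "f sums S" "\<And>n. 0 \<le> f n"
  shows "(f has_sum S) UNIV"
  by (rule norm_summable_imp_has_sum) (use assms in \<open>auto simp: sums_iff\<close>)

text \<open>The kernel equation says that the drift factor of the weight \<open>x\<^sup>m y\<^sup>n u\<^sup>k\<close>, with \<open>y = x t\<close> and a suitable
\<open>u\<close>, vanishes at the idle and at the busy states with \<open>m, n \<ge> 1\<close>. It then also vanishes at the busy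
states with \<open>m = 0\<close>, \<open>n \<ge> 1\<close>. What is left of the paired balance equations are the states with
\<open>n = 0\<close>, which contribute the series \<open>A\<close> and a term for \<open>m = 0\<close>, and the idle states with \<open>m = 0\<close>,
\<open>n \<ge> 1\<close>, which contribute \<open>B\<close>. The series \<open>B\<close> starts at \<open>n = 1\<close> with a factor \<open>y\<close> removed; that factor
absorbs the division by \<open>t\<close> in \<open>1 / u\<close>, and so the right-hand side stays regular at \<open>t = 0\<close>.\<close>

lemma boundary_identity:
  fixes q :: "nat \<times> nat \<times> bool \<Rightarrow> real"
  assumes pos: "0 < lam" "0 < \<mu>" "0 < \<alpha>"
    and q0: "\<And>p. 0 \<le> q p"
    and idle: "\<And>m n. \<mu> * q (m, n, True) =
     (lam + (if n = 0 then 0 else \<alpha>) + (if m = 0 then 0 else if n = 0 then 2 * \<alpha> else \<alpha>)) * q (m, n, False)"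
    and xt: "0 < x" "0 < t" and kernel: "t\<^sup>2 - 2 * (1 + rho lam \<mu> \<alpha>) * t + 2 * rho lam \<mu> \<alpha> + 1 / x = 0"
    and pairing: "\<And>u. 0 < u \<Longrightarrow>
      ((\<lambda>p. q p * retrial_drift lam \<mu> \<alpha> (geometric_weight x (x * t) u) p) has_sum 0) UNIV"
    and A: "(\<lambda>m. q (Suc m, 0, False) * x ^ Suc m) sums A"
    and B: "(\<lambda>n. q (0, Suc n, False) * (x * t) ^ n) sums B"
  shows "2 * \<alpha> * (t - 1 + rho lam \<mu> \<alpha> * (x * t - 1)) * A =
    - (\<alpha> * B * (x * t * (1 + lam / \<mu> - t) - lam / \<mu> * x) + lam\<^sup>2 / \<mu> * (x * t - 1) * q (0, 0, False))"
proof -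
  let ?r = "rho lam \<mu> \<alpha>"
  have r: "2 * \<alpha> * ?r = lam * (lam + 2 * \<alpha>) / \<mu>" using pos by (simp add: rho_def)
  define y where "y = x * t"
  have y: "0 < y" "y \<noteq> 0" "x \<noteq> 0" using xt by (auto simp: y_def)
  \<comment> \<open>w = 1 / u, where u is the solution of the idle equation in the interior.\<close>
  define w where "w = (lam + \<alpha> / y + \<alpha> * t) / (lam + 2 * \<alpha>)"
  define u where "u = 1 / w"
  have "0 < lam + \<alpha> / y + \<alpha> * t" using pos xt y by (intro add_pos_pos divide_pos_pos mult_pos_pos) auto
  then have w: "0 < w" using pos by (simp add: w_def)
  then have u: "0 < u" "u * w = 1" by (auto simp: u_def)
  have k: "1 / y + t = 2 + 2 * ?r - 2 * ?r / t"
  proof -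
    have "1 / y = 1 / x / t" by (simp add: y_def)
    also have "1 / x = 2 * (1 + ?r) * t - 2 * ?r - t\<^sup>2" using kernel by simp
    finally show ?thesis using xt by (simp add: diff_divide_distrib power2_eq_square)
  qed
  \<comment> \<open>The kernel equation turns it into the solution of the busy equation.\<close>
  have w': "w = 1 + lam / \<mu> - lam / \<mu> / t"
  proof -
    have "\<alpha> / y + \<alpha> * t = \<alpha> * (1 / y + t)" by (simp add: distrib_left)
    also have "\<dots> = 2 * \<alpha> + 2 * \<alpha> * ?r - 2 * \<alpha> * ?r / t" unfolding k by (simp add: algebra_simps)
    also have "\<dots> = 2 * \<alpha> + (lam + 2 * \<alpha>) * (lam / \<mu>) - (lam + 2 * \<alpha>) * (lam / \<mu> / t)" unfolding r by (simp add: mult.commute)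
    finally have "lam + \<alpha> / y + \<alpha> * t = (lam + 2 * \<alpha>) * (1 + lam / \<mu> - lam / \<mu> / t)"
      by (simp add: algebra_simps)
    then show ?thesis using pos by (simp add: w_def)
  qed
  let ?F = "geometric_weight x y u"
  define dA where "dA = lam * (u - 1) + 2 * \<alpha> * (u * t - 1)"
  define dB where "dB = \<mu> * (1 - u) + lam * u * (y - 1)"
  define dC where "dC = \<alpha> * (1 - u * t)"
  have busy0: "\<mu> * (1 - u) + lam * u * (1 / t - 1) = 0"
  proof -
    have "\<mu> * (1 - u) + lam * u * (1 / t - 1) = \<mu> * u * w - \<mu> * u - lam * u + lam * u / t"
      using u by (simp add: algebra_simps)
    also have "\<dots> = \<mu> * u * (w - (1 + lam / \<mu> - lam / \<mu> / t))" using pos by (simp add: algebra_simps)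
    finally show ?thesis using w' by simp
  qed
  have idle0: "lam * (u - 1) + \<alpha> * (u / y - 1) + \<alpha> * (u * t - 1) = 0"
  proof -
    have "lam * (u - 1) + \<alpha> * (u / y - 1) + \<alpha> * (u * t - 1) = u * (lam + \<alpha> / y + \<alpha> * t) - (lam + 2 * \<alpha>)"
      by (simp add: algebra_simps)
    also have "lam + \<alpha> / y + \<alpha> * t = w * (lam + 2 * \<alpha>)" using pos by (simp add: w_def)
    also have "u * (w * (lam + 2 * \<alpha>)) = lam + 2 * \<alpha>" using u by (simp add: mult.assoc[symmetric])
    finally show ?thesis by simp
  qed
  define f where "f p = q p * retrial_drift lam \<mu> \<alpha> ?F p" for p
  have xyt: "x / y = 1 / t" "u * y / x = u * t" using xt by (auto simp: y_def)
  have f: "f (m, n, k) = q (m, n, k) * (x ^ m * y ^ n *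
    (if k then \<mu> * (1 - u) + lam * u * ((if n = 0 then y else 1 / t) - 1)
     else lam * (u - 1) + (if n = 0 then 0 else \<alpha> * (u / y - 1))
       + (if m = 0 then 0 else (if n = 0 then 2 * \<alpha> else \<alpha>) * (u * t - 1))))" for m n k
    unfolding f_def by (subst geometric_drift) (use y xyt in auto)
  have f_A: "f (Suc m, 0, False) = q (Suc m, 0, False) * x ^ Suc m * dA" for m
    by (simp add: f dA_def)
  have f_B: "f (Suc m, 0, True) = q (Suc m, 0, False) * x ^ Suc m * ((lam + 2 * \<alpha>) / \<mu> * dB)" for m
  proof -
    have "q (Suc m, 0, True) = (lam + 2 * \<alpha>) / \<mu> * q (Suc m, 0, False)"
      using idle[of "Suc m" 0] pos by (simp add: field_simps)
    then show ?thesis by (simp add: f dB_def)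
  qed
  have f_C: "f (0, Suc n, False) = q (0, Suc n, False) * (x * t) ^ n * (y * dC)" for n
  proof -
    have "lam * (u - 1) + \<alpha> * (u / y - 1) = dC" using idle0 by (simp add: dC_def algebra_simps)
    then show ?thesis by (simp add: f y_def)
  qed
  have f_0: "f (0, 0, False) + f (0, 0, True) = q (0, 0, False) * (lam\<^sup>2 / \<mu> * u * (y - 1))"
  proof -
    have "q (0, 0, True) = lam / \<mu> * q (0, 0, False)"
      using idle[of 0 0] pos by (simp add: field_simps)
    then have "f (0, 0, False) + f (0, 0, True) = q (0, 0, False) * (lam * (u - 1) + lam / \<mu> * dB)"
      by (simp add: f dB_def distrib_left mult_ac)
    also have "lam * (u - 1) + lam / \<mu> * dB = lam\<^sup>2 / \<mu> * u * (y - 1)"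
      using pos by (simp add: dB_def power2_eq_square field_simps)
    finally show ?thesis .
  qed
  have f_zero: "f p = 0"
    if "p \<notin> range (\<lambda>m. (Suc m, 0, False))" "p \<notin> range (\<lambda>m. (Suc m, 0, True))"
      "p \<notin> range (\<lambda>n. (0, Suc n, False))" "p \<notin> {(0, 0, False), (0, 0, True)}" for p
  proof (cases p)
    case (fields m n k)
    have "n \<noteq> 0" using that fields by (cases m; cases k) auto
    moreover have "k \<or> m \<noteq> 0" using that fields \<open>n \<noteq> 0\<close> by (cases n; cases k) auto
    ultimately show ?thesis using busy0 idle0 by (auto simp: fields f)
  qed
  have A': "((\<lambda>m. q (Suc m, 0, False) * x ^ Suc m) has_sum A) UNIV"
    by (rule sums_nonneg_imp_has_sum[OF A]) (use q0 xt in auto)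
  have B': "((\<lambda>n. q (0, Suc n, False) * (x * t) ^ n) has_sum B) UNIV"
    by (rule sums_nonneg_imp_has_sum[OF B]) (use q0 xt in auto)
  have S1: "(f has_sum A * dA) (range (\<lambda>m. (Suc m, 0, False)))"
    by (subst has_sum_reindex) (use has_sum_cmult_left[OF A', of dA] in \<open>auto simp: inj_on_def comp_def f_A\<close>)
  have S2: "(f has_sum A * ((lam + 2 * \<alpha>) / \<mu> * dB)) (range (\<lambda>m. (Suc m, 0, True)))"
    by (subst has_sum_reindex)
       (use has_sum_cmult_left[OF A', of "(lam + 2 * \<alpha>) / \<mu> * dB"] in \<open>auto simp: inj_on_def comp_def f_B\<close>)
  have S3: "(f has_sum B * (y * dC)) (range (\<lambda>n. (0, Suc n, False)))"
    by (subst has_sum_reindex)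
       (use has_sum_cmult_left[OF B', of "y * dC"] in \<open>auto simp: inj_on_def comp_def f_C\<close>)
  have S4: "(f has_sum (f (0, 0, False) + f (0, 0, True))) {(0, 0, False), (0, 0, True)}"
    by (rule has_sum_finiteI) auto
  have "(f has_sum (A * dA + A * ((lam + 2 * \<alpha>) / \<mu> * dB) + B * (y * dC) + (f (0, 0, False) + f (0, 0, True))))
    (range (\<lambda>m. (Suc m, 0, False)) \<union> range (\<lambda>m. (Suc m, 0, True)) \<union> range (\<lambda>n. (0, Suc n, False))
      \<union> {(0, 0, False), (0, 0, True)})" (is "(f has_sum ?S) ?T")
    by (intro has_sum_Un_disjoint S1 S2 S3 S4) auto
  also have "(f has_sum ?S) ?T \<longleftrightarrow> (f has_sum ?S) UNIV"
    by (rule has_sum_cong_neutral) (use f_zero in auto)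
  finally have "(f has_sum ?S) UNIV" .
  moreover have "(f has_sum 0) UNIV" using pairing[OF u(1)] by (simp add: f_def[abs_def] y_def)
  ultimately have S0: "?S = 0" by (rule has_sum_unique)
  have "dA + (lam + 2 * \<alpha>) / \<mu> * dB = 2 * \<alpha> * u * (t - 1) + u * (lam * (lam + 2 * \<alpha>) / \<mu>) * (y - 1)"
    using pos by (simp add: dA_def dB_def field_simps)
  also have "\<dots> = u * (2 * \<alpha> * (t - 1 + ?r * (y - 1)))"
    unfolding r[symmetric] by (simp add: algebra_simps)
  finally have AB: "A * dA + A * ((lam + 2 * \<alpha>) / \<mu> * dB) = u * (2 * \<alpha> * (t - 1 + ?r * (y - 1)) * A)"
    unfolding distrib_left[symmetric] by simp
  have "y * dC = u * (\<alpha> * (y * w - y * t))" using u by (simp add: dC_def algebra_simps)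
  also have "y * w = y * (1 + lam / \<mu>) - lam / \<mu> * x" using xt by (simp add: w' y_def algebra_simps)
  also have "u * (\<alpha> * (y * (1 + lam / \<mu>) - lam / \<mu> * x - y * t))
    = u * (\<alpha> * (y * (1 + lam / \<mu> - t) - lam / \<mu> * x))" by (simp add: algebra_simps)
  finally have C: "B * (y * dC) = u * (\<alpha> * B * (y * (1 + lam / \<mu> - t) - lam / \<mu> * x))"
    by (simp only: mult_ac)
  have "u * (2 * \<alpha> * (t - 1 + ?r * (y - 1)) * A + \<alpha> * B * (y * (1 + lam / \<mu> - t) - lam / \<mu> * x)
     + lam\<^sup>2 / \<mu> * (y - 1) * q (0, 0, False)) = 0"
    using S0 unfolding AB C f_0 by (simp add: algebra_simps)
  then show ?thesis using u by (simp add: y_def)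
qed

section \<open>Analytic continuation past the dominant singularity\<close>

text \<open>\<open>(1 - z / R) A z\<close> is a power series with coefficients \<open>a\<^sub>m - a\<^sub>m\<^sub>-\<^sub>1 / R\<close>. If it continues analytically
beyond \<open>R\<close>, that series converges at \<open>R\<close>, where its partial sums telescope to \<open>a\<^sub>m R\<^sup>m\<close>. The
continuation is glued from the disc and an annulus; that the pieces agree on the overlap only has to be
checked at real points.\<close>

lemma coefficient_limit_at_simple_pole:
  fixes a :: "nat \<Rightarrow> complex" and R0 R R' :: real
  assumes R: "0 \<le> R0" "R0 < R" "R < R'"
    and A: "\<And>z. norm z < R \<Longrightarrow> (\<lambda>m. a m * z ^ m) sums A z"
    and G: "G holomorphic_on {z. R0 < norm z \<and> norm z < R'}"
    and AG: "\<And>x. R0 < x \<Longrightarrow> x < R \<Longrightarrow> (1 - of_real x / of_real R) * A (of_real x) = G (of_real x)"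
  shows "(\<lambda>m. a m * of_real R ^ m) \<longlonglongrightarrow> G (of_real R)"
proof -
  define g0 where "g0 z = (1 - z / of_real R) * A z" for z
  have A_hol: "A holomorphic_on ball 0 R"
    by (rule power_series_holomorphic[where a = a]) (use A in auto)
  have g0_hol: "g0 holomorphic_on ball 0 R"
    unfolding g0_def using R by (intro holomorphic_intros A_hol) auto
  define U where "U = {z::complex. R0 < norm z \<and> norm z < R}"
  define V where "V = {z::complex. R0 < norm z \<and> norm z < R'}"
  have UV: "U \<subseteq> V" "U \<subseteq> ball 0 R" using R by (auto simp: U_def V_def)
  have open_U: "open U" unfolding U_def by (intro open_Collect_conj open_Collect_less continuous_intros)
  have open_V: "open V" unfolding V_def by (intro open_Collect_conj open_Collect_less continuous_intros)
  have conn: "connected U" using connected_annulus(1)[of R0 "0::complex" R] by (simp add: U_def)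
  have agree: "g0 z = G z" if z: "z \<in> U" for z
  proof -
    define \<xi> where "\<xi> = (R0 + R) / 2"
    have xi: "R0 < \<xi>" "\<xi> < R" using R by (auto simp: \<xi>_def)
    have "g0 z - G z = 0"
    proof (rule analytic_continuation[where f = "\<lambda>z. g0 z - G z" and w = z and S = U and \<xi> = "of_real \<xi>" and U = "of_real ` {R0<..<R}"])
      show "(\<lambda>z. g0 z - G z) holomorphic_on U"
        by (intro holomorphic_intros holomorphic_on_subset[OF g0_hol] holomorphic_on_subset[OF G])
           (use UV in \<open>auto simp: V_def\<close>)
      show "complex_of_real ` {R0<..<R} \<subseteq> U" using R by (auto simp: U_def)
      show "complex_of_real \<xi> \<in> U" using xi R by (auto simp: U_def)
      show "complex_of_real \<xi> islimpt complex_of_real ` {R0<..<R}"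
        unfolding islimpt_approachable
      proof (intro allI impI)
        fix e :: real assume "0 < e"
        then have "\<xi> + min e (R - \<xi>) / 2 \<in> {R0<..<R} \<and> dist (\<xi> + min e (R - \<xi>) / 2) \<xi> < e
          \<and> \<xi> + min e (R - \<xi>) / 2 \<noteq> \<xi>"
          using xi by (auto simp: dist_real_def min_def field_simps)
        then obtain p where "p \<in> {R0<..<R}" "dist p \<xi> < e" "p \<noteq> \<xi>" by blast
        then show "\<exists>w\<in>complex_of_real ` {R0<..<R}. w \<noteq> complex_of_real \<xi> \<and> dist w (complex_of_real \<xi>) < e"
          by (intro bexI[of _ "complex_of_real p"]) auto
      qed
      show "g0 w - G w = 0" if "w \<in> complex_of_real ` {R0<..<R}" for w
        using that AG by (auto simp: g0_def)
    qed (use open_U conn z in auto)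
    then show ?thesis by simp
  qed
  define g where "g z = (if z \<in> ball 0 R then g0 z else G z)" for z
  have "g holomorphic_on (ball 0 R \<union> V)" unfolding g_def
    by (rule holomorphic_on_If_Un[OF g0_hol _ _ open_V]) (use G agree in \<open>auto simp: V_def U_def\<close>)
  moreover have "ball 0 R' \<subseteq> ball 0 R \<union> V" using R by (auto simp: V_def)
  ultimately have g_hol: "g holomorphic_on ball 0 R'" by (rule holomorphic_on_subset)
  define c where "c m = a m - (if m = 0 then 0 else a (m - 1) / of_real R)" for m
  have "g has_fps_expansion Abs_fps c"
  proof (rule has_fps_expansionI)
    have "eventually (\<lambda>z::complex. z \<in> ball 0 R) (nhds 0)"
      using R by (intro eventually_nhds_in_open) auto
    then show "eventually (\<lambda>z. (\<lambda>n. fps_nth (Abs_fps c) n * z ^ n) sums g z) (nhds 0)"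
    proof eventually_elim
      case (elim z)
      then have z: "norm z < R" by simp
      have "(\<lambda>m. z / of_real R * (a m * z ^ m)) sums (z / of_real R * A z)"
        by (intro sums_mult A z)
      then have "(\<lambda>m. a m / of_real R * z ^ Suc m) sums (z / of_real R * A z)"
        by (simp add: mult_ac)
      then have "(\<lambda>m. (if m = 0 then 0 else a (m - 1) / of_real R) * z ^ m) sums (z / of_real R * A z)"
        using sums_Suc_iff[of "\<lambda>m. (if m = 0 then 0 else a (m - 1) / of_real R) * z ^ m" "z / of_real R * A z"]
        by simp
      from sums_diff[OF A[OF z] this]
      have "(\<lambda>m. c m * z ^ m) sums (A z - z / of_real R * A z)"
        by (simp add: c_def left_diff_distrib)
      then show ?case using elim by (simp add: g_def g0_def left_diff_distrib)
    qed
  qed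
  then have "(\<lambda>n. fps_nth (Abs_fps c) n * of_real R ^ n) sums g (of_real R)"
    by (rule has_fps_expansion_imp_sums_complex[where r = "ereal R'"]) (use g_hol R in auto)
  then have "(\<lambda>m. \<Sum>n<m. c n * of_real R ^ n) \<longlonglongrightarrow> G (of_real R)"
    using R by (simp add: sums_def g_def)
  then have "(\<lambda>m. \<Sum>n<Suc m. c n * of_real R ^ n) \<longlonglongrightarrow> G (of_real R)"
    by (rule LIMSEQ_Suc)
  moreover have "(\<Sum>n<Suc m. c n * of_real R ^ n) = a m * of_real R ^ m" for m
    by (induction m) (use R in \<open>auto simp: c_def field_simps\<close>)
  ultimately show ?thesis by simp
qed

lemma inverse_norm_less_1: "1 < norm z \<Longrightarrow> 1 / norm z < 1"
  by (subst divide_less_eq_1_pos) linarith+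

text \<open>Let \<open>r = \<surd>(1 + \<rho>\<^sup>2 - 1 / z)\<close>. On each circle of radius greater than \<open>1\<close> the modulus of the branch
\<open>t = 1 + \<rho> - r\<close> of the kernel curve is largest, and the real part of \<open>r\<close> smallest, at the positive real
point. For \<open>t\<close>, rationalize to
\<open>t = (2 \<rho> + 1 / z) / (1 + \<rho> + r)\<close> and estimate numerator and denominator separately.\<close>

lemma norm_kernel_branch_le:
  fixes z :: complex and \<rho> :: real
  assumes \<rho>: "0 < \<rho>" and z: "1 < norm z"
  shows "norm (1 + of_real \<rho> - csqrt (1 + of_real (\<rho>\<^sup>2) - 1 / z))
    \<le> (2 * \<rho> + 1 / norm z) / (1 + \<rho> + sqrt (1 + \<rho>\<^sup>2 - 1 / norm z))"
    and "sqrt (1 + \<rho>\<^sup>2 - 1 / norm z) \<le> Re (csqrt (1 + of_real (\<rho>\<^sup>2) - 1 / z))"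
proof -
  define c where "c = 1 + of_real (\<rho>\<^sup>2) - 1 / z"
  define r where "r = csqrt c"
  define h where "h = sqrt (1 + \<rho>\<^sup>2 - 1 / norm z)"
  have "Re (1 / z) \<le> norm (1 / z)" by (rule complex_Re_le_cmod)
  then have "1 + \<rho>\<^sup>2 - 1 / norm z \<le> Re c" by (simp add: c_def norm_divide)
  also have "c = r\<^sup>2" by (simp add: r_def)
  also have "Re (r\<^sup>2) \<le> (Re r)\<^sup>2" by (simp add: power2_eq_square)
  finally have "1 + \<rho>\<^sup>2 - 1 / norm z \<le> (Re r)\<^sup>2" .
  moreover have Re0: "0 \<le> Re r" using csqrt_principal[of c] by (auto simp: r_def)
  ultimately show h: "h \<le> Re r" unfolding h_def by (rule real_le_lsqrt[rotated -1])
  have "0 < 1 - 1 / norm z" using inverse_norm_less_1[OF z] by simp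
  then have "0 \<le> 1 + \<rho>\<^sup>2 - 1 / norm z" using zero_le_power2[of \<rho>] by linarith
  then have h0: "0 \<le> h" unfolding h_def by (rule real_sqrt_ge_zero)
  have "(1 + of_real \<rho> - r) * (1 + of_real \<rho> + r) = (1 + of_real \<rho>)\<^sup>2 - r\<^sup>2"
    by (simp add: power2_eq_square algebra_simps)
  also have "r\<^sup>2 = c" by (simp add: r_def)
  also have "(1 + of_real \<rho>)\<^sup>2 - c = 2 * of_real \<rho> + 1 / z"
    by (simp add: c_def power2_eq_square algebra_simps)
  finally have "norm (1 + of_real \<rho> - r) * norm (1 + of_real \<rho> + r) = norm (2 * of_real \<rho> + 1 / z)"
    by (metis norm_mult)
  also have "\<dots> \<le> 2 * \<rho> + 1 / norm z"
    by (rule norm_triangle_le) (use \<rho> in \<open>simp add: norm_mult norm_divide\<close>)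
  finally have le: "norm (1 + of_real \<rho> - r) * norm (1 + of_real \<rho> + r) \<le> 2 * \<rho> + 1 / norm z" .
  have "1 + \<rho> + h \<le> Re (1 + of_real \<rho> + r)" using h by simp
  also have "\<dots> \<le> norm (1 + of_real \<rho> + r)" by (rule complex_Re_le_cmod)
  finally have "norm (1 + of_real \<rho> - r) * (1 + \<rho> + h) \<le> norm (1 + of_real \<rho> - r) * norm (1 + of_real \<rho> + r)"
    by (intro mult_left_mono) auto
  with le have "norm (1 + of_real \<rho> - r) * (1 + \<rho> + h) \<le> 2 * \<rho> + 1 / norm z" by linarith
  moreover have "0 < 1 + \<rho> + h" using \<rho> h0 by simp
  ultimately show "norm (1 + of_real \<rho> - r) \<le> (2 * \<rho> + 1 / norm z) / (1 + \<rho> + h)"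
    by (simp add: pos_le_divide_eq)
qed

text \<open>In the coordinate \<open>r\<close> the kernel curve is rational. The last two equations are the reason for the simple
pole: the coefficient of the unknown series in the boundary identity vanishes only at \<open>r = 1\<close>,
\<open>r = \<rho>\<close> and \<open>r = - 1 - \<rho>\<close>, and \<open>r = 1\<close> is the point \<open>x = 1 / \<rho>\<^sup>2\<close>, a simple zero of \<open>1 - \<rho>\<^sup>2 x\<close>. The bound
\<open>x t \<le> \<surd>x\<close> keeps the weight \<open>x\<^sup>m (x t)\<^sup>n\<close> below \<open>s\<^sup>2\<^sup>m\<^sup>+\<^sup>n\<close> with \<open>s = \<surd>x\<close>.\<close>

lemma kernel_branch_real:
  fixes x \<rho> :: real
  assumes \<rho>: "0 < \<rho>" "\<rho> < 1" and x: "1 < x" "x < (1 / \<rho>)\<^sup>2"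
  defines "r \<equiv> sqrt (1 + \<rho>\<^sup>2 - 1 / x)"
  defines "t \<equiv> 1 + \<rho> - r"
  shows "\<rho> < r" "r < 1" "r\<^sup>2 = 1 + \<rho>\<^sup>2 - 1 / x"
    and "t\<^sup>2 - 2 * (1 + \<rho>) * t + 2 * \<rho> + 1 / x = 0"
    and "x * t \<le> sqrt x"
    and "t - 1 + \<rho> * (x * t - 1) = x * ((r - 1) * (r - \<rho>) * (r + 1 + \<rho>))"
    and "1 - x / (1 / \<rho>)\<^sup>2 = x * ((1 - r) * (1 + r))"
proof -
  have "\<rho>\<^sup>2 * x < 1" using x(2) \<rho> by (simp add: power_divide field_simps)
  then have ix: "\<rho>\<^sup>2 < 1 / x" "1 / x < 1" using x by (simp_all add: field_simps)
  have "0 \<le> 1 + \<rho>\<^sup>2 - 1 / x" using ix by (smt (verit) zero_le_power2)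
  then show r2: "r\<^sup>2 = 1 + \<rho>\<^sup>2 - 1 / x" unfolding r_def by (rule real_sqrt_pow2)
  show r: "\<rho> < r" "r < 1" using ix \<rho>
    by (auto simp: r_def intro!: real_less_rsqrt real_less_lsqrt)
  have ix': "1 / x = 1 + \<rho>\<^sup>2 - r\<^sup>2" using r2 by simp
  show "t\<^sup>2 - 2 * (1 + \<rho>) * t + 2 * \<rho> + 1 / x = 0"
    unfolding ix' t_def by (simp add: power2_eq_square algebra_simps)
  define s where "s = sqrt x"
  have s: "1 < s" "x = s\<^sup>2" using x by (auto simp: s_def)
  have ixs: "1 / x = (1 / s)\<^sup>2" using s by (simp add: power_divide)
  have "\<rho>\<^sup>2 < (1 / s)\<^sup>2" using ix(1) unfolding ixs .
  then have "\<rho> < 1 / s" by (rule power_less_imp_less_base) (use s(1) in simp)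
  moreover have s1: "1 / s < 1" using s(1) by simp
  ultimately have "(1 - 1 / s) * (1 / s - \<rho>) \<ge> 0" by simp
  moreover have "(1 + \<rho> - i)\<^sup>2 = 1 + \<rho>\<^sup>2 - i\<^sup>2 - 2 * ((1 - i) * (i - \<rho>))" for i
    by (simp add: power2_eq_square algebra_simps)
  ultimately have "(1 + \<rho> - 1 / s)\<^sup>2 \<le> 1 + \<rho>\<^sup>2 - 1 / x" unfolding ixs by simp
  then have "1 + \<rho> - 1 / s \<le> r" unfolding r_def by (rule real_le_rsqrt)
  then have "t \<le> 1 / s" by (simp add: t_def)
  then have "x * t \<le> x * (1 / s)" using x by (intro mult_left_mono) auto
  also have "\<dots> = s" unfolding s(2) using s(1) by (simp add: power2_eq_square)
  finally show "x * t \<le> sqrt x" by (simp add: s_def)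
  have x1: "x * (1 / x) = 1" using x by simp
  have expand: "x * (t * (i + \<rho>) - i * (1 + \<rho>)) = (x * i) * t + \<rho> * x * t - (x * i) * (1 + \<rho>)" for i
    by (simp add: algebra_simps)
  have "x * ((r - 1) * (r - \<rho>) * (r + 1 + \<rho>)) = x * (t * (1 / x + \<rho>) - 1 / x * (1 + \<rho>))"
    unfolding ix' t_def by (simp add: power2_eq_square algebra_simps)
  also have "\<dots> = (x * (1 / x)) * t + \<rho> * x * t - (x * (1 / x)) * (1 + \<rho>)"
    by (rule expand)
  also have "\<dots> = t - 1 + \<rho> * (x * t - 1)" unfolding x1 by (simp add: algebra_simps)
  finally show "t - 1 + \<rho> * (x * t - 1) = x * ((r - 1) * (r - \<rho>) * (r + 1 + \<rho>))" by simp
  have "(1 - r) * (1 + r) = 1 / x - \<rho>\<^sup>2" unfolding ix' by (simp add: power2_eq_square algebra_simps)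
  then show "1 - x / (1 / \<rho>)\<^sup>2 = x * ((1 - r) * (1 + r))"
    using x \<rho> by (simp add: right_diff_distrib power_divide)
qed

text \<open>Solving the boundary identity for \<open>A\<close> and multiplying by \<open>1 - \<rho>\<^sup>2 x\<close> cancels the zero at \<open>r = 1\<close> and leaves the
function \<open>G\<close> of the proof. It is holomorphic on an annulus around the circle of radius \<open>1 / \<rho>\<^sup>2\<close>, since
there \<open>r\<close> has positive real part and differs from \<open>\<rho>\<close> (which would mean \<open>z = 1\<close>), and since the
boundary series is only evaluated inside its disc of convergence. The limit is \<open>G (1 / \<rho>\<^sup>2)\<close>, a
combination of the boundary probabilities with positive coefficients.\<close>

lemma boundary_phase_limit:
  fixes q :: "nat \<times> nat \<times> bool \<Rightarrow> real"
  assumes pos: "0 < lam" "0 < \<mu>" "0 < \<alpha>" and stable: "rho lam \<mu> \<alpha> < 1"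
    and q0: "\<And>p. 0 \<le> q p"
    and stat: "\<And>y. ((\<lambda>x. q x * generator (retrial_rate lam \<mu> \<alpha>) x y) has_sum 0) UNIV"
    and mom: "\<And>s. 1 < s \<Longrightarrow> s < 1 / rho lam \<mu> \<alpha> \<Longrightarrow>
      (\<lambda>(m, n, k). q (m, n, k) * s ^ (2 * m + n)) summable_on UNIV"
    and y1: "1 / rho lam \<mu> \<alpha> < y1" and mom0: "summable (\<lambda>n. q (0, n, False) * y1 ^ n)"
    and nz: "q (0, n0, False) \<noteq> 0"
  shows "\<exists>W>0. (\<lambda>m. ((1 / rho lam \<mu> \<alpha>)\<^sup>2) ^ m * q (m, 0, False)) \<longlonglongrightarrow> W"
proof -
  define \<rho> where "\<rho> = rho lam \<mu> \<alpha>"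
  define R where "R = (1 / \<rho>)\<^sup>2"
  have \<rho>: "0 < \<rho>" "\<rho> < 1" using pos stable by (auto simp: \<rho>_def rho_def)
  have R1: "1 < R" using \<rho> by (simp add: R_def power_divide power_less_one_iff)
  have y10: "0 < y1" using y1 \<rho> by (auto simp: \<rho>_def[symmetric] intro: less_trans[rotated])
  define a where "a m = (if m = 0 then 0 else q (m, 0, False))" for m
  define b where "b n = q (0, Suc n, False)" for n
  define q00 where "q00 = q (0, 0, False)"
  have ab0: "0 \<le> a m" "0 \<le> b n" "0 \<le> q00" for m n using q0 by (auto simp: a_def b_def q00_def)
  have sum_a: "summable (\<lambda>m. a m * x ^ m)" if x: "1 < x" "x < R" for x
  proof -
    have "sqrt x < 1 / \<rho>" using x \<rho> by (intro real_less_lsqrt) (auto simp: R_def)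
    then have "(\<lambda>(m, n, k). q (m, n, k) * sqrt x ^ (2 * m + n)) summable_on UNIV"
      by (intro mom) (use x in \<open>auto simp: \<rho>_def\<close>)
    then have "(\<lambda>(m, n, k). q (m, n, k) * sqrt x ^ (2 * m + n)) summable_on range (\<lambda>m. (m, 0, False))"
      by (rule summable_on_subset) auto
    then have "((\<lambda>(m, n, k). q (m, n, k) * sqrt x ^ (2 * m + n)) \<circ> (\<lambda>m. (m, 0, False))) summable_on UNIV"
      by (subst (asm) summable_on_reindex) (auto simp: inj_on_def)
    then have "summable ((\<lambda>(m, n, k). q (m, n, k) * sqrt x ^ (2 * m + n)) \<circ> (\<lambda>m. (m, 0, False)))"
      by (rule summable_on_imp_summable)
    then have "summable (\<lambda>m. q (m, 0, False) * x ^ m)" using x by (simp add: comp_def power_mult)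
    then show ?thesis
      by (rule summable_comparison_test'[where N = 0]) (use q0 x in \<open>auto simp: a_def\<close>)
  qed
  define A where "A z = (\<Sum>m. complex_of_real (a m) * z ^ m)" for z
  have A: "(\<lambda>m. complex_of_real (a m) * z ^ m) sums A z" if z: "norm z < R" for z
  proof -
    have "max 1 (norm z) < R" using z R1 by simp
    then obtain x where x: "max 1 (norm z) < x" "x < R" using dense by blast
    have "summable (\<lambda>m. a m * x ^ m)" using sum_a x by simp
    then have "summable (\<lambda>m. complex_of_real (a m) * z ^ m)"
    proof (rule summable_comparison_test'[where N = 0])
      fix m
      have "norm z ^ m \<le> x ^ m" using x by (intro power_mono) auto
      then show "norm (complex_of_real (a m) * z ^ m) \<le> a m * x ^ m"
        using ab0 by (simp add: norm_mult norm_power mult_left_mono)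
    qed
    then show ?thesis unfolding A_def by (rule summable_sums)
  qed
  have sum_b: "summable (\<lambda>n. b n * y1 ^ n)"
  proof -
    have "summable (\<lambda>n. q (0, Suc n, False) * y1 ^ Suc n)"
      using mom0 by (subst summable_Suc_iff[of "\<lambda>n. q (0, n, False) * y1 ^ n"])
    then have "summable (\<lambda>n. q (0, Suc n, False) * y1 ^ Suc n / y1)" by (rule summable_divide)
    then show ?thesis using y10 by (simp add: b_def)
  qed
  define B where "B w = (\<Sum>n. complex_of_real (b n) * w ^ n)" for w
  have B: "(\<lambda>n. complex_of_real (b n) * w ^ n) sums B w" if w: "norm w < y1" for w
  proof -
    have "summable (\<lambda>n. complex_of_real (b n) * w ^ n)"
    proof (rule summable_comparison_test'[OF sum_b, where N = 0])
      fix n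
      have "norm w ^ n \<le> y1 ^ n" using w by (intro power_mono) auto
      then show "norm (complex_of_real (b n) * w ^ n) \<le> b n * y1 ^ n"
        using ab0 by (simp add: norm_mult norm_power mult_left_mono)
    qed
    then show ?thesis unfolding B_def by (rule summable_sums)
  qed
  have sum_b_real: "summable (\<lambda>n. b n * w ^ n)" if w: "\<bar>w\<bar> < y1" for w :: real
  proof (rule summable_comparison_test'[OF sum_b, where N = 0])
    fix n
    have "\<bar>w\<bar> ^ n \<le> y1 ^ n" using w by (intro power_mono) auto
    then show "norm (b n * w ^ n) \<le> b n * y1 ^ n"
      using ab0 by (simp add: abs_mult power_abs mult_left_mono)
  qed
  have B_real: "B (of_real w) = of_real (\<Sum>n. b n * w ^ n)" if w: "\<bar>w\<bar> < y1" for w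
  proof (rule sums_unique2)
    show "(\<lambda>n. complex_of_real (b n) * of_real w ^ n) sums B (of_real w)" by (rule B) (use w in simp)
    show "(\<lambda>n. complex_of_real (b n) * of_real w ^ n) sums of_real (\<Sum>n. b n * w ^ n)"
      using sums_of_real[OF summable_sums[OF sum_b_real[OF w]], where 'a = complex] by simp
  qed
  have B_hol: "B holomorphic_on ball 0 y1"
    by (rule power_series_holomorphic[where a = "\<lambda>n. complex_of_real (b n)"]) (use B in auto)
  define r where "r z = csqrt (1 + of_real (\<rho>\<^sup>2) - 1 / z)" for z
  define t where "t z = 1 + of_real \<rho> - r z" for z
  define num where "num y w t x = (\<alpha> * w * (y * (1 + lam / \<mu> - t) - lam / \<mu> * x)
     + lam\<^sup>2 / \<mu> * (y - 1) * q00) / (2 * \<alpha>)" for y w t x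
  define G where "G z = (1 + r z) / ((r z - of_real \<rho>) * (r z + 1 + of_real \<rho>))
     * ((of_real \<alpha> * B (z * t z) * (z * t z * (1 + of_real (lam / \<mu>) - t z) - of_real (lam / \<mu>) * z)
     + of_real (lam\<^sup>2 / \<mu>) * (z * t z - 1) * of_real q00) / of_real (2 * \<alpha>))" for z
  \<comment> \<open>At the circle of radius R itself the bound for z * t z equals 1 / \<rho> < y1, so a thin annulus is safe.\<close>
  obtain e where e: "0 < e" "1 < R - e"
    "(2 * \<rho> * (R + e) + 1) / (1 + \<rho> + sqrt (1 + \<rho>\<^sup>2 - 1 / (R - e))) < y1"
  proof -
    have "1 / R = \<rho>\<^sup>2" using \<rho> by (simp add: R_def power_divide)
    have "((\<lambda>e. (2 * \<rho> * (R + e) + 1) / (1 + \<rho> + sqrt (1 + \<rho>\<^sup>2 - 1 / (R - e))))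
      \<longlongrightarrow> (2 * \<rho> * (R + 0) + 1) / (1 + \<rho> + sqrt (1 + \<rho>\<^sup>2 - 1 / (R - 0)))) (at_right 0)"
      using \<rho> R1 \<open>1 / R = \<rho>\<^sup>2\<close> by (intro tendsto_intros) auto
    also have "(2 * \<rho> * (R + 0) + 1) / (1 + \<rho> + sqrt (1 + \<rho>\<^sup>2 - 1 / (R - 0))) = 1 / \<rho>"
    proof -
      have "2 * \<rho> * R + 1 = (2 + \<rho>) / \<rho>" using \<rho> by (simp add: R_def power2_eq_square field_simps)
      then show ?thesis using \<rho> \<open>1 / R = \<rho>\<^sup>2\<close> by simp
    qed
    finally have "\<forall>\<^sub>F e in at_right 0. (2 * \<rho> * (R + e) + 1) / (1 + \<rho> + sqrt (1 + \<rho>\<^sup>2 - 1 / (R - e))) < y1"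
      by (rule order_tendstoD(2)) (use y1 in \<open>simp add: \<rho>_def\<close>)
    moreover have "\<forall>\<^sub>F e in at_right 0. e < R - 1"
      by (rule eventually_at_rightI[of 0 "R - 1"]) (use R1 in auto)
    ultimately have "\<forall>\<^sub>F e in at_right 0. 0 < e \<and> e < R - 1 \<and>
        (2 * \<rho> * (R + e) + 1) / (1 + \<rho> + sqrt (1 + \<rho>\<^sup>2 - 1 / (R - e))) < y1"
      using eventually_at_right_less[of "0::real"] by eventually_elim auto
    then obtain e where "0 < e \<and> e < R - 1 \<and>
        (2 * \<rho> * (R + e) + 1) / (1 + \<rho> + sqrt (1 + \<rho>\<^sup>2 - 1 / (R - e))) < y1"
      using eventually_happens'[OF trivial_limit_at_right_real] by blast
    then show thesis by (intro that[of e]) auto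
  qed
  define V where "V = {z::complex. R - e < norm z \<and> norm z < R + e}"
  have V1: "1 < norm z" if "z \<in> V" for z using that e by (auto simp: V_def)
  have V0: "z \<noteq> 0" if "z \<in> V" for z using V1[OF that] by auto
  have h0: "0 \<le> 1 + \<rho>\<^sup>2 - 1 / norm z" "0 < sqrt (1 + \<rho>\<^sup>2 - 1 / norm z)" if "z \<in> V" for z
  proof -
    have "1 / norm z < 1" using V1[OF that] by (rule inverse_norm_less_1)
    then have "0 < 1 + \<rho>\<^sup>2 - 1 / norm z" by (smt (verit) zero_le_power2)
    then show "0 \<le> 1 + \<rho>\<^sup>2 - 1 / norm z" "0 < sqrt (1 + \<rho>\<^sup>2 - 1 / norm z)" by auto
  qed
  have Re_r: "0 < Re (r z)" if "z \<in> V" for z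
    using norm_kernel_branch_le(2)[OF \<rho>(1) V1[OF that]] h0(2)[OF that] unfolding r_def by linarith
  have r2: "(r z)\<^sup>2 = 1 + of_real (\<rho>\<^sup>2) - 1 / z" for z by (simp add: r_def)
  have r_ne: "r z \<noteq> of_real \<rho>" "r z + 1 + of_real \<rho> \<noteq> 0" if "z \<in> V" for z
  proof -
    show "r z \<noteq> of_real \<rho>"
    proof
      assume "r z = of_real \<rho>"
      then have "1 / z = 1" using r2[of z] by simp
      then have "z = 1" using V0[OF that] by (simp add: field_simps)
      then show False using V1[OF that] by simp
    qed
    have "0 < Re (r z + 1 + of_real \<rho>)" using Re_r[OF that] \<rho> by simp
    then show "r z + 1 + of_real \<rho> \<noteq> 0" by (metis less_irrefl zero_complex.simps(1))
  qed
  have r_hol: "r holomorphic_on V" unfolding r_def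
  proof (intro holomorphic_intros)
    fix z assume z: "z \<in> V"
    show "z \<noteq> 0" using V0[OF z] .
    have "Re (1 / z) \<le> norm (1 / z)" by (rule complex_Re_le_cmod)
    also have "\<dots> < 1" using inverse_norm_less_1[OF V1[OF z]] by (simp add: norm_divide)
    finally have "Re (1 / z) < 1 + \<rho>\<^sup>2" using zero_le_power2[of \<rho>] by linarith
    then have "0 < Re (1 + of_real (\<rho>\<^sup>2) - 1 / z)" by simp
    then show "1 + of_real (\<rho>\<^sup>2) - 1 / z \<notin> \<real>\<^sub>\<le>\<^sub>0" by (auto simp: complex_nonpos_Reals_iff)
  qed
  have t_hol: "t holomorphic_on V" unfolding t_def by (intro holomorphic_intros r_hol)
  have y_small: "norm (z * t z) < y1" if z: "z \<in> V" for z
  proof -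
    have zR: "R - e < norm z" "norm z < R + e" using z by (auto simp: V_def)
    have "norm (z * t z) \<le> norm z * ((2 * \<rho> + 1 / norm z) / (1 + \<rho> + sqrt (1 + \<rho>\<^sup>2 - 1 / norm z)))"
      unfolding norm_mult using norm_kernel_branch_le(1)[OF \<rho>(1) V1[OF z]]
      by (intro mult_left_mono) (auto simp: t_def r_def)
    also have "\<dots> = (2 * \<rho> * norm z + 1) / (1 + \<rho> + sqrt (1 + \<rho>\<^sup>2 - 1 / norm z))"
      using V0[OF z] by (simp add: algebra_simps)
    also have "\<dots> \<le> (2 * \<rho> * (R + e) + 1) / (1 + \<rho> + sqrt (1 + \<rho>\<^sup>2 - 1 / (R - e)))"
    proof (rule frac_le)
      show "2 * \<rho> * norm z + 1 \<le> 2 * \<rho> * (R + e) + 1" using zR \<rho> by simp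
      have "1 / norm z \<le> 1 / (R - e)" using zR e(2) V1[OF z] by (intro divide_left_mono mult_pos_pos) linarith+
      then show "1 + \<rho> + sqrt (1 + \<rho>\<^sup>2 - 1 / (R - e)) \<le> 1 + \<rho> + sqrt (1 + \<rho>\<^sup>2 - 1 / norm z)" by simp
      have "1 / (R - e) < 1" using e by simp
      then have "0 \<le> 1 + \<rho>\<^sup>2 - 1 / (R - e)" by (smt (verit) zero_le_power2)
      then have "0 \<le> sqrt (1 + \<rho>\<^sup>2 - 1 / (R - e))" by simp
      then show "0 < 1 + \<rho> + sqrt (1 + \<rho>\<^sup>2 - 1 / (R - e))" using \<rho> by linarith
      show "0 \<le> 2 * \<rho> * (R + e) + 1" using \<rho> R1 e by simp
    qed
    finally show ?thesis using e(3) by linarith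
  qed
  have "(B \<circ> (\<lambda>z. z * t z)) holomorphic_on V"
    by (rule holomorphic_on_compose_gen[OF _ B_hol]) (use y_small in \<open>auto intro!: holomorphic_intros t_hol\<close>)
  then have Bt_hol: "(\<lambda>z. B (z * t z)) holomorphic_on V" by (simp add: comp_def)
  have G_hol: "G holomorphic_on V" unfolding G_def
    by (intro holomorphic_intros r_hol t_hol Bt_hol) (use r_ne pos in auto)
  have G_real: "G (of_real x) = of_real ((1 + r') / ((r' - \<rho>) * (r' + 1 + \<rho>)) * num (x * t') (suminf (\<lambda>n. b n * (x * t') ^ n)) t' x)"
    if x: "R - e < x" "x < R + e" and r': "r' = sqrt (1 + \<rho>\<^sup>2 - 1 / x)" and t': "t' = 1 + \<rho> - r'" for x r' t'
  proof -
    have xV: "of_real x \<in> V" using x e by (auto simp: V_def)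
    have "0 \<le> 1 + \<rho>\<^sup>2 - 1 / x" using h0(1)[OF xV] x e by simp
    moreover have "1 + of_real (\<rho>\<^sup>2) - 1 / complex_of_real x = of_real (1 + \<rho>\<^sup>2 - 1 / x)" by simp
    ultimately have rx: "r (of_real x) = of_real r'"
      unfolding r_def r' by (simp only: of_real_sqrt)
    then have tx: "t (of_real x) = of_real t'" by (simp add: t_def t')
    have "norm (complex_of_real (x * t')) < y1" using y_small[OF xV] by (simp only: tx of_real_mult)
    then have "\<bar>x * t'\<bar> < y1" by (simp only: norm_of_real)
    from B_real[OF this] have "B (of_real x * of_real t') = of_real (suminf (\<lambda>n. b n * (x * t') ^ n))"
      by (simp only: of_real_mult)
    then show ?thesis by (simp add: G_def rx tx num_def)
  qed
  have lim: "(\<lambda>m. complex_of_real (a m) * of_real R ^ m) \<longlonglongrightarrow> G (of_real R)"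
  proof (rule coefficient_limit_at_simple_pole[where A = A and ?R0.0 = "R - e" and R' = "R + e"])
    show "G holomorphic_on {z. R - e < norm z \<and> norm z < R + e}" using G_hol by (simp add: V_def)
    fix x assume x: "R - e < x" "x < R"
    define r' where "r' = sqrt (1 + \<rho>\<^sup>2 - 1 / x)"
    define t' where "t' = 1 + \<rho> - r'"
    have x1: "1 < x" using x e by simp
    have xR: "x < (1 / \<rho>)\<^sup>2" using x by (simp add: R_def)
    note kb = kernel_branch_real[OF \<rho> x1 xR, folded r'_def, folded t'_def]
    have t0: "0 < t'" using kb \<rho> by (simp add: t'_def)
    have yt: "x * t' < y1"
    proof -
      have "x * t' \<le> sqrt x" by (rule kb)
      also have "\<dots> < 1 / \<rho>" using x1 xR \<rho> by (intro real_less_lsqrt) auto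
      finally show ?thesis using y1 by (simp add: \<rho>_def)
    qed
    have sA: "summable (\<lambda>m. a m * x ^ m)" by (rule sum_a[OF x1 x(2)])
    define A' where "A' = (\<Sum>m. a m * x ^ m)"
    have A': "A (of_real x) = of_real A'"
    proof (rule sums_unique2)
      show "(\<lambda>m. complex_of_real (a m) * of_real x ^ m) sums A (of_real x)" by (rule A) (use x x1 in simp)
      show "(\<lambda>m. complex_of_real (a m) * of_real x ^ m) sums of_real A'"
        using sums_of_real[OF summable_sums[OF sA], where 'a = complex] by (simp add: A'_def)
    qed
    have "(\<lambda>m. a m * x ^ m) sums A'" unfolding A'_def by (rule summable_sums[OF sA])
    then have "(\<lambda>m. a (Suc m) * x ^ Suc m) sums A'"
      by (subst sums_Suc_iff) (simp add: a_def)
    then have A'_sums: "(\<lambda>m. q (Suc m, 0, False) * x ^ Suc m) sums A'" by (simp add: a_def)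
    define B' where "B' = (\<Sum>n. b n * (x * t') ^ n)"
    have "summable (\<lambda>n. b n * (x * t') ^ n)" by (rule sum_b_real) (use yt x1 t0 in simp)
    then have B'_sums: "(\<lambda>n. q (0, Suc n, False) * (x * t') ^ n) sums B'"
      unfolding B'_def b_def by (rule summable_sums)
    have key: "2 * \<alpha> * (t' - 1 + \<rho> * (x * t' - 1)) * A' =
      - (\<alpha> * B' * (x * t' * (1 + lam / \<mu> - t') - lam / \<mu> * x) + lam\<^sup>2 / \<mu> * (x * t' - 1) * q00)"
      unfolding q00_def \<rho>_def
    proof (rule boundary_identity[OF pos q0 _ _ t0 _ _ A'_sums B'_sums])
      show "t'\<^sup>2 - 2 * (1 + rho lam \<mu> \<alpha>) * t' + 2 * rho lam \<mu> \<alpha> + 1 / x = 0"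
        using kb by (simp add: \<rho>_def)
      show "((\<lambda>p. q p * retrial_drift lam \<mu> \<alpha> (geometric_weight x (x * t') u) p) has_sum 0) UNIV" if "0 < u" for u
      proof (rule retrial_geometric_pairing[OF pos q0 stat _ mom _ _ _ _ that, of "sqrt x"])
        show "sqrt x < 1 / rho lam \<mu> \<alpha>"
          using x1 xR \<rho> unfolding \<rho>_def[symmetric] by (intro real_less_lsqrt) auto
      qed (use x1 t0 kb in auto)
    qed (use x1 idle_balance[OF stat] in auto)
    have "(1 - x / R) * A' = (1 + r') / ((r' - \<rho>) * (r' + 1 + \<rho>)) * num (x * t') B' t' x"
    proof -
      have ne: "r' - \<rho> \<noteq> 0" "r' + 1 + \<rho> \<noteq> 0" using kb \<rho> by auto
      have "num (x * t') B' t' x = - (2 * \<alpha> * (t' - 1 + \<rho> * (x * t' - 1)) * A') / (2 * \<alpha>)"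
        unfolding key num_def by simp
      also have "\<dots> = - ((t' - 1 + \<rho> * (x * t' - 1)) * A')" using pos by simp
      also have "\<dots> = x * (1 - r') * A' * ((r' - \<rho>) * (r' + 1 + \<rho>))"
        unfolding kb(6) by (simp add: algebra_simps)
      finally show ?thesis using ne unfolding R_def kb(7) by simp
    qed
    then show "(1 - complex_of_real x / complex_of_real R) * A (complex_of_real x) = G (complex_of_real x)"
      using G_real[OF x(1) _ r'_def t'_def] x e unfolding A' B'_def[symmetric]
      by (metis (no_types, lifting) add_strict_increasing less_imp_le of_real_1 of_real_diff of_real_divide of_real_mult add.commute)
  qed (use A e in auto)
  define B1 where "B1 = (\<Sum>n. b n * (1 / \<rho>) ^ n)"
  define W where "W = 2 / ((1 - \<rho>) * (2 + \<rho>)) * num (1 / \<rho>) B1 \<rho> R"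
  have GR: "G (of_real R) = of_real W"
  proof -
    have "1 / R = \<rho>\<^sup>2" "R * \<rho> = 1 / \<rho>" using \<rho> by (simp_all add: R_def power_divide power2_eq_square)
    then show ?thesis using G_real[of R 1 \<rho>] e by (simp add: W_def B1_def add.commute)
  qed
  have "(\<lambda>m. complex_of_real (a m * R ^ m)) \<longlonglongrightarrow> of_real W" using lim by (simp add: GR)
  then have "(\<lambda>m. a m * R ^ m) \<longlonglongrightarrow> W" by (simp only: tendsto_of_real_iff)
  then have "(\<lambda>m. R ^ m * q (m, 0, False)) \<longlonglongrightarrow> W"
    by (rule Lim_transform_eventually) (auto simp: a_def mult.commute eventually_sequentially intro!: exI[of _ 1])
  moreover have "0 < W"
  proof -
    have sB: "summable (\<lambda>n. b n * (1 / \<rho>) ^ n)" by (rule sum_b_real) (use y1 \<rho> in \<open>simp add: \<rho>_def\<close>)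
    have "lam / \<mu> / \<rho> = (lam * (2 * \<alpha>)) / (lam * (lam + 2 * \<alpha>))"
      using pos by (simp add: \<rho>_def rho_def mult_ac)
    also have "\<dots> = 2 * \<alpha> / (lam + 2 * \<alpha>)" using pos by (subst mult_divide_mult_cancel_left) auto
    also have "\<dots> < 1" using pos by simp
    finally have l1: "lam / \<mu> / \<rho> < 1" .
    have "1 / \<rho> * (1 + lam / \<mu> - \<rho>) - lam / \<mu> * R = (1 - lam / \<mu> / \<rho>) * ((1 - \<rho>) / \<rho>)"
      using \<rho> pos by (simp add: R_def power_divide power2_eq_square field_simps)
    moreover have "0 < (1 - lam / \<mu> / \<rho>) * ((1 - \<rho>) / \<rho>)" using l1 \<rho> by (intro mult_pos_pos divide_pos_pos) auto
    ultimately have c1: "0 < 1 / \<rho> * (1 + lam / \<mu> - \<rho>) - lam / \<mu> * R" by simp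
    have c2: "0 < lam\<^sup>2 / \<mu> * (1 / \<rho> - 1)" using pos \<rho> by (intro mult_pos_pos divide_pos_pos) auto
    have B10: "0 \<le> B1" unfolding B1_def using ab0 \<rho> by (intro suminf_nonneg sB) auto
    have "0 < \<alpha> * B1 * (1 / \<rho> * (1 + lam / \<mu> - \<rho>) - lam / \<mu> * R) + lam\<^sup>2 / \<mu> * (1 / \<rho> - 1) * q00"
    proof (cases n0)
      case 0
      then have "0 < q00" using nz ab0(3) by (simp add: q00_def)
      then have "0 < lam\<^sup>2 / \<mu> * (1 / \<rho> - 1) * q00" by (rule mult_pos_pos[OF c2])
      moreover have "0 \<le> \<alpha> * B1 * (1 / \<rho> * (1 + lam / \<mu> - \<rho>) - lam / \<mu> * R)"
        using pos B10 less_imp_le[OF c1] by (intro mult_nonneg_nonneg) auto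
      ultimately show ?thesis by linarith
    next
      case (Suc n)
      then have "0 < b n" using nz ab0(2)[of n] by (simp add: b_def)
      then have "0 < B1" unfolding B1_def using ab0 \<rho> by (intro suminf_pos2[OF sB, of n]) auto
      then have "0 < \<alpha> * B1 * (1 / \<rho> * (1 + lam / \<mu> - \<rho>) - lam / \<mu> * R)"
        using pos by (intro mult_pos_pos c1) auto
      moreover have "0 \<le> lam\<^sup>2 / \<mu> * (1 / \<rho> - 1) * q00" by (rule mult_nonneg_nonneg[OF less_imp_le[OF c2] ab0(3)])
      ultimately show ?thesis by linarith
    qed
    then show ?thesis unfolding W_def num_def using \<rho> pos by (intro mult_pos_pos divide_pos_pos) auto
  qed
  ultimately show ?thesis unfolding R_def \<rho>_def by blast
qed

section \<open>Convergence in the remaining phases\<close>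

text \<open>Solved for \<open>c m\<close>, the recursion runs backwards with contraction factor \<open>1 / \<kappa>\<close>, so that the error at \<open>m\<close> is
controlled by later values. Nonnegativity supplies the boundedness without which a solution of the
homogeneous equation, growing like \<open>(- \<kappa>)\<^sup>m\<close>, could be added.\<close>

lemma backward_recursion_convergent:
  fixes c :: "nat \<Rightarrow> real"
  assumes c: "\<And>m. 0 \<le> c m" and \<kappa>: "1 < \<kappa>"
    and lim: "(\<lambda>m. c (Suc m) + \<kappa> * c m) \<longlonglongrightarrow> d"
  shows "c \<longlonglongrightarrow> d / (1 + \<kappa>)"
proof -
  define l where "l = d / (1 + \<kappa>)"
  define e where "e m = c m - l" for m
  define \<delta> where "\<delta> m = e (Suc m) + \<kappa> * e m" for m
  have "l * (1 + \<kappa>) = d" using \<kappa> by (simp add: l_def)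
  then have l: "l + \<kappa> * l = d" by (simp add: algebra_simps)
  have \<delta>: "\<delta> m = c (Suc m) + \<kappa> * c m - d" for m
    using l by (simp add: \<delta>_def e_def right_diff_distrib)
  have \<delta>_lim: "\<delta> \<longlonglongrightarrow> 0" unfolding \<delta>[abs_def] using tendsto_diff[OF lim tendsto_const[of d]] by simp
  obtain M where M: "\<And>m. \<bar>c (Suc m) + \<kappa> * c m\<bar> \<le> M"
    using convergent_imp_Bseq[OF convergentI[OF lim]] by (auto simp: Bseq_def)
  have cM: "c m \<le> M" for m
  proof -
    have "c m * 1 \<le> c m * \<kappa>" using c \<kappa> by (intro mult_left_mono) auto
    then show ?thesis using M[of m] c[of "Suc m"] by (simp add: mult.commute)
  qed
  define B where "B = M + \<bar>l\<bar>"
  have eB: "\<bar>e m\<bar> \<le> B" for m using c[of m] cM[of m] by (auto simp: e_def B_def)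
  have "e \<longlonglongrightarrow> 0"
  proof (rule LIMSEQ_I)
    fix r :: real assume r: "0 < r"
    define \<epsilon> where "\<epsilon> = r / 2 * (\<kappa> - 1)"
    have \<epsilon>: "0 < \<epsilon>" using r \<kappa> by (simp add: \<epsilon>_def)
    obtain N where N: "\<And>m. N \<le> m \<Longrightarrow> \<bar>\<delta> m\<bar> < \<epsilon>"
      using LIMSEQ_D[OF \<delta>_lim \<epsilon>] by auto
    have iter: "\<bar>e m\<bar> \<le> r / 2 + B / \<kappa> ^ j" if "N \<le> m" for m j using that
    proof (induction j arbitrary: m)
      case 0
      then show ?case using eB[of m] r by simp
    next
      case (Suc j)
      have "\<kappa> * e m = \<delta> m - e (Suc m)" by (simp add: \<delta>_def)
      then have "\<kappa> * \<bar>e m\<bar> = \<bar>\<delta> m - e (Suc m)\<bar>" using \<kappa> by (metis abs_mult abs_of_pos less_trans zero_less_one)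
      also have "\<dots> \<le> \<epsilon> + (r / 2 + B / \<kappa> ^ j)" using N[OF Suc.prems] Suc.IH[of "Suc m"] Suc.prems by simp
      also have "\<dots> = \<kappa> * (r / 2 + B / \<kappa> ^ Suc j)" using \<kappa> by (simp add: \<epsilon>_def field_simps)
      finally show ?case using \<kappa> by simp
    qed
    have "(\<lambda>j. r / 2 + B * (1 / \<kappa>) ^ j) \<longlonglongrightarrow> r / 2 + B * 0"
      using \<kappa> by (intro tendsto_intros LIMSEQ_realpow_zero) auto
    then have lim': "(\<lambda>j. r / 2 + B / \<kappa> ^ j) \<longlonglongrightarrow> r / 2" by (simp add: power_divide)
    have "\<bar>e m\<bar> \<le> r / 2" if "N \<le> m" for m
      by (rule LIMSEQ_le_const[OF lim']) (use iter[OF that] in auto)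
    then show "\<exists>no. \<forall>n\<ge>no. norm (e n - 0) < r" using r by (intro exI[of _ N]) force
  qed
  then have "(\<lambda>m. e m + l) \<longlonglongrightarrow> 0 + l" by (intro tendsto_intros)
  then show ?thesis by (simp add: e_def l_def)
qed

text \<open>The equations \<open>p K = 0\<close> for the idle entries of \<open>p\<close>, after the busy entries have been eliminated and the
rates expressed by \<open>\<rho>\<close>. The first two differ from the general pattern because the phase \<open>n = 0\<close> has rates
of its own.\<close>

definition phase_recursion :: "real \<Rightarrow> (nat \<Rightarrow> real) \<Rightarrow> bool" where
  "phase_recursion \<rho> f \<longleftrightarrow>
     (1 + 2 / \<rho>) * f 1 = 2 * (1 + \<rho>) * f 0 \<and>
     (1 + 2 / \<rho>) * f 2 = 2 * (1 + \<rho>) * f 1 - 2 * \<rho> * (1 + \<rho>) * f 0 \<and>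
     (\<forall>n. (1 + 2 / \<rho>) * f (n + 3) = 2 * (1 + \<rho>) * f (n + 2) - \<rho>\<^sup>2 * f (n + 1))"

lemma phase_recursion_eq_0:
  assumes \<rho>: "0 < \<rho>" and f: "phase_recursion \<rho> f" and zero: "f 0 = 0"
  shows "f n = 0"
proof (induction n rule: less_induct)
  case (less n)
  have "1 + 2 / \<rho> \<noteq> 0" using \<rho> by (simp add: add_pos_pos less_imp_neq[symmetric])
  moreover consider "n = 0" | "n = 1" | "n = 2" | k where "n = k + 3"
  proof -
    have "n = 0 \<or> n = 1 \<or> n = 2 \<or> n = (n - 3) + 3" by arith
    then show thesis using that by blast
  qed
  then have "(1 + 2 / \<rho>) * f n = 0"
  proof cases
    case 1
    then show ?thesis using zero by simp
  next
    case 2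
    have "(1 + 2 / \<rho>) * f 1 = 2 * (1 + \<rho>) * f 0" using f unfolding phase_recursion_def by blast
    then show ?thesis using zero unfolding 2 by simp
  next
    case 3
    have "(1 + 2 / \<rho>) * f 2 = 2 * (1 + \<rho>) * f 1 - 2 * \<rho> * (1 + \<rho>) * f 0"
      using f unfolding phase_recursion_def by blast
    then show ?thesis using zero less[of 1] unfolding 3 by simp
  next
    case (4 k)
    have "(1 + 2 / \<rho>) * f (k + 3) = 2 * (1 + \<rho>) * f (k + 2) - \<rho>\<^sup>2 * f (k + 1)"
      using f unfolding phase_recursion_def by blast
    then show ?thesis using less[of "k + 1"] less[of "k + 2"] unfolding 4 by simp
  qed
  ultimately show ?case by simp
qed

lemma phase_recursion_unique:
  assumes \<rho>: "0 < \<rho>" and f: "phase_recursion \<rho> f" and g: "phase_recursion \<rho> g"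
  shows "g 0 * f n = f 0 * g n"
proof -
  have comb: "\<kappa> * (g 0 * x - f 0 * y) = g 0 * (\<kappa> * x) - f 0 * (\<kappa> * y)" for \<kappa> x y
    by (simp add: algebra_simps)
  have "phase_recursion \<rho> (\<lambda>n. g 0 * f n - f 0 * g n)"
    unfolding phase_recursion_def
  proof (intro conjI allI)
    have "(1 + 2 / \<rho>) * f 1 = 2 * (1 + \<rho>) * f 0" "(1 + 2 / \<rho>) * g 1 = 2 * (1 + \<rho>) * g 0"
      using f g unfolding phase_recursion_def by blast+
    then show "(1 + 2 / \<rho>) * (g 0 * f 1 - f 0 * g 1) = 2 * (1 + \<rho>) * (g 0 * f 0 - f 0 * g 0)"
      unfolding comb by simp
    have "(1 + 2 / \<rho>) * f 2 = 2 * (1 + \<rho>) * f 1 - 2 * \<rho> * (1 + \<rho>) * f 0"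
      "(1 + 2 / \<rho>) * g 2 = 2 * (1 + \<rho>) * g 1 - 2 * \<rho> * (1 + \<rho>) * g 0"
      using f g unfolding phase_recursion_def by blast+
    then show "(1 + 2 / \<rho>) * (g 0 * f 2 - f 0 * g 2)
      = 2 * (1 + \<rho>) * (g 0 * f 1 - f 0 * g 1) - 2 * \<rho> * (1 + \<rho>) * (g 0 * f 0 - f 0 * g 0)"
      unfolding comb by (simp only: right_diff_distrib)
    fix n
    have "(1 + 2 / \<rho>) * f (n + 3) = 2 * (1 + \<rho>) * f (n + 2) - \<rho>\<^sup>2 * f (n + 1)"
      "(1 + 2 / \<rho>) * g (n + 3) = 2 * (1 + \<rho>) * g (n + 2) - \<rho>\<^sup>2 * g (n + 1)"
      using f g unfolding phase_recursion_def by blast+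
    then show "(1 + 2 / \<rho>) * (g 0 * f (n + 3) - f 0 * g (n + 3))
      = 2 * (1 + \<rho>) * (g 0 * f (n + 2) - f 0 * g (n + 2)) - \<rho>\<^sup>2 * (g 0 * f (n + 1) - f 0 * g (n + 1))"
      unfolding comb by (simp only: right_diff_distrib)
  qed
  from phase_recursion_eq_0[OF \<rho> this, of n] show ?thesis by simp
qed

text \<open>In the busy balance equation of \<open>(m, n)\<close> the only terms with phase \<open>n + 1\<close> are those of the levels \<open>m\<close> and
\<open>m - 1\<close>. After scaling by \<open>\<rho>\<^sup>-\<^sup>2\<^sup>m\<close> they form the backward recursion with factor \<open>2 / \<rho> > 1\<close>, so convergence
passes from the phases up to \<open>n\<close> to the phase \<open>n + 1\<close>.\<close>

lemma phase_limits:
  fixes q :: "nat \<times> nat \<times> bool \<Rightarrow> real"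
  assumes pos: "0 < lam" "0 < \<mu>" "0 < \<alpha>" and stable: "rho lam \<mu> \<alpha> < 1"
    and q0: "\<And>p. 0 \<le> q p"
    and stat: "\<And>y. ((\<lambda>x. q x * generator (retrial_rate lam \<mu> \<alpha>) x y) has_sum 0) UNIV"
    and lim0: "(\<lambda>m. ((1 / rho lam \<mu> \<alpha>)\<^sup>2) ^ m * q (m, 0, False)) \<longlonglongrightarrow> W"
  shows "\<exists>L. L 0 = W \<and> phase_recursion (rho lam \<mu> \<alpha>) L \<and>
    (\<forall>n. (\<lambda>m. ((1 / rho lam \<mu> \<alpha>)\<^sup>2) ^ m * q (m, n, False)) \<longlonglongrightarrow> L n)"
proof -
  define \<rho> where "\<rho> = rho lam \<mu> \<alpha>"
  define R where "R = (1 / \<rho>)\<^sup>2"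
  have \<rho>: "0 < \<rho>" "\<rho> < 1" using pos stable by (auto simp: \<rho>_def rho_def)
  have R: "0 < R" "R * \<rho>\<^sup>2 = 1" using \<rho> by (auto simp: R_def power_divide)
  define \<theta> where "\<theta> = (lam + 2 * \<alpha>) / \<mu>"
  have \<theta>: "lam * \<theta> = 2 * \<rho> * \<alpha>" "(lam + \<mu>) * \<theta> - lam = 2 * (1 + \<rho>) * \<alpha>"
    using pos by (simp_all add: \<theta>_def \<rho>_def rho_def field_simps)
  define a where "a n m = q (m, n, False)" for n m
  have busy: "q (Suc m, n, True) = \<theta> * a n (Suc m)" for m n
    using idle_balance[OF stat, of "Suc m" n] pos by (simp add: \<theta>_def a_def field_simps split: if_splits)
  have bal: "\<alpha> * (2 * (1 + \<rho>) * a n (Suc (Suc m))) = (lam + \<mu>) * q (Suc (Suc m), n, True) - lam * a n (Suc (Suc m))" for n m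
  proof -
    have "(lam + \<mu>) * q (Suc (Suc m), n, True) - lam * a n (Suc (Suc m)) = ((lam + \<mu>) * \<theta> - lam) * a n (Suc (Suc m))"
      by (simp add: busy algebra_simps)
    then show ?thesis unfolding \<theta> by (simp add: mult_ac)
  qed
  have lb: "lam * q (Suc m, n, True) = \<alpha> * (2 * \<rho> * a n (Suc m))" for n m
  proof -
    have "lam * q (Suc m, n, True) = (lam * \<theta>) * a n (Suc m)" by (simp add: busy)
    then show ?thesis unfolding \<theta> by simp
  qed
  have cancel: "x = y" if "\<alpha> * x = \<alpha> * y" for x y using that pos by simp
  have rec0: "a 1 (Suc (Suc m)) + 2 * \<rho> * a 1 (Suc m) = 2 * (1 + \<rho>) * a 0 (Suc (Suc m))" for m
  proof (rule cancel)
    show "\<alpha> * (a 1 (Suc (Suc m)) + 2 * \<rho> * a 1 (Suc m)) = \<alpha> * (2 * (1 + \<rho>) * a 0 (Suc (Suc m)))"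
      unfolding bal unfolding distrib_left lb[symmetric] busy_balance_0[OF stat] by (simp add: a_def)
  qed
  have rec1: "a 2 (Suc (Suc m)) + 2 * \<rho> * a 2 (Suc m)
      = 2 * (1 + \<rho>) * a 1 (Suc (Suc m)) - (2 * a 0 (Suc (Suc (Suc m))) + 2 * \<rho> * a 0 (Suc (Suc m)))" for m
  proof (rule cancel)
    show "\<alpha> * (a 2 (Suc (Suc m)) + 2 * \<rho> * a 2 (Suc m))
      = \<alpha> * (2 * (1 + \<rho>) * a 1 (Suc (Suc m)) - (2 * a 0 (Suc (Suc (Suc m))) + 2 * \<rho> * a 0 (Suc (Suc m))))"
      unfolding right_diff_distrib unfolding bal unfolding distrib_left lb[symmetric] busy_balance_1[OF stat] by (simp add: a_def)
  qed
  have rec2: "a (n + 3) (Suc (Suc m)) + 2 * \<rho> * a (n + 3) (Suc m)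
      = 2 * (1 + \<rho>) * a (n + 2) (Suc (Suc m)) - a (n + 1) (Suc (Suc (Suc m)))" for n m
  proof (rule cancel)
    have n: "n + 3 = Suc (Suc (Suc n))" "n + 2 = Suc (Suc n)" "n + 1 = Suc n" by simp_all
    show "\<alpha> * (a (n + 3) (Suc (Suc m)) + 2 * \<rho> * a (n + 3) (Suc m))
      = \<alpha> * (2 * (1 + \<rho>) * a (n + 2) (Suc (Suc m)) - a (n + 1) (Suc (Suc (Suc m))))"
      unfolding n right_diff_distrib unfolding bal unfolding distrib_left lb[symmetric] busy_balance_ge_2[OF stat] by (simp add: a_def)
  qed
  \<comment> \<open>Level 0 is skipped: there the busy probabilities are not \<theta> times the idle ones.\<close>
  define c where "c n m = R ^ Suc m * a n (Suc m)" for n m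
  have c0: "0 \<le> c n m" for n m using R q0 by (simp add: c_def a_def)
  have \<kappa>: "1 < 2 / \<rho>" using \<rho> by simp
  have R_kappa: "R * (2 * \<rho>) = 2 / \<rho>" using \<rho> by (simp add: R_def power2_eq_square)
  have shift: "R ^ Suc (Suc m) * x = \<rho>\<^sup>2 * (R ^ Suc (Suc (Suc m)) * x)" for m x
  proof -
    have "\<rho>\<^sup>2 * (R ^ Suc (Suc (Suc m)) * x) = (R * \<rho>\<^sup>2) * (R ^ Suc (Suc m) * x)" by (simp add: mult_ac)
    then show ?thesis by (simp only: R mult_1)
  qed
  have lhs: "c n (Suc m) + 2 / \<rho> * c n m = R ^ Suc (Suc m) * (a n (Suc (Suc m)) + 2 * \<rho> * a n (Suc m))" for n m
    unfolding c_def R_kappa[symmetric] by (simp add: algebra_simps)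
  have crec0: "c 1 (Suc m) + 2 / \<rho> * c 1 m = 2 * (1 + \<rho>) * c 0 (Suc m)" for m
    unfolding lhs unfolding rec0 c_def by (simp only: mult_ac)
  have crec1: "c 2 (Suc m) + 2 / \<rho> * c 2 m
      = 2 * (1 + \<rho>) * c 1 (Suc m) - (2 * \<rho>\<^sup>2 * c 0 (Suc (Suc m)) + 2 * \<rho> * c 0 (Suc m))" for m
    unfolding lhs unfolding rec1 c_def right_diff_distrib distrib_left
    using shift[of m "a 0 (Suc (Suc (Suc m)))"] by (simp only: mult_ac)
  have crec2: "c (n + 3) (Suc m) + 2 / \<rho> * c (n + 3) m
      = 2 * (1 + \<rho>) * c (n + 2) (Suc m) - \<rho>\<^sup>2 * c (n + 1) (Suc (Suc m))" for n m
    unfolding lhs unfolding rec2 c_def right_diff_distrib shift[of m "a (n + 1) (Suc (Suc (Suc m)))"]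
    by (simp only: mult_ac)
  have step: "c n \<longlonglongrightarrow> d / (1 + 2 / \<rho>)"
    if "(\<lambda>m. c n (Suc m) + 2 / \<rho> * c n m) \<longlonglongrightarrow> d" for n d
    using backward_recursion_convergent[OF c0[of n] \<kappa> that] .
  have W: "c 0 \<longlonglongrightarrow> W" unfolding c_def a_def using LIMSEQ_Suc[OF lim0] by (simp add: R_def \<rho>_def)
  have conv: "convergent (c n)" for n
  proof (induction n rule: less_induct)
    case (less n)
    consider "n = 0" | "n = 1" | "n = 2" | k where "n = k + 3"
    proof -
      have "n = 0 \<or> n = 1 \<or> n = 2 \<or> n = (n - 3) + 3" by arith
      then show thesis using that by blast
    qed
    then show ?case
    proof cases
      case 1
      then show ?thesis using W by (auto simp: convergent_def)
    next
      case 2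
      have "(\<lambda>m. c 1 (Suc m) + 2 / \<rho> * c 1 m) \<longlonglongrightarrow> 2 * (1 + \<rho>) * W"
        unfolding crec0 by (intro tendsto_intros LIMSEQ_Suc W)
      from step[OF this] show ?thesis using 2 by (auto simp: convergent_def)
    next
      case 3
      obtain L1 where L1: "c 1 \<longlonglongrightarrow> L1" using less[of 1] 3 by (auto simp: convergent_def)
      have "(\<lambda>m. c 2 (Suc m) + 2 / \<rho> * c 2 m) \<longlonglongrightarrow> 2 * (1 + \<rho>) * L1 - (2 * \<rho>\<^sup>2 * W + 2 * \<rho> * W)"
        unfolding crec1 by (intro tendsto_intros LIMSEQ_Suc W L1)
      from step[OF this] show ?thesis using 3 by (auto simp: convergent_def)
    next
      case (4 k)
      obtain L1 where L1: "c (k + 2) \<longlonglongrightarrow> L1" using less[of "k + 2"] 4 by (auto simp: convergent_def)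
      obtain L0 where L0: "c (k + 1) \<longlonglongrightarrow> L0" using less[of "k + 1"] 4 by (auto simp: convergent_def)
      have "(\<lambda>m. c (k + 3) (Suc m) + 2 / \<rho> * c (k + 3) m) \<longlonglongrightarrow> 2 * (1 + \<rho>) * L1 - \<rho>\<^sup>2 * L0"
        unfolding crec2 by (intro tendsto_intros LIMSEQ_Suc L0 L1)
      from step[OF this] show ?thesis using 4 by (auto simp: convergent_def)
    qed
  qed
  define L where "L n = lim (c n)" for n
  have L: "c n \<longlonglongrightarrow> L n" for n using conv[of n] by (simp add: L_def convergent_LIMSEQ_iff)
  have llim: "(\<lambda>m. c n (Suc m) + 2 / \<rho> * c n m) \<longlonglongrightarrow> L n + 2 / \<rho> * L n" for n
    by (intro tendsto_intros LIMSEQ_Suc L)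
  have L0: "L 0 = W" using L[of 0] W by (rule LIMSEQ_unique)
  have "(1 + 2 / \<rho>) * L 1 = 2 * (1 + \<rho>) * L 0"
  proof -
    have "(\<lambda>m. c 1 (Suc m) + 2 / \<rho> * c 1 m) \<longlonglongrightarrow> 2 * (1 + \<rho>) * L 0"
      unfolding crec0 by (intro tendsto_intros LIMSEQ_Suc L)
    from LIMSEQ_unique[OF llim this] show ?thesis by (simp only: distrib_right mult_1)
  qed
  moreover have "(1 + 2 / \<rho>) * L 2 = 2 * (1 + \<rho>) * L 1 - 2 * \<rho> * (1 + \<rho>) * L 0"
  proof -
    have "(\<lambda>m. c 2 (Suc m) + 2 / \<rho> * c 2 m) \<longlonglongrightarrow> 2 * (1 + \<rho>) * L 1 - (2 * \<rho>\<^sup>2 * L 0 + 2 * \<rho> * L 0)"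
      unfolding crec1 by (intro tendsto_intros LIMSEQ_Suc L)
    from LIMSEQ_unique[OF llim this] have "(1 + 2 / \<rho>) * L 2 = 2 * (1 + \<rho>) * L 1 - (2 * \<rho>\<^sup>2 * L 0 + 2 * \<rho> * L 0)"
      by (simp only: distrib_right mult_1)
    then show ?thesis by (simp add: power2_eq_square algebra_simps)
  qed
  moreover have "(1 + 2 / \<rho>) * L (n + 3) = 2 * (1 + \<rho>) * L (n + 2) - \<rho>\<^sup>2 * L (n + 1)" for n
  proof -
    have "(\<lambda>m. c (n + 3) (Suc m) + 2 / \<rho> * c (n + 3) m) \<longlonglongrightarrow> 2 * (1 + \<rho>) * L (n + 2) - \<rho>\<^sup>2 * L (n + 1)"
      unfolding crec2 by (intro tendsto_intros LIMSEQ_Suc L)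
    from LIMSEQ_unique[OF llim this] show ?thesis by (simp only: distrib_right mult_1)
  qed
  ultimately have "phase_recursion \<rho> L" by (simp only: phase_recursion_def) blast
  moreover have "(\<lambda>m. R ^ m * q (m, n, False)) \<longlonglongrightarrow> L n" for n
    using L[of n] unfolding c_def a_def by (rule LIMSEQ_imp_Suc)
  ultimately show ?thesis using L0 unfolding R_def \<rho>_def by blast
qed

section \<open>Equilibrium of the process and geometric decay\<close>

lemma p_vec_invariant:
  assumes pos: "0 < lam" "0 < \<mu>" "0 < \<alpha>" and xi: "stationary_distribution (KD lam \<mu> \<alpha>) \<xi>"
    and A: "finite A" "\<And>x. x \<notin> A \<Longrightarrow> K lam \<mu> \<alpha> x y = 0"
  shows "(\<Sum>x\<in>A. p_vec lam \<mu> \<alpha> \<xi> x * K lam \<mu> \<alpha> x y) = 0"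
proof -
  have "0 < rho lam \<mu> \<alpha>" "0 < v lam \<mu> \<alpha> k" for k using pos by (auto simp: rho_def v_def)
  then have D0: "D lam \<mu> \<alpha> y \<noteq> 0" by (cases y) (simp add: D_def power_int_eq_0_iff less_imp_neq[symmetric])
  have "((\<lambda>x. \<xi> x * KD lam \<mu> \<alpha> x y) has_sum (\<Sum>x\<in>A. \<xi> x * KD lam \<mu> \<alpha> x y)) UNIV"
    by (rule has_sum_finite_neutralI[OF A(1)]) (use A(2) in \<open>auto simp: KD_def\<close>)
  moreover have "((\<lambda>x. \<xi> x * KD lam \<mu> \<alpha> x y) has_sum 0) UNIV"
    using xi unfolding stationary_distribution_def by blast
  ultimately have "(\<Sum>x\<in>A. \<xi> x * KD lam \<mu> \<alpha> x y) = 0" by (rule has_sum_unique)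
  also have "(\<Sum>x\<in>A. \<xi> x * KD lam \<mu> \<alpha> x y) = (\<Sum>x\<in>A. p_vec lam \<mu> \<alpha> \<xi> x * K lam \<mu> \<alpha> x y) * D lam \<mu> \<alpha> y"
    unfolding sum_distrib_right by (rule sum.cong) (simp_all add: KD_def p_vec_def mult_ac)
  finally show ?thesis using D0 by simp
qed

text \<open>The columns of \<open>p K = 0\<close> for the idle and for the busy states give the first two facts. Positivity of the first entry: if it vanished, the recursion would force \<open>p\<close> and with it the probability
distribution \<open>\<xi>\<close> to vanish.\<close>

lemma p_vec_recursion:
  assumes pos: "0 < lam" "0 < \<mu>" "0 < \<alpha>" and xi: "stationary_distribution (KD lam \<mu> \<alpha>) \<xi>"
  shows "p_vec lam \<mu> \<alpha> \<xi> (n, True) = (lam + 2 * \<alpha>) / \<mu> * p_vec lam \<mu> \<alpha> \<xi> (n, False)"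
    and "phase_recursion (rho lam \<mu> \<alpha>) (\<lambda>n. p_vec lam \<mu> \<alpha> \<xi> (n, False))"
    and "0 < p_vec lam \<mu> \<alpha> \<xi> (0, False)"
proof -
  let ?p = "p_vec lam \<mu> \<alpha> \<xi>"
  define \<rho> where "\<rho> = rho lam \<mu> \<alpha>"
  have \<rho>: "0 < \<rho>" using pos by (simp add: \<rho>_def rho_def)
  define R where "R = \<rho> powi (-2)"
  have R: "R * \<rho>\<^sup>2 = 1" using \<rho> by (simp add: R_def power_int_minus)
  define \<theta> where "\<theta> = (lam + 2 * \<alpha>) / \<mu>"
  have \<theta>: "lam * \<theta> = 2 * \<rho> * \<alpha>" "(lam + \<mu>) * \<theta> - lam = 2 * (1 + \<rho>) * \<alpha>"
    using pos by (simp_all add: \<theta>_def \<rho>_def rho_def field_simps)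
  note K_simps = K_def K0_def K1_def K1bar_def Km1_def mat2_def
  have busy: "?p (n, True) = \<theta> * ?p (n, False)" for n
  proof -
    have "(\<Sum>x\<in>{(n, False), (n, True)}. ?p x * K lam \<mu> \<alpha> x (n, False)) = 0"
      by (rule p_vec_invariant[OF pos xi]) (auto simp: K_simps split: if_splits)
    then have "\<mu> * ?p (n, True) = (lam + 2 * \<alpha>) * ?p (n, False)" by (simp add: K_simps algebra_simps)
    then show ?thesis using pos by (simp add: \<theta>_def field_simps)
  qed
  then show "?p (n, True) = (lam + 2 * \<alpha>) / \<mu> * ?p (n, False)" by (simp add: \<theta>_def)
  have out: "(lam + \<mu>) * ?p (n, True) - lam * ?p (n, False) = \<alpha> * (2 * (1 + \<rho>) * ?p (n, False))" for n
  proof -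
    have "(lam + \<mu>) * ?p (n, True) - lam * ?p (n, False) = ((lam + \<mu>) * \<theta> - lam) * ?p (n, False)"
      unfolding busy by (simp add: algebra_simps)
    then show ?thesis unfolding \<theta> by (simp add: mult_ac)
  qed
  have inn: "\<alpha> * ?p (n, False) + R * lam * ?p (n, True) = \<alpha> * ((1 + 2 / \<rho>) * ?p (n, False))" for n
  proof -
    have "R * (2 * \<rho>) = 2 / \<rho>" using R \<rho> by (simp add: power2_eq_square field_simps)
    moreover have "R * lam * ?p (n, True) = \<alpha> * (R * (2 * \<rho>)) * ?p (n, False)"
    proof -
      have "R * lam * ?p (n, True) = R * (lam * \<theta>) * ?p (n, False)" unfolding busy by (simp only: mult_ac)
      then show ?thesis unfolding \<theta> by (simp only: mult_ac)
    qed
    ultimately show ?thesis by (simp add: algebra_simps)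
  qed
  have cancel: "x = y" if "\<alpha> * x = \<alpha> * y" for x y using that pos by simp
  have e0: "(1 + 2 / \<rho>) * ?p (1, False) = 2 * (1 + \<rho>) * ?p (0, False)"
  proof (rule cancel)
    have "(\<Sum>x\<in>{(0, False), (0, True), (1, False), (1, True)}. ?p x * K lam \<mu> \<alpha> x (0, True)) = 0"
      by (rule p_vec_invariant[OF pos xi]) (auto simp: K_simps split: if_splits)
    then show "\<alpha> * ((1 + 2 / \<rho>) * ?p (1, False)) = \<alpha> * (2 * (1 + \<rho>) * ?p (0, False))"
      unfolding out[symmetric] inn[symmetric] by (simp add: K_simps R_def \<rho>_def algebra_simps)
  qed
  have e1: "(1 + 2 / \<rho>) * ?p (2, False) = 2 * (1 + \<rho>) * ?p (1, False) - 2 * \<rho> * (1 + \<rho>) * ?p (0, False)"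
  proof (rule cancel)
    have "(\<Sum>x\<in>{(0, False), (0, True), (1, False), (1, True), (2, False), (2, True)}. ?p x * K lam \<mu> \<alpha> x (1, True)) = 0"
      by (rule p_vec_invariant[OF pos xi]) (auto simp: K_simps split: if_splits)
    then have "\<alpha> * ?p (2, False) + R * lam * ?p (2, True)
        = (lam + \<mu>) * ?p (1, True) - lam * ?p (1, False) - (2 * \<rho>\<^sup>2 * \<alpha> * ?p (0, False) + lam * ?p (0, True))"
      by (simp add: K_simps R_def \<rho>_def algebra_simps)
    also have "lam * ?p (0, True) = (lam * \<theta>) * ?p (0, False)" by (simp add: busy)
    finally show "\<alpha> * ((1 + 2 / \<rho>) * ?p (2, False))
      = \<alpha> * (2 * (1 + \<rho>) * ?p (1, False) - 2 * \<rho> * (1 + \<rho>) * ?p (0, False))"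
      unfolding out inn \<theta> by (simp add: right_diff_distrib distrib_left distrib_right power2_eq_square mult_ac)
  qed
  have e2: "(1 + 2 / \<rho>) * ?p (n + 3, False) = 2 * (1 + \<rho>) * ?p (n + 2, False) - \<rho>\<^sup>2 * ?p (n + 1, False)" for n
  proof (rule cancel)
    have "(\<Sum>x\<in>{(n + 1, False), (n + 1, True), (n + 2, False), (n + 2, True), (n + 3, False), (n + 3, True)}.
        ?p x * K lam \<mu> \<alpha> x (n + 2, True)) = 0"
      by (rule p_vec_invariant[OF pos xi]) (auto simp: K_simps split: if_splits)
    then have "\<alpha> * ?p (n + 3, False) + R * lam * ?p (n + 3, True)
        = (lam + \<mu>) * ?p (n + 2, True) - lam * ?p (n + 2, False) - \<alpha> * (\<rho>\<^sup>2 * ?p (n + 1, False))"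
      by (simp add: K_simps R_def \<rho>_def algebra_simps)
    then show "\<alpha> * ((1 + 2 / \<rho>) * ?p (n + 3, False))
      = \<alpha> * (2 * (1 + \<rho>) * ?p (n + 2, False) - \<rho>\<^sup>2 * ?p (n + 1, False))"
      unfolding out inn by (simp only: right_diff_distrib)
  qed
  show rec: "phase_recursion (rho lam \<mu> \<alpha>) (\<lambda>n. ?p (n, False))"
    using e0 e1 e2 unfolding phase_recursion_def \<rho>_def by blast
  have D0: "0 < D lam \<mu> \<alpha> x" for x
    using pos by (cases x) (auto simp: D_def rho_def v_def)
  have p0: "0 \<le> ?p x" for x
  proof -
    have "0 \<le> \<xi> x" using xi unfolding stationary_distribution_def by blast
    then show ?thesis using D0[of x] by (simp add: p_vec_def)
  qed
  have "?p (0, False) \<noteq> 0"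
  proof
    assume z: "?p (0, False) = 0"
    have nonz: "?p (n, False) = 0" for n
      using phase_recursion_eq_0[OF _ rec z] \<rho> by (simp add: \<rho>_def)
    have "\<xi> x = 0" for x
    proof (cases x)
      case (Pair n k)
      then have "?p x = 0" using nonz busy by (cases k) auto
      then show ?thesis using D0[of x] by (simp add: p_vec_def)
    qed
    then have "(\<xi> has_sum 0) UNIV" by (intro has_sum_0) auto
    moreover have "(\<xi> has_sum 1) UNIV" using xi by (simp add: stationary_distribution_def)
    ultimately show False using has_sum_unique by fastforce
  qed
  then show "0 < ?p (0, False)" using p0[of "(0, False)"] by simp
qed

text \<open>All that is needed of the process. The limits form a subprobability with \<open>q Q \<le> 0\<close>; that they do not all
vanish on the level \<open>m = 0\<close> follows from recurrence, started at a state \<open>x\<^sub>0\<close> of positive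
initial probability.\<close>

lemma equilibrium_of_markov_chain:
  fixes lam \<mu> \<alpha> :: real and q :: "nat \<times> nat \<times> bool \<Rightarrow> real"
  assumes pos: "0 < lam" "0 < \<mu>" "0 < \<alpha>" and stable: "rho lam \<mu> \<alpha> < 1"
    and M: "markov_chain M (generator (retrial_rate lam \<mu> \<alpha>)) X"
    and lim: "\<And>x. ((\<lambda>t. measure M {\<omega> \<in> space M. X t \<omega> = x}) \<longlongrightarrow> q x) at_top"
  shows "0 \<le> q x" and "finite F \<Longrightarrow> sum q F \<le> 1"
    and "finite F \<Longrightarrow> y \<in> F \<Longrightarrow> (\<Sum>z\<in>F. q z * generator (retrial_rate lam \<mu> \<alpha>) z y) \<le> 0"
    and "\<exists>n k. q (0, n, k) \<noteq> 0"
proof -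
  let ?Q = "generator (retrial_rate lam \<mu> \<alpha>)"
  interpret prob_space M using M by (simp add: markov_chain_def)
  define p where "p t x = measure M {\<omega> \<in> space M. X t \<omega> = x}" for t x
  have p0: "0 \<le> p t x" for t x by (simp add: p_def)
  note ev = markov_chain_event[OF M]
  have p1: "sum (p t) F \<le> 1" if "0 \<le> t" "finite F" for t F
  proof -
    have "sum (p t) F = measure M (\<Union>x\<in>F. {\<omega> \<in> space M. X t \<omega> = x})" unfolding p_def
      by (rule finite_measure_finite_Union[symmetric]) (use that ev in \<open>auto simp: disjoint_family_on_def\<close>)
    then show ?thesis by simp
  qed
  obtain P where P: "transition_function ?Q P" and
    step: "\<And>s t F y. 0 \<le> s \<Longrightarrow> 0 \<le> t \<Longrightarrow> finite F \<Longrightarrow> (\<Sum>z\<in>F. p t z * P s z y) \<le> p (t + s) y"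
    using markov_chain_marginal_step[OF M] unfolding p_def by blast
  have lim': "((\<lambda>t. p t x) \<longlongrightarrow> q x) at_top" for x unfolding p_def by (rule lim)
  show q0: "0 \<le> q x" for x
    by (rule tendsto_lowerbound[OF lim'[of x]]) (auto simp: p0)
  show "sum q F \<le> 1" if "finite F" for F
  proof (rule tendsto_upperbound)
    show "((\<lambda>t. sum (p t) F) \<longlongrightarrow> sum q F) at_top" by (intro tendsto_sum lim')
    show "\<forall>\<^sub>F t in at_top. sum (p t) F \<le> 1"
      using eventually_ge_at_top[of "0::real"] by eventually_elim (use p1 that in auto)
  qed simp
  have sub: "(\<Sum>z\<in>F. q z * P s z y) \<le> q y" if "0 \<le> s" "finite F" for s F y
  proof (rule tendsto_le[OF _ _ _])
    show "((\<lambda>t. p (t + s) y) \<longlongrightarrow> q y) at_top"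
      by (rule filterlim_compose[OF lim'[of y]])
         (intro filterlim_at_top_mono[OF filterlim_ident] always_eventually allI, use that in simp)
    show "((\<lambda>t. \<Sum>z\<in>F. p t z * P s z y) \<longlongrightarrow> (\<Sum>z\<in>F. q z * P s z y)) at_top"
      by (intro tendsto_intros lim')
    show "\<forall>\<^sub>F t in at_top. (\<Sum>z\<in>F. p t z * P s z y) \<le> p (t + s) y"
      using eventually_ge_at_top[of "0::real"] by eventually_elim (use step that in auto)
  qed simp
  show "(\<Sum>z\<in>F. q z * ?Q z y) \<le> 0" if "finite F" "y \<in> F" for F y
    using substationary_generator[OF P sub[OF _ that(1)] that] .
  obtain x0 where x0: "0 < p 0 x0"
  proof (rule ccontr)
    assume "\<not> thesis"
    then have "p 0 x = 0" for x using that p0[of 0 x] by (metis less_le)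
    then have "emeasure M {\<omega> \<in> space M. X 0 \<omega> = x} = 0" for x
      by (simp add: p_def emeasure_eq_measure)
    then have "(\<Union>x. {\<omega> \<in> space M. X 0 \<omega> = x}) \<in> null_sets M"
      by (intro null_sets_UN' null_setsI ev) auto
    moreover have "(\<Union>x. {\<omega> \<in> space M. X 0 \<omega> = x}) = space M" by auto
    ultimately have "emeasure M (space M) = 0" by auto
    then show False by (simp add: emeasure_space_1)
  qed
  show "\<exists>n k. q (0, n, k) \<noteq> 0"
  proof (rule ccontr)
    assume "\<not> (\<exists>n k. q (0, n, k) \<noteq> 0)"
    then have qz: "q (0, n, k) = 0" for n k by blast
    have "((\<lambda>t. P t x0 (0, n, k)) \<longlongrightarrow> 0) at_top" for n k
    proof (rule tendsto_sandwich[where f = "\<lambda>_. 0" and h = "\<lambda>t. p t (0, n, k) / p 0 x0"])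
      show "((\<lambda>t. p t (0, n, k) / p 0 x0) \<longlongrightarrow> 0) at_top"
        using tendsto_divide[OF lim'[of "(0, n, k)"] tendsto_const[of "p 0 x0"]] x0 by (simp add: qz)
      show "\<forall>\<^sub>F t in at_top. 0 \<le> P t x0 (0, n, k)"
        using eventually_ge_at_top[of "0::real"]
        by eventually_elim (use P in \<open>unfold transition_function_def, blast\<close>)
      show "\<forall>\<^sub>F t in at_top. P t x0 (0, n, k) \<le> p t (0, n, k) / p 0 x0"
        using eventually_ge_at_top[of "0::real"]
      proof eventually_elim
        case (elim t)
        then show ?case using step[of t 0 "{x0}" "(0, n, k)"] x0 by (simp add: pos_le_divide_eq mult.commute)
      qed
    qed simp
    then show False using retrial_recurrence[OF pos stable P, of x0] by blast
  qed
qed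

theorem theorem1:
  fixes lam \<mu> \<alpha> :: real
    and M :: "'w measure"
    and X :: "real \<Rightarrow> 'w \<Rightarrow> nat \<times> nat \<times> bool"
    and q :: "nat \<Rightarrow> nat \<Rightarrow> bool \<Rightarrow> real"
    and \<xi> :: "nat \<times> bool \<Rightarrow> real"
  assumes "lam > 0" and "\<mu> > 0" and "\<alpha> > 0"
    and "rho lam \<mu> \<alpha> < 1"
    and "markov_chain M (generator (retrial_rate lam \<mu> \<alpha>)) X"
    and "\<And>m n k. ((\<lambda>t. measure M {\<omega> \<in> space M. X t \<omega> = (m, n, k)}) \<longlongrightarrow> q m n k) at_top"
    and "stationary_distribution (KD lam \<mu> \<alpha>) \<xi>"
  shows "\<exists>W>0. \<forall>n k.
           (\<lambda>m. rho lam \<mu> \<alpha> powi (- 2 * int m) * q m n k)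
             \<longlonglongrightarrow> W * p_vec lam \<mu> \<alpha> \<xi> (n, k)"
proof -
  note pos = assms(1-3) and stable = assms(4) and xi = assms(7)
  let ?\<rho> = "rho lam \<mu> \<alpha>"
  let ?R = "(1 / ?\<rho>)\<^sup>2"
  let ?p = "p_vec lam \<mu> \<alpha> \<xi>"
  have \<rho>: "0 < ?\<rho>" using pos by (simp add: rho_def)
  define qq where "qq = (\<lambda>(m, n, k). q m n k)"
  have lim: "((\<lambda>t. measure M {\<omega> \<in> space M. X t \<omega> = x}) \<longlongrightarrow> qq x) at_top" for x
    by (cases x) (simp add: qq_def assms(6))
  note eq = equilibrium_of_markov_chain[OF pos stable assms(5) lim]
  have qsum: "qq summable_on UNIV"
    by (rule nonneg_bounded_partial_sums_imp_summable_on[where C = 1])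
       (use eq(1,2) in \<open>auto intro: eventually_finite_subsets_at_top_weakI\<close>)
  have stat: "((\<lambda>x. qq x * generator (retrial_rate lam \<mu> \<alpha>) x y) has_sum 0) UNIV" for y
    by (rule retrial_stationary[OF pos eq(1) qsum eq(3)])
  obtain y1 where y1: "1 / ?\<rho> < y1" "summable (\<lambda>n. qq (0, n, False) * y1 ^ n)"
    using retrial_moments(2)[OF pos stable eq(1-3)] by blast
  obtain n0 k0 where "qq (0, n0, k0) \<noteq> 0" using eq(4) by blast
  then have nz: "qq (0, n0, False) \<noteq> 0"
    using idle_balance[OF stat, of 0 n0] pos by (cases k0) auto
  obtain W where W: "0 < W" "(\<lambda>m. ?R ^ m * qq (m, 0, False)) \<longlonglongrightarrow> W"
    using boundary_phase_limit[OF pos stable eq(1) stat retrial_moments(1)[OF pos stable eq(1-3)] y1 nz] by blast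
  obtain L where L: "L 0 = W" "phase_recursion ?\<rho> L"
    "\<And>n. (\<lambda>m. ?R ^ m * qq (m, n, False)) \<longlonglongrightarrow> L n"
    using phase_limits[OF pos stable eq(1) stat W(2)] by blast
  note p = p_vec_recursion[OF pos xi]
  define c where "c = W / ?p (0, False)"
  have c: "0 < c" using W p(3) by (simp add: c_def)
  have Lp: "L n = c * ?p (n, False)" for n
  proof -
    have "?p (0, False) * L n = W * ?p (n, False)"
      using phase_recursion_unique[OF \<rho> L(2) p(2), of n] by (simp add: L(1))
    then show ?thesis using p(3) by (simp add: c_def field_simps)
  qed
  have idle: "(\<lambda>m. ?R ^ m * qq (m, n, False)) \<longlonglongrightarrow> c * ?p (n, False)" for n
    using L(3)[of n] by (simp add: Lp)
  \<comment> \<open>The busy probabilities are a fixed multiple of the idle ones except on the level 0.\<close>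
  have busy: "(\<lambda>m. ?R ^ m * qq (m, n, True)) \<longlonglongrightarrow> c * ?p (n, True)" for n
  proof -
    have "(\<lambda>m. (lam + 2 * \<alpha>) / \<mu> * (?R ^ m * qq (m, n, False))) \<longlonglongrightarrow> (lam + 2 * \<alpha>) / \<mu> * (c * ?p (n, False))"
      by (intro tendsto_intros idle)
    moreover have "\<forall>\<^sub>F m in sequentially. (lam + 2 * \<alpha>) / \<mu> * (?R ^ m * qq (m, n, False)) = ?R ^ m * qq (m, n, True)"
      using eventually_gt_at_top[of 0]
    proof eventually_elim
      case (elim m)
      then have "\<mu> * qq (m, n, True) = (lam + 2 * \<alpha>) * qq (m, n, False)"
        using idle_balance[OF stat, of m n] by (simp split: if_splits)
      then have "qq (m, n, True) = (lam + 2 * \<alpha>) / \<mu> * qq (m, n, False)" using pos by (simp add: field_simps)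
      then show ?case by simp
    qed
    ultimately have "(\<lambda>m. ?R ^ m * qq (m, n, True)) \<longlonglongrightarrow> (lam + 2 * \<alpha>) / \<mu> * (c * ?p (n, False))"
      by (rule Lim_transform_eventually)
    then show ?thesis by (simp add: p(1) mult_ac)
  qed
  have powi: "?\<rho> powi (- 2 * int m) = ?R ^ m" for m
    using \<rho> by (simp add: power_int_def power_mult power_divide nat_mult_distrib inverse_eq_divide power_one_over)
  have "(\<lambda>m. ?\<rho> powi (- 2 * int m) * q m n k) \<longlonglongrightarrow> c * ?p (n, k)" for n k
    unfolding powi using idle[of n] busy[of n] by (cases k) (simp_all add: qq_def)
  with c show ?thesis by blast
qed

end
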